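(* Let $Y=(Y_i)_{i\in\mathbb{Z}}$ be a stationary ergodic sequence of real-valued random variables with common distribution function $F_Y$, and let $F_n(t)=\frac1n\sum_{i=1}^n\mathbf{1}_{Y_i\le t}$. Assume that $$\sum_{k\ge1}\sqrt{\frac{\tilde\phi(k)}{k}}<\infty\quad\text{and}\quad\int_0^\infty\sqrt{\mathbb{P}(|Y_0|>t)}\,dt<\infty .$$ Then $\{t\mapsto\sqrt n(F_n(t)-F_Y(t)),\ t\in\mathbb{R}\}$ converges in law in $\mathbf{L}^1(\lambda)$, as $n\to\infty$, to a centered Gaussian random variable with covariance function: for any $f,g\in\mathbf{L}^\infty(\lambda)$, $$\Phi_\lambda(f,g)=\int_{\mathbb{R}^2}f(s)g(t)\,C(s,t)\,dt\,ds,$$ with $$C(s,t)=F_Y(t\wedge s)-F_Y(t)F_Y(s)+2\sum_{k\ge1}\big(\mathbb{P}(Y_0\le t,Y_k\le s)-F_Y(t)F_Y(s)\big).$$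
   Context: $\lambda$ is the Lebesgue measure on $\mathbb{R}$; $\mathbf{L}^1(\lambda)$ is the space of Lebesgue-integrable real functions with norm $\int_{\mathbb{R}}|x(t)|\,dt$, with dual $\mathbf{L}^\infty(\lambda)$ acting by $f(x)=\int_{\mathbb{R}} f(t)x(t)\,dt$. The covariance function of a centered Gaussian $G$ in $\mathbf{L}^1(\lambda)$ is $(f,g)\mapsto\mathbb{E}(f(G)g(G))$. $t\wedge s$ denotes the minimum. With $\mathcal{F}_0=\sigma(Y_i,\,i\le0)$, the dependence coefficients are, for integers $k\ge0$, $$\tilde\phi(k)=\sup_{t\in\mathbb{R}}\|\mathbb{P}(Y_k\le t\mid\mathcal{F}_0)-\mathbb{P}(Y_k\le t)\|_\infty ,$$ where $\|\cdot\|_\infty$ is the essential supremum norm.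
   Formalization: The limit's covariance is stated as (Φ_λ(f,g)+Φ_λ(g,f))/2 instead of Φ_λ(f,g), since C(s,t) as printed need not be symmetric (e.g. a biased rotation chain on three states) while a covariance must be; the two agree when Φ_λ is symmetric, in particular for f=g. *)

theory Defs
  imports "HOL-Probability.Probability"
begin

section \<open>The Banach space \<open>L\<^sup>1(\<lambda>)\<close>\<close>

definition l1_eq :: "(real \<Rightarrow> real) \<Rightarrow> (real \<Rightarrow> real) \<Rightarrow> bool" where
  "l1_eq f g \<longleftrightarrow> integrable lborel f \<and> integrable lborel g \<and> (AE t in lborel. f t = g t)"

lemma l1_eq_part_equivp: "part_equivp l1_eq"
proof (rule part_equivpI)
  show "\<exists>f. l1_eq f f"
    by (rule exI[of _ "\<lambda>_. 0"]) (simp add: l1_eq_def)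
  show "symp l1_eq"
    by (rule sympI) (auto simp: l1_eq_def elim: eventually_mono)
  show "transp l1_eq"
  proof (rule transpI)
    fix f g h assume "l1_eq f g" "l1_eq g h"
    then show "l1_eq f h"
      unfolding l1_eq_def by (auto elim: eventually_elim2)
  qed
qed

text \<open>\<open>l1_class f\<close> is the equivalence class of \<open>f\<close>; it is meaningful only for integrable \<open>f\<close>.\<close>

quotient_type l1 = "real \<Rightarrow> real" / partial: l1_eq
  morphisms l1_rep l1_class
  by (rule l1_eq_part_equivp)

instantiation l1 :: real_normed_vector
begin

lift_definition zero_l1 :: l1 is "\<lambda>_. 0"
  by (simp add: l1_eq_def)

lift_definition plus_l1 :: "l1 \<Rightarrow> l1 \<Rightarrow> l1" is "\<lambda>f g t. f t + g t"
  unfolding l1_eq_def by (auto elim: eventually_elim2)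

lift_definition uminus_l1 :: "l1 \<Rightarrow> l1" is "\<lambda>f t. - f t"
  unfolding l1_eq_def by (auto elim: eventually_mono)

lift_definition minus_l1 :: "l1 \<Rightarrow> l1 \<Rightarrow> l1" is "\<lambda>f g t. f t - g t"
  unfolding l1_eq_def by (auto elim: eventually_elim2)

lift_definition scaleR_l1 :: "real \<Rightarrow> l1 \<Rightarrow> l1" is "\<lambda>c f t. c * f t"
  unfolding l1_eq_def by (auto elim: eventually_mono)

lift_definition norm_l1 :: "l1 \<Rightarrow> real" is "\<lambda>f. \<integral>t. \<bar>f t\<bar> \<partial>lborel"
  unfolding l1_eq_def by (intro integral_cong_AE) (auto elim: eventually_mono)

definition dist_l1 :: "l1 \<Rightarrow> l1 \<Rightarrow> real" where
  "dist_l1 x y = norm (x - y)"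

definition uniformity_l1 :: "(l1 \<times> l1) filter" where
  "uniformity_l1 = (INF e\<in>{0<..}. principal {(x, y). dist x y < e})"

definition open_l1 :: "l1 set \<Rightarrow> bool" where
  "open_l1 U \<longleftrightarrow> (\<forall>x\<in>U. \<forall>\<^sub>F (x', y) in uniformity. x' = x \<longrightarrow> y \<in> U)"

definition sgn_l1 :: "l1 \<Rightarrow> l1" where
  "sgn_l1 x = inverse (norm x) *\<^sub>R x"

instance
proof
  fix x y z :: l1 and a b :: real
  show "x + y + z = x + (y + z)"
    by transfer (simp add: l1_eq_def add.assoc)
  show "x + y = y + x"
    by transfer (simp add: l1_eq_def add.commute)
  show "0 + x = x"
    by transfer (simp add: l1_eq_def)
  show "- x + x = 0"
    by transfer (simp add: l1_eq_def)
  show "x - y = x + - y"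
    by transfer (simp add: l1_eq_def)
  show "a *\<^sub>R (x + y) = a *\<^sub>R x + a *\<^sub>R y"
    by transfer (simp add: l1_eq_def algebra_simps)
  show "(a + b) *\<^sub>R x = a *\<^sub>R x + b *\<^sub>R x"
    by transfer (simp add: l1_eq_def algebra_simps)
  show "a *\<^sub>R b *\<^sub>R x = (a * b) *\<^sub>R x"
    by transfer (simp add: l1_eq_def algebra_simps)
  show "1 *\<^sub>R x = x"
    by transfer (simp add: l1_eq_def)
  show "dist x y = norm (x - y)"
    by (rule dist_l1_def)
  show "sgn x = inverse (norm x) *\<^sub>R x"
    by (rule sgn_l1_def)
  show "uniformity = (INF e\<in>{0<..}. principal {(x :: l1, y). dist x y < e})"
    by (rule uniformity_l1_def)
  show "open U \<longleftrightarrow> (\<forall>x\<in>U. \<forall>\<^sub>F (x', y) in uniformity. x' = x \<longrightarrow> y \<in> U)" for U :: "l1 set"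
    by (rule open_l1_def)
  show "norm x = 0 \<longleftrightarrow> x = 0"
    by transfer (auto simp: l1_eq_def integral_nonneg_eq_0_iff_AE)
  show "norm (x + y) \<le> norm x + norm y"
  proof transfer
    fix f g :: "real \<Rightarrow> real"
    assume "l1_eq f f" "l1_eq g g"
    then have int: "integrable lborel f" "integrable lborel g"
      by (auto simp: l1_eq_def)
    have "(\<integral>t. \<bar>f t + g t\<bar> \<partial>lborel) \<le> (\<integral>t. \<bar>f t\<bar> + \<bar>g t\<bar> \<partial>lborel)"
      using int by (intro integral_mono) auto
    also have "\<dots> = (\<integral>t. \<bar>f t\<bar> \<partial>lborel) + (\<integral>t. \<bar>g t\<bar> \<partial>lborel)"
      using int by (intro Bochner_Integration.integral_add) auto
    finally show "(\<integral>t. \<bar>f t + g t\<bar> \<partial>lborel) \<le> (\<integral>t. \<bar>f t\<bar> \<partial>lborel) + (\<integral>t. \<bar>g t\<bar> \<partial>lborel)" .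
  qed
  show "norm (a *\<^sub>R x) = \<bar>a\<bar> * norm x"
    by transfer (simp add: abs_mult)
qed

end

definition Linfty :: "(real \<Rightarrow> real) set" where
  "Linfty = {f \<in> borel_measurable lborel. \<exists>c. AE t in lborel. \<bar>f t\<bar> \<le> c}"

text \<open>For \<open>f \<in> Linfty\<close> the value does not depend on the chosen representative of \<open>x\<close>.\<close>

definition Linfty_act :: "(real \<Rightarrow> real) \<Rightarrow> l1 \<Rightarrow> real" where
  "Linfty_act f x = (\<integral>t. f t * l1_rep x t \<partial>lborel)"


section \<open>Centered Gaussian laws and convergence in law\<close>

definition centered_gaussian_law :: "'b::real_normed_vector measure \<Rightarrow> bool" where
  "centered_gaussian_law \<mu> \<longleftrightarrow>
     prob_space \<mu> \<and> sets \<mu> = sets borel \<and>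
     (\<forall>\<phi> :: 'b \<Rightarrow> real. bounded_linear \<phi> \<longrightarrow>
        distr \<mu> borel \<phi> = return borel 0 \<or>
        (\<exists>\<sigma>>0. distributed \<mu> lborel \<phi> (normal_density 0 \<sigma>)))"

definition converges_in_law ::
    "'a measure \<Rightarrow> (nat \<Rightarrow> 'a \<Rightarrow> 'b::topological_space) \<Rightarrow> 'b measure \<Rightarrow> bool" where
  "converges_in_law M X \<mu> \<longleftrightarrow>
     (\<forall>n. X n \<in> borel_measurable M) \<and>
     (\<forall>h :: 'b \<Rightarrow> real. continuous_on UNIV h \<and> bounded (range h) \<longrightarrow>
        (\<lambda>n. \<integral>\<omega>. h (X n \<omega>) \<partial>M) \<longlonglongrightarrow> (\<integral>x. h x \<partial>\<mu>))"


section \<open>Stationary ergodic sequences and dependence coefficients\<close>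

abbreviation path_space :: "(int \<Rightarrow> real) measure" where
  "path_space \<equiv> PiM UNIV (\<lambda>_. borel)"

definition stationary :: "'a measure \<Rightarrow> (int \<Rightarrow> 'a \<Rightarrow> real) \<Rightarrow> bool" where
  "stationary M Y \<longleftrightarrow>
     distr M path_space (\<lambda>\<omega> i. Y (i + 1) \<omega>) = distr M path_space (\<lambda>\<omega> i. Y i \<omega>)"

definition ergodic :: "'a measure \<Rightarrow> (int \<Rightarrow> 'a \<Rightarrow> real) \<Rightarrow> bool" where
  "ergodic M Y \<longleftrightarrow>
     (\<forall>A \<in> sets path_space. (\<lambda>y i. y (i + 1)) -` A = A \<longrightarrow>
        measure M {\<omega> \<in> space M. (\<lambda>i. Y i \<omega>) \<in> A} \<in> {0, 1})"

definition past :: "'a measure \<Rightarrow> (int \<Rightarrow> 'a \<Rightarrow> real) \<Rightarrow> 'a measure" where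
  "past M Y = sigma (space M) {Y i -` B \<inter> space M | i B. i \<le> 0 \<and> B \<in> sets borel}"

definition distr_fun :: "'a measure \<Rightarrow> (int \<Rightarrow> 'a \<Rightarrow> real) \<Rightarrow> real \<Rightarrow> real" where
  "distr_fun M Y = cdf (distr M borel (Y 0))"

text \<open>The supremum is taken in the extended reals, where it lies in \<open>[0, 1]\<close> for a
  probability measure, so passing back to the reals loses nothing.\<close>

definition phi_coeff :: "'a measure \<Rightarrow> (int \<Rightarrow> 'a \<Rightarrow> real) \<Rightarrow> nat \<Rightarrow> real" where
  "phi_coeff M Y k = real_of_ereal (SUP t. esssup M (\<lambda>\<omega>. ereal
     \<bar>real_cond_exp M (past M Y) (indicat_real {\<omega>' \<in> space M. Y (int k) \<omega>' \<le> t}) \<omega>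
       - measure M {\<omega>' \<in> space M. Y (int k) \<omega>' \<le> t}\<bar>))"


section \<open>The empirical process and its limiting covariance\<close>

definition empirical_df :: "(int \<Rightarrow> 'a \<Rightarrow> real) \<Rightarrow> nat \<Rightarrow> 'a \<Rightarrow> real \<Rightarrow> real" where
  "empirical_df Y n \<omega> t = 1 / real n * (\<Sum>i=1..n. indicat_real {..t} (Y (int i) \<omega>))"

definition empirical_process ::
    "'a measure \<Rightarrow> (int \<Rightarrow> 'a \<Rightarrow> real) \<Rightarrow> nat \<Rightarrow> 'a \<Rightarrow> real \<Rightarrow> real" where
  "empirical_process M Y n \<omega> t = sqrt (real n) * (empirical_df Y n \<omega> t - distr_fun M Y t)"

definition lag_cov :: "'a measure \<Rightarrow> (int \<Rightarrow> 'a \<Rightarrow> real) \<Rightarrow> nat \<Rightarrow> real \<Rightarrow> real \<Rightarrow> real" where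
  "lag_cov M Y k s t =
     measure M {\<omega> \<in> space M. Y 0 \<omega> \<le> t \<and> Y (int k) \<omega> \<le> s} - distr_fun M Y t * distr_fun M Y s"

definition C_kernel :: "'a measure \<Rightarrow> (int \<Rightarrow> 'a \<Rightarrow> real) \<Rightarrow> real \<Rightarrow> real \<Rightarrow> real" where
  "C_kernel M Y s t =
     distr_fun M Y (min t s) - distr_fun M Y t * distr_fun M Y s
     + 2 * (\<Sum>k. lag_cov M Y (Suc k) s t)"

definition Phi_integrand ::
    "'a measure \<Rightarrow> (int \<Rightarrow> 'a \<Rightarrow> real) \<Rightarrow> (real \<Rightarrow> real) \<Rightarrow> (real \<Rightarrow> real) \<Rightarrow> real \<times> real \<Rightarrow> real" where
  "Phi_integrand M Y f g = (\<lambda>(s, t). f s * g t * C_kernel M Y s t)"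

definition Phi ::
    "'a measure \<Rightarrow> (int \<Rightarrow> 'a \<Rightarrow> real) \<Rightarrow> (real \<Rightarrow> real) \<Rightarrow> (real \<Rightarrow> real) \<Rightarrow> real" where
  "Phi M Y f g = (\<integral>p. Phi_integrand M Y f g p \<partial>(lborel \<Otimes>\<^sub>M lborel))"

text \<open>\<open>C_kernel\<close> adds the lagged covariances in one direction of time with weight 2, hence need
  not be symmetric in \<open>(s, t)\<close> unless the sequence is time-reversible (a stationary three-state
  Markov chain with a preferred direction of rotation gives an asymmetric kernel), whereas a
  covariance function is symmetric. Only the diagonal \<open>Phi f f\<close> is then a variance; the covariance
  belonging to these variances is the symmetric part of \<open>Phi\<close>, which is \<open>Phi\<close> itself whenever
  \<open>C_kernel\<close> is symmetric.\<close>

definition Phi_sym ::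
    "'a measure \<Rightarrow> (int \<Rightarrow> 'a \<Rightarrow> real) \<Rightarrow> (real \<Rightarrow> real) \<Rightarrow> (real \<Rightarrow> real) \<Rightarrow> real" where
  "Phi_sym M Y f g = (Phi M Y f g + Phi M Y g f) / 2"

end

theory Submission
  imports Defs "HOL-Real_Asymp.Real_Asymp"
begin

text \<open>For a linear combination \<open>Z\<close> of centered indicators \<open>1{Y\<^sub>0 \<le> t} - F t\<close>, the predictions of \<open>Z \<circ> T\<^sup>k\<close> from the
  past are bounded by a multiple of the dependence coefficients, which are summable. Hence \<open>Z\<close> is a bounded
  martingale difference plus a bounded coboundary (Gordin), and McLeish's product argument together with
  the ergodic theorem gives the central limit theorem for the finite-dimensional distributions.

  The variance of the increment over \<open>]s, t]\<close> of the normalized empirical process is at most \<open>c (F t - F s)\<close>, uniformly in \<open>n\<close>.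
  The expected \<open>L\<^sup>1\<close>-distance between the process and its values sampled on a grid is therefore at most the
  integral of \<open>sqrt (c (F t' - F t))\<close>, where \<open>t'\<close> is the grid point following \<open>t\<close>, plus a tail of \<open>\<integral> sqrt (P (\<bar>Y\<^sub>0\<bar> > t)) dt\<close>, and the
  convergence in law in \<open>L\<^sup>1\<close> reduces to that of finitely many coordinates.

  The limit is \<open>\<Sum>m. \<xi>\<^sub>m c\<^sub>m\<close> with independent standard normal \<open>\<xi>\<^sub>m\<close>, where the functions \<open>c\<^sub>m\<close> are the columns of the
  Cholesky factorization of the symmetrized covariance kernel with the rational numbers as pivots; the
  kernel is the full sum \<open>\<Sum>m. c\<^sub>m s * c\<^sub>m t\<close> because \<open>F\<close> is continuous from the right.

  Summability of the coefficients suffices for all this except for the integrability of the covariance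
  kernel before symmetrization, where the square roots in the hypothesis enter through dyadic blocks.\<close>

section \<open>Integrable functions modulo null sets, and convergence in law\<close>

text \<open>No compactness of laws on \<open>L^1\<close> enters. The Gaussian limit is built
  beforehand, and the expectations of a Lipschitz test function under the empirical process and
  under the partial sums of the Gaussian series are compared through their values on one grid. Both
  families obey the same second moment bounds, so the grid error is common to both and uniform in
  the index.

  The coefficients control the future given the past. Sums are therefore run along the shift
  \<open>y \<mapsto> (\<lambda>i. y (i - 1))\<close>, which keeps functions of the past functions of
  the past; stationarity turns time around at the end.

  For the kernel before symmetrization positivity is of no help. The plain covariance bound carries
  the summable rate but the tail of one variable only; the bound through second moments carries both
  tails but costs \<open>sqrt (\<psi> k)\<close>, whose sum may diverge. Pairing a whole block of
  past coordinates with a future one gains the missing factor, because the standard deviation of a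
  block of length \<open>n\<close> grows only like \<open>sqrt n\<close>.\<close>

lemma l1_class_eq_iff:
  assumes "integrable lborel f" "integrable lborel g"
  shows "l1_class f = l1_class g \<longleftrightarrow> (AE t in lborel. f t = g t)"
proof -
  have "l1_eq f f" "l1_eq g g" using assms by (auto simp: l1_eq_def)
  then show ?thesis
    using Quotient3_rel[OF Quotient3_l1, of f g] assms by (auto simp: l1_eq_def)
qed

lemma integrable_l1_rep: "integrable lborel (l1_rep x)"
  using Quotient3_rep_reflp[OF Quotient3_l1, of x] by (simp add: l1_eq_def)

lemma l1_class_rep: "l1_class (l1_rep x) = x"
  using Quotient3_abs_rep[OF Quotient3_l1] by simp

lemma l1_rep_class:
  assumes "integrable lborel f"
  shows "AE t in lborel. l1_rep (l1_class f) t = f t"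
  using l1_class_eq_iff[OF integrable_l1_rep assms, of "l1_class f"] by (simp add: l1_class_rep)

lemma norm_l1_class:
  assumes "integrable lborel f"
  shows "norm (l1_class f) = (\<integral>t. \<bar>f t\<bar> \<partial>lborel)"
  using assms by (simp add: norm_l1.abs_eq l1_eq_def)

lemma l1_class_add:
  assumes "integrable lborel f" "integrable lborel g"
  shows "l1_class f + l1_class g = l1_class (\<lambda>t. f t + g t)"
  using assms by (simp add: plus_l1.abs_eq l1_eq_def)

lemma l1_class_diff:
  assumes "integrable lborel f" "integrable lborel g"
  shows "l1_class f - l1_class g = l1_class (\<lambda>t. f t - g t)"
  using assms by (simp add: minus_l1.abs_eq l1_eq_def)

lemma l1_class_scaleR:
  assumes "integrable lborel f"
  shows "c *\<^sub>R l1_class f = l1_class (\<lambda>t. c * f t)"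
  using assms by (simp add: scaleR_l1.abs_eq l1_eq_def)

lemma l1_class_sum:
  assumes "\<And>i. i \<in> I \<Longrightarrow> integrable lborel (f i)"
  shows "(\<Sum>i\<in>I. l1_class (f i)) = l1_class (\<lambda>t. \<Sum>i\<in>I. f i t)"
  using assms
  by (induction I rule: infinite_finite_induct) (auto simp: l1_class_add zero_l1_def)

lemma norm_l1_class_diff:
  assumes "integrable lborel f" "integrable lborel g"
  shows "norm (l1_class f - l1_class g) = (\<integral>t. \<bar>f t - g t\<bar> \<partial>lborel)"
  using assms by (simp add: l1_class_diff norm_l1_class)

lemma integrable_Linfty_mult:
  assumes "f \<in> Linfty" "integrable lborel x"
  shows "integrable lborel (\<lambda>t. f t * x t)"
proof -
  obtain c where c: "AE t in lborel. \<bar>f t\<bar> \<le> c" and [measurable]: "f \<in> borel_measurable lborel"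
    using assms(1) by (auto simp: Linfty_def)
  have [measurable]: "x \<in> borel_measurable lborel" using assms(2) by auto
  show ?thesis
  proof (rule Bochner_Integration.integrable_bound)
    show "integrable lborel (\<lambda>t. c * x t)" using assms(2) by simp
    show "AE t in lborel. norm (f t * x t) \<le> norm (c * x t)"
      using c by eventually_elim (auto simp: abs_mult intro!: mult_right_mono)
  qed simp
qed

lemma Linfty_act_class:
  assumes "f \<in> Linfty" "integrable lborel x"
  shows "Linfty_act f (l1_class x) = (\<integral>t. f t * x t \<partial>lborel)"
  unfolding Linfty_act_def
proof (rule integral_cong_AE)
  have [measurable]: "f \<in> borel_measurable lborel" using assms(1) by (auto simp: Linfty_def)
  have [measurable]: "x \<in> borel_measurable lborel" "l1_rep (l1_class x) \<in> borel_measurable lborel"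
    using assms(2) integrable_l1_rep by auto
  show "(\<lambda>t. f t * l1_rep (l1_class x) t) \<in> borel_measurable lborel"
    "(\<lambda>t. f t * x t) \<in> borel_measurable lborel" by measurable
  show "AE t in lborel. f t * l1_rep (l1_class x) t = f t * x t"
    using l1_rep_class[OF assms(2)] by eventually_elim simp
qed

lemma bounded_linear_Linfty_act:
  assumes f: "f \<in> Linfty"
  shows "bounded_linear (Linfty_act f)"
proof -
  obtain c where c: "AE t in lborel. \<bar>f t\<bar> \<le> c" and [measurable]: "f \<in> borel_measurable lborel"
    using f by (auto simp: Linfty_def)
  show ?thesis
  proof (rule bounded_linear_intro)
    fix x y :: l1 and r :: real
    note ix = integrable_l1_rep[of x] and iy = integrable_l1_rep[of y]
    have "x + y = l1_class (\<lambda>t. l1_rep x t + l1_rep y t)"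
      using l1_class_add[OF ix iy] by (simp add: l1_class_rep)
    then show "Linfty_act f (x + y) = Linfty_act f x + Linfty_act f y"
      using f ix iy integrable_Linfty_mult[OF f ix] integrable_Linfty_mult[OF f iy]
      by (simp add: Linfty_act_class) (simp add: Linfty_act_def distrib_left)
    have "r *\<^sub>R x = l1_class (\<lambda>t. r * l1_rep x t)"
      using l1_class_scaleR[OF ix] by (simp add: l1_class_rep)
    then show "Linfty_act f (r *\<^sub>R x) = r *\<^sub>R Linfty_act f x"
      using f ix by (simp add: Linfty_act_class) (simp add: Linfty_act_def mult.left_commute)
    have "\<bar>Linfty_act f x\<bar> \<le> (\<integral>t. \<bar>f t * l1_rep x t\<bar> \<partial>lborel)"
      unfolding Linfty_act_def by (rule integral_abs_bound)
    also have "\<dots> \<le> (\<integral>t. c * \<bar>l1_rep x t\<bar> \<partial>lborel)"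
    proof (rule integral_mono_AE)
      show "AE t in lborel. \<bar>f t * l1_rep x t\<bar> \<le> c * \<bar>l1_rep x t\<bar>"
        using c by eventually_elim (auto simp: abs_mult intro!: mult_right_mono)
    qed (use integrable_Linfty_mult[OF f ix] ix in auto)
    also have "\<dots> = norm x * c"
      using norm_l1_class[OF ix] by (simp add: l1_class_rep)
    finally show "norm (Linfty_act f x) \<le> norm x * c" by simp
  qed
qed

text \<open>Riesz-Fischer: integrating the sum of the absolute values term by term shows that the
  series converges absolutely at almost every point. The same sum dominates the partial sums, so the
  pointwise limit is also the limit in norm. The construction of the Gaussian variable rests on this
  completeness.\<close>

lemma l1_summable_norm_cancel:
  fixes x :: "nat \<Rightarrow> l1"
  assumes "summable (\<lambda>n. norm (x n))"
  shows "summable x"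
proof -
  define f where "f n = l1_rep (x n)" for n
  have x: "x n = l1_class (f n)" for n by (simp add: f_def l1_class_rep)
  have int: "integrable lborel (f n)" for n by (simp add: f_def integrable_l1_rep)
  have nx: "norm (x n) = (\<integral>t. norm (f n t) \<partial>lborel)" for n
    using int by (simp add: x norm_l1_class)
  have "(\<Sum>n. \<integral>\<^sup>+ t. norm (f n t) \<partial>lborel) = (\<Sum>n. ennreal (norm (x n)))"
    using int by (simp add: nx nn_integral_eq_integral)
  also have "\<dots> < \<infinity>"
    using assms by (metis ennreal_suminf_neq_top norm_ge_zero infinity_ennreal_def less_top)
  finally have fin: "(\<integral>\<^sup>+ t. (\<Sum>n. ennreal (norm (f n t))) \<partial>lborel) < \<infinity>"
    using int by (subst nn_integral_suminf) auto
  have "AE t in lborel. (\<Sum>n. ennreal (norm (f n t))) \<noteq> \<infinity>"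
    using fin int by (intro nn_integral_PInf_AE) auto
  then have ae: "AE t in lborel. summable (\<lambda>n. norm (f n t))"
    by eventually_elim (simp add: summable_suminf_not_top)
  have sm: "summable (\<lambda>n. \<integral>t. norm (f n t) \<partial>lborel)" using assms by (simp add: nx)
  define s where "s t = (\<Sum>n. f n t)" for t
  have ints: "integrable lborel s" unfolding s_def by (rule integrable_suminf[OF int ae sm])
  have "(\<lambda>n. (\<Sum>i<n. x i)) \<longlonglongrightarrow> l1_class s"
  proof (rule Lim_null[THEN iffD2], rule tendsto_norm_zero_cancel)
    have "norm ((\<Sum>i<n. x i) - l1_class s) = (\<integral>t. \<bar>(\<Sum>i<n. f i t) - s t\<bar> \<partial>lborel)" for n
      using int ints by (simp add: x l1_class_sum norm_l1_class_diff)
    moreover have "(\<lambda>n. \<integral>t. \<bar>(\<Sum>i<n. f i t) - s t\<bar> \<partial>lborel) \<longlonglongrightarrow> (\<integral>(t::real). (0::real) \<partial>lborel)"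
    proof (rule integral_dominated_convergence)
      have [measurable]: "f n \<in> borel_measurable lborel" "s \<in> borel_measurable lborel" for n
        using int ints by auto
      show "(\<lambda>t. \<bar>(\<Sum>i<n. f i t) - s t\<bar>) \<in> borel_measurable lborel" for n by measurable
      show "integrable lborel (\<lambda>t. \<Sum>n. norm (f n t))"
        using int ae sm by (intro integrable_suminf) auto
      show "AE t in lborel. (\<lambda>n. \<bar>(\<Sum>i<n. f i t) - s t\<bar>) \<longlonglongrightarrow> 0"
        using ae
      proof eventually_elim
        case (elim t)
        have "(\<lambda>n. \<Sum>i<n. f i t) \<longlonglongrightarrow> s t"
          unfolding s_def using summable_norm_cancel[OF elim] summable_LIMSEQ by blast
        then show ?case using Lim_null tendsto_rabs_zero by blast
      qed
      show "AE t in lborel. norm \<bar>(\<Sum>i<n. f i t) - s t\<bar> \<le> (\<Sum>n. norm (f n t))" for n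
        using ae
      proof eventually_elim
        case (elim t)
        have su: "summable (\<lambda>n. f n t)" using summable_norm_cancel[OF elim] .
        have "s t - (\<Sum>i<n. f i t) = (\<Sum>i. f (i + n) t)"
          unfolding s_def using suminf_split_initial_segment[OF su, of n] by simp
        then have "\<bar>(\<Sum>i<n. f i t) - s t\<bar> = norm (\<Sum>i. f (i + n) t)" by simp
        also have "\<dots> \<le> (\<Sum>i. norm (f (i + n) t))"
          by (rule summable_norm) (use summable_ignore_initial_segment[OF elim] in simp)
        also have "\<dots> \<le> (\<Sum>n. norm (f n t))"
          using suminf_split_initial_segment[OF elim, of n] by (simp add: sum_nonneg)
        finally show ?case by simp
      qed
    qed simp
    ultimately show "(\<lambda>n. norm ((\<Sum>i<n. x i) - l1_class s)) \<longlonglongrightarrow> 0" by simp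
  qed
  then show ?thesis unfolding summable_def sums_def by blast
qed

text \<open>The approximants are \<open>x \<mapsto> INF y. h y + k * dist x y\<close>.\<close>

lemma lipschitz_approx_below:
  fixes h :: "'b::metric_space \<Rightarrow> real"
  assumes cont: "continuous_on UNIV h" and bd: "\<And>x. \<bar>h x\<bar> \<le> B"
  obtains g :: "nat \<Rightarrow> 'b \<Rightarrow> real" where
    "\<And>k x y. \<bar>g k x - g k y\<bar> \<le> real k * dist x y"
    "\<And>k x. \<bar>g k x\<bar> \<le> B" "\<And>k x. g k x \<le> h x" "\<And>x. (\<lambda>k. g k x) \<longlonglongrightarrow> h x"
proof
  define g where "g k x = (INF y. h y + real k * dist x y)" for k x
  have low: "- B \<le> h y + real k * dist x y" for k x y
    using bd[of y] by (smt (verit) mult_nonneg_nonneg of_nat_0_le_iff zero_le_dist)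
  have bb: "bdd_below (range (\<lambda>y. h y + real k * dist x y))" for k x
    using low by (intro bdd_belowI2) auto
  have le: "g k x \<le> h y + real k * dist x y" for k x y
    unfolding g_def by (rule cINF_lower[OF bb]) simp
  have one: "g k x - real k * dist x y \<le> g k y" for k x y
    unfolding g_def[of k y]
  proof (rule cINF_greatest)
    fix z
    have "real k * dist x z \<le> real k * (dist x y + dist y z)"
      by (intro mult_left_mono dist_triangle) auto
    then show "g k x - real k * dist x y \<le> h z + real k * dist y z"
      using le[of k x z] by (simp add: algebra_simps)
  qed simp
  show "\<bar>g k x - g k y\<bar> \<le> real k * dist x y" for k x y
    using one[of k x y] one[of k y x] by (simp add: dist_commute abs_le_iff)
  show gh: "g k x \<le> h x" for k x using le[of k x x] by simp
  have gl: "- B \<le> g k x" for k x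
    unfolding g_def by (rule cINF_greatest) (use low in auto)
  show "\<bar>g k x\<bar> \<le> B" for k x using gh[of k x] gl[of k x] bd[of x] by simp
  show "(\<lambda>k. g k x) \<longlonglongrightarrow> h x" for x
  proof (rule LIMSEQ_I)
    fix e :: real assume e: "0 < e"
    then obtain d where d: "d > 0" "\<And>y. dist y x < d \<Longrightarrow> dist (h y) (h x) < e / 2"
      using cont unfolding continuous_on_iff by (metis UNIV_I half_gt_zero)
    \<comment> \<open>Beyond distance \<open>d\<close> the penalty \<open>k * dist x y\<close>
      exceeds the oscillation \<open>2 * B\<close> of \<open>h\<close>, so only points within
      \<open>d\<close> of \<open>x\<close>, where \<open>h\<close> is close to \<open>h x\<close>,
      matter for the infimum.\<close>
    obtain N :: nat where N: "2 * B < real N * d" using d reals_Archimedean3 by blast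
    have "norm (g k x - h x) < e" if "k \<ge> N" for k
    proof -
      have "h x - e / 2 \<le> g k x" unfolding g_def
      proof (rule cINF_greatest)
        fix y
        show "h x - e / 2 \<le> h y + real k * dist x y"
        proof (cases "dist y x < d")
          case True
          then have "\<bar>h y - h x\<bar> < e / 2" using d(2) by (simp add: dist_real_def)
          moreover have "0 \<le> real k * dist x y" by simp
          ultimately show ?thesis by linarith
        next
          case False
          have "real N * d \<le> real k * dist x y"
            using that False d by (intro mult_mono) (auto simp: dist_commute)
          then show ?thesis using N bd[of x] bd[of y] e by linarith
        qed
      qed simp
      then show ?thesis using gh[of k x] e by simp
    qed
    then show "\<exists>N. \<forall>k\<ge>N. norm (g k x - h x) < e" by blast
  qed
qed

lemma continuous_on_of_dist_le:
  fixes h :: "'b::metric_space \<Rightarrow> real"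
  assumes "\<And>x y. \<bar>h x - h y\<bar> \<le> L * dist x y"
  shows "continuous_on UNIV h"
proof (rule lipschitz_on_continuous_on)
  have "\<bar>h x - h y\<bar> \<le> \<bar>L\<bar> * dist x y" for x y
    using assms[of x y] mult_right_mono[OF abs_ge_self[of L], of "dist x y"] by simp
  then show "\<bar>L\<bar>-lipschitz_on UNIV h" by (auto simp: lipschitz_on_def dist_real_def)
qed

text \<open>Minorants suffice: a bounded continuous \<open>h\<close> is the pointwise limit of
  bounded Lipschitz functions below it. By dominated convergence under \<open>\<mu>\<close> these
  bound the lower limit of the expectations of \<open>h\<close>, and the same for \<open>- h\<close>
  bounds the upper limit.\<close>

lemma converges_in_law_lipschitzI:
  fixes X :: "nat \<Rightarrow> 'a \<Rightarrow> 'b::metric_space"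
  assumes M: "prob_space M" and mu: "prob_space \<mu>" "sets \<mu> = sets borel"
    and X: "\<And>n. X n \<in> borel_measurable M"
    and lip: "\<And>h L B. (\<And>x y. \<bar>h x - h y\<bar> \<le> L * dist x y) \<Longrightarrow> (\<And>x. \<bar>h x\<bar> \<le> B) \<Longrightarrow>
      (\<lambda>n. \<integral>\<omega>. h (X n \<omega>) \<partial>M) \<longlonglongrightarrow> (\<integral>x. h x \<partial>\<mu>)"
  shows "converges_in_law M X \<mu>"
proof -
  interpret M: prob_space M by fact
  interpret mu: prob_space \<mu> by fact
  have int_mu: "integrable \<mu> h" if "continuous_on UNIV h" "\<And>x. \<bar>h x\<bar> \<le> B" for h :: "'b \<Rightarrow> real" and B
  proof (rule mu.integrable_const_bound[of _ B])
    show "h \<in> borel_measurable \<mu>"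
      using borel_measurable_continuous_onI[OF that(1)] by (simp add: measurable_cong_sets[OF mu(2) refl])
  qed (use that in auto)
  have int_M: "integrable M (\<lambda>\<omega>. h (X n \<omega>))"
    if "continuous_on UNIV h" "\<And>x. \<bar>h x\<bar> \<le> B" for h :: "'b \<Rightarrow> real" and B n
  proof (rule M.integrable_const_bound[of _ B])
    show "(\<lambda>\<omega>. h (X n \<omega>)) \<in> borel_measurable M"
      using borel_measurable_continuous_onI[OF that(1)] X by (rule measurable_compose_rev)
  qed (use that in auto)
  have low: "eventually (\<lambda>n. (\<integral>x. h x \<partial>\<mu>) - e < (\<integral>\<omega>. h (X n \<omega>) \<partial>M)) sequentially"
    if h: "continuous_on UNIV h" "\<And>x. \<bar>h x\<bar> \<le> B" and e: "e > 0" for h :: "'b \<Rightarrow> real" and B e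
  proof -
    obtain g where g: "\<And>k x y. \<bar>g k x - g k y\<bar> \<le> real k * dist x y"
      "\<And>k x. \<bar>g k x\<bar> \<le> B" "\<And>k x. g k x \<le> h x" "\<And>x. (\<lambda>k. g k x) \<longlonglongrightarrow> h x"
      using lipschitz_approx_below[OF h] by blast
    have gc: "continuous_on UNIV (g k)" for k by (rule continuous_on_of_dist_le[OF g(1)])
    have "(\<lambda>k. \<integral>x. g k x \<partial>\<mu>) \<longlonglongrightarrow> (\<integral>x. h x \<partial>\<mu>)"
    proof (rule integral_dominated_convergence[where w="\<lambda>_. B"])
      show "h \<in> borel_measurable \<mu>" using int_mu[OF h] by auto
      show "g k \<in> borel_measurable \<mu>" for k using int_mu[OF gc g(2)] by auto
    qed (use g in auto)
    then have "eventually (\<lambda>k. (\<integral>x. h x \<partial>\<mu>) - e < (\<integral>x. g k x \<partial>\<mu>)) sequentially"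
      using e by (intro order_tendstoD) auto
    then obtain k where k: "(\<integral>x. h x \<partial>\<mu>) - e < (\<integral>x. g k x \<partial>\<mu>)"
      using eventually_happens trivial_limit_sequentially by blast
    have "eventually (\<lambda>n. (\<integral>x. h x \<partial>\<mu>) - e < (\<integral>\<omega>. g k (X n \<omega>) \<partial>M)) sequentially"
      by (rule order_tendstoD(1)[OF lip[OF g(1) g(2)] k])
    then show ?thesis
    proof eventually_elim
      case (elim n)
      have "(\<integral>\<omega>. g k (X n \<omega>) \<partial>M) \<le> (\<integral>\<omega>. h (X n \<omega>) \<partial>M)"
        by (intro integral_mono int_M[OF gc g(2)] int_M[OF h] g)
      then show ?case using elim by simp
    qed
  qed
  have "(\<lambda>n. \<integral>\<omega>. h (X n \<omega>) \<partial>M) \<longlonglongrightarrow> (\<integral>x. h x \<partial>\<mu>)"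
    if h: "continuous_on UNIV h" "bounded (range h)" for h :: "'b \<Rightarrow> real"
  proof -
    obtain B where B: "\<And>x. \<bar>h x\<bar> \<le> B" using h(2) by (auto simp: bounded_iff)
    show ?thesis
    proof (rule order_tendstoI)
      fix a assume "a < (\<integral>x. h x \<partial>\<mu>)"
      then show "eventually (\<lambda>n. a < (\<integral>\<omega>. h (X n \<omega>) \<partial>M)) sequentially"
        using low[OF h(1) B, of "(\<integral>x. h x \<partial>\<mu>) - a"] by simp
    next
      fix a assume "(\<integral>x. h x \<partial>\<mu>) < a"
      then show "eventually (\<lambda>n. (\<integral>\<omega>. h (X n \<omega>) \<partial>M) < a) sequentially"
        using low[of "\<lambda>x. - h x" B "a - (\<integral>x. h x \<partial>\<mu>)"] h(1) B by (simp add: continuous_on_minus)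
    qed
  qed
  then show ?thesis unfolding converges_in_law_def using X by blast
qed

section \<open>The ergodic theorem and a martingale central limit theorem\<close>

text \<open>Triviality is assumed for exactly invariant sets, so the events to which it is applied
  have to be invariant pointwise and not merely up to null sets.\<close>

locale ergodic_system = prob_space P for P :: "'a measure" +
  fixes B :: "'a \<Rightarrow> 'a"
  assumes B_meas [measurable]: "B \<in> measurable P P"
    and B_pres: "distr P P B = P"
    and B_erg: "\<And>A. A \<in> sets P \<Longrightarrow> B -` A \<inter> space P = A \<Longrightarrow> prob A = 0 \<or> prob A = 1"
begin

lemma B_pow_meas [measurable]: "(B ^^ j) \<in> measurable P P"
  by (induction j) (auto intro: measurable_comp)

lemma B_pow_pres: "distr P P (B ^^ j) = P"
proof (induction j)
  case (Suc j)
  have "distr P P (B ^^ Suc j) = distr (distr P P (B ^^ j)) P B"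
    by (subst distr_distr) auto
  then show ?case by (simp only: Suc B_pres)
qed (simp add: distr_id)

lemma integral_B_pow:
  fixes f :: "'a \<Rightarrow> 'c::{banach, second_countable_topology}"
  assumes "f \<in> borel_measurable P"
  shows "(\<integral>y. f ((B ^^ j) y) \<partial>P) = (\<integral>y. f y \<partial>P)"
  using integral_distr[OF B_pow_meas assms, of j] by (simp add: B_pow_pres)

lemma integral_B:
  fixes f :: "'a \<Rightarrow> 'c::{banach, second_countable_topology}"
  assumes "f \<in> borel_measurable P"
  shows "(\<integral>y. f (B y) \<partial>P) = (\<integral>y. f y \<partial>P)"
  using integral_B_pow[OF assms, of 1] by simp

lemma B_space: "y \<in> space P \<Longrightarrow> (B ^^ j) y \<in> space P"
  using measurable_space[OF B_pow_meas] .

text \<open>Cut an orbit into blocks of length at most \<open>L\<close> along which the average of \<open>f\<close> exceeds \<open>c\<close>;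
  on the exceptional set \<open>D\<close> where no such block starts, \<open>f\<close> is raised above \<open>c\<close>.\<close>

lemma le_integral_of_good_blocks:
  fixes f :: "'a \<Rightarrow> real"
  assumes f [measurable]: "f \<in> borel_measurable P" and bd: "\<And>y. \<bar>f y\<bar> \<le> C"
    and ae: "AE y in P. \<exists>n\<ge>1. (\<Sum>j<n. f ((B ^^ j) y)) > real n * c"
  shows "c \<le> (\<integral>y. f y \<partial>P)"
proof -
  define S where "S n y = (\<Sum>j<n. f ((B ^^ j) y))" for n y
  have [measurable]: "S n \<in> borel_measurable P" for n
    unfolding S_def by measurable
  have C: "0 \<le> C" using bd by (metis abs_ge_zero order_trans)
  define D where "D L = {y \<in> space P. \<forall>n\<in>{1..L}. S n y \<le> real n * c}" for L :: nat
  have [measurable]: "D L \<in> sets P" for L unfolding D_def by measurable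
  have intf: "integrable P f" by (rule integrable_const_bound[of _ C]) (use bd in auto)
  have main: "c \<le> (\<integral>y. f y \<partial>P) + (C + \<bar>c\<bar>) * prob (D L)" for L
  proof -
    define f' where "f' y = f y + (C + \<bar>c\<bar>) * indicator (D L) y" for y
    have [measurable]: "f' \<in> borel_measurable P" unfolding f'_def by measurable
    define S' where "S' n y = (\<Sum>j<n. f' ((B ^^ j) y))" for n y
    have ff': "f y \<le> f' y" for y using C by (auto simp: f'_def indicator_def)
    have SS': "S n y \<le> S' n y" for n y unfolding S_def S'_def by (intro sum_mono ff')
    have add: "S' (m + n) y = S' m y + S' n ((B ^^ m) y)" for m n y
    proof -
      have "S' (m + n) y = S' m y + (\<Sum>j<n. f' ((B ^^ (m + j)) y))"
        unfolding S'_def by (simp add: sum.lessThan_Suc_shift sum_up_index_split lessThan_atLeast0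
          sum.atLeastLessThan_shift_0[of _ m "m + n"] flip: sum.atLeastLessThan_concat[of 0 m "m + n"])
      also have "(\<Sum>j<n. f' ((B ^^ (m + j)) y)) = S' n ((B ^^ m) y)"
        unfolding S'_def by (intro sum.cong refl) (simp add: funpow_add add.commute)
      finally show ?thesis .
    qed
    \<comment> \<open>A lower bound along the orbit that loses only a term independent of
      \<open>n\<close>: complete blocks have average at least \<open>c\<close>, and the remainder at
      the end, of length at most \<open>L\<close>, costs at most
      \<open>L * (C + \<bar>c\<bar>)\<close>.\<close>
    have claim: "y \<in> space P \<Longrightarrow> real n * c - real L * (C + \<bar>c\<bar>) \<le> S' n y" for n y
    proof (induction n arbitrary: y rule: less_induct)
      case (less n)
      show ?case
      proof (cases "n \<le> L")
        case True
        have "- (real n * C) = (\<Sum>j<n. - C)" by simp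
        also have "\<dots> \<le> S n y" unfolding S_def
          by (intro sum_mono) (use bd in \<open>auto simp: abs_le_iff minus_le_iff\<close>)
        finally have "- (real n * C) \<le> S' n y" using SS' order_trans by blast
        moreover have "real n * (C + \<bar>c\<bar>) \<le> real L * (C + \<bar>c\<bar>)"
          using True C by (intro mult_right_mono) auto
        moreover have "real n * c \<le> real n * \<bar>c\<bar>" by (intro mult_left_mono) auto
        ultimately show ?thesis by (simp add: algebra_simps)
      next
        case False
        show ?thesis
        proof (cases "y \<in> D L")
          case True
          \<comment> \<open>On \<open>D L\<close> the raised value makes the single point a block,
            since \<open>- C + (C + \<bar>c\<bar>) \<ge> c\<close>.\<close>
          have "c \<le> f' y" using True bd[of y] by (auto simp: f'_def abs_le_iff)
          moreover have "S' n y = f' y + S' (n - 1) (B y)"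
            using add[of 1 "n - 1" y] False by (simp add: S'_def)
          moreover have "real (n - 1) * c - real L * (C + \<bar>c\<bar>) \<le> S' (n - 1) (B y)"
            using less.IH[of "n - 1" "B y"] False B_space[OF less.prems, of 1] by simp
          moreover have "real n * c = c + real (n - 1) * c"
            using False by (simp add: of_nat_diff algebra_simps)
          ultimately show ?thesis by linarith
        next
          case nD: False
          then obtain m where m: "1 \<le> m" "m \<le> L" "S m y > real m * c"
            using less.prems by (auto simp: D_def not_le)
          have "S' n y = S' m y + S' (n - m) ((B ^^ m) y)"
            using add[of m "n - m" y] False m by simp
          moreover have "real (n - m) * c - real L * (C + \<bar>c\<bar>) \<le> S' (n - m) ((B ^^ m) y)"
            using less.IH[of "n - m"] False m B_space[OF less.prems] by simp
          moreover have "real n * c = real m * c + real (n - m) * c"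
            using False m by (simp add: of_nat_diff algebra_simps)
          moreover have "real m * c \<le> S' m y" using m SS'[of m y] by linarith
          ultimately show ?thesis by linarith
        qed
      qed
    qed
    have intf': "integrable P (\<lambda>y. f' ((B ^^ j) y))" for j
    proof (rule integrable_const_bound[of _ "C + (C + \<bar>c\<bar>)"])
      have "\<bar>f' x\<bar> \<le> C + (C + \<bar>c\<bar>)" for x
        using bd[of x] C by (auto simp: f'_def indicator_def)
      then show "AE y in P. norm (f' ((B ^^ j) y)) \<le> C + (C + \<bar>c\<bar>)" by simp
    qed measurable
    have If: "(\<integral>y. f' y \<partial>P) = (\<integral>y. f y \<partial>P) + (C + \<bar>c\<bar>) * prob (D L)"
      unfolding f'_def using intf by (subst Bochner_Integration.integral_add) (auto simp: integrable_indicator_iff less_top[symmetric])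
    have "real n * c - real L * (C + \<bar>c\<bar>) \<le> real n * (\<integral>y. f' y \<partial>P)" for n
    proof -
      have "real n * c - real L * (C + \<bar>c\<bar>) = (\<integral>y. real n * c - real L * (C + \<bar>c\<bar>) \<partial>P)"
        by (simp add: prob_space)
      also have "\<dots> \<le> (\<integral>y. S' n y \<partial>P)"
        by (intro integral_mono) (use claim intf' in \<open>auto simp: S'_def\<close>)
      also have "\<dots> = (\<Sum>j<n. \<integral>y. f' ((B ^^ j) y) \<partial>P)"
        unfolding S'_def using intf' by (intro Bochner_Integration.integral_sum)
      also have "\<dots> = real n * (\<integral>y. f' y \<partial>P)" by (simp add: integral_B_pow)
      finally show ?thesis .
    qed
    \<comment> \<open>The right-hand side does not depend on \<open>n\<close>, so the factor of
      \<open>n\<close> on the left cannot be positive.\<close>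
    then have *: "real n * (c - (\<integral>y. f' y \<partial>P)) \<le> real L * (C + \<bar>c\<bar>)" for n
      by (simp add: algebra_simps)
    have "c \<le> (\<integral>y. f' y \<partial>P)"
    proof (rule ccontr)
      assume "\<not> ?thesis"
      then obtain n :: nat where "real L * (C + \<bar>c\<bar>) < real n * (c - (\<integral>y. f' y \<partial>P))"
        using reals_Archimedean3[of "c - (\<integral>y. f' y \<partial>P)"] by auto
      then show False using *[of n] by simp
    qed
    then show ?thesis by (simp add: If)
  qed
  have "(\<lambda>L. prob (D L)) \<longlonglongrightarrow> prob (\<Inter>L. D L)"
    by (rule finite_Lim_measure_decseq) (auto simp: decseq_def D_def)
  moreover have "prob (\<Inter>L. D L) = 0"
  proof -
    have "AE y in P. y \<notin> (\<Inter>L. D L)"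
      using ae
    proof eventually_elim
      case (elim y)
      then obtain n where "n \<ge> 1" "S n y > real n * c" by (auto simp: S_def)
      then have "y \<notin> D n" by (auto simp: D_def intro!: bexI[of _ n])
      then show ?case by blast
    qed
    then show ?thesis by (simp add: measure_eq_0_null_sets AE_iff_null_sets)
  qed
  ultimately have "(\<lambda>L. (\<integral>y. f y \<partial>P) + (C + \<bar>c\<bar>) * prob (D L)) \<longlonglongrightarrow> (\<integral>y. f y \<partial>P) + (C + \<bar>c\<bar>) * 0"
    by (intro tendsto_intros) simp
  then show ?thesis
    using LIMSEQ_le_const[of _ _ c] main by auto
qed

text \<open>Averages that exceed \<open>c\<close> by a fixed amount infinitely often form an
  invariant event. If it had probability one, almost every point would start a block with average
  above \<open>c\<close>, and \<open>le_integral_of_good_blocks\<close> would contradict the choice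
  of \<open>c\<close>.\<close>

lemma ergodic_limsup_le:
  fixes f :: "'a \<Rightarrow> real"
  assumes f [measurable]: "f \<in> borel_measurable P" and bd: "\<And>y. \<bar>f y\<bar> \<le> C"
    and c: "(\<integral>y. f y \<partial>P) < c"
  shows "AE y in P. \<forall>k::nat. eventually (\<lambda>n. (\<Sum>j<n. f ((B ^^ j) y)) / real n \<le> c + 1 / real (Suc k)) sequentially"
proof -
  define u where "u n y = (\<Sum>j<n. f ((B ^^ j) y)) / real n" for n y
  have [measurable]: "u n \<in> borel_measurable P" for n
    unfolding u_def by measurable
  \<comment> \<open>The margin \<open>1 / Suc k\<close> is existentially quantified so that it may
    shrink under the shift: the averages from \<open>y\<close> and from \<open>B y\<close> differ by
    \<open>O(1/n)\<close>, which \<open>inv\<close> absorbs by replacing \<open>k\<close> with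
    \<open>Suc k\<close>. The invariance is then exact.\<close>
  define A where "A = {y \<in> space P. \<exists>k::nat. \<forall>m. \<exists>n\<ge>m. u n y > c + 1 / real (Suc k)}"
  have [measurable]: "A \<in> sets P" unfolding A_def by measurable
  have close: "(\<lambda>n. u n (B y) - u n y) \<longlonglongrightarrow> 0" for y
  proof (rule Lim_null_comparison)
    show "(\<lambda>n. 2 * C / real n) \<longlonglongrightarrow> 0"
      by (rule tendsto_divide_0[OF tendsto_const]) (simp add: filterlim_real_sequentially filterlim_at_top_imp_at_infinity)
    have "norm (u n (B y) - u n y) \<le> 2 * C / real n" for n
    proof -
      have "(\<Sum>j<n. f ((B ^^ j) (B y))) + f y = (\<Sum>j<Suc n. f ((B ^^ j) y))"
        by (simp only: sum.lessThan_Suc_shift) (simp add: funpow_swap1 comp_def funpow_Suc_right del: funpow.simps)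
      then have "(\<Sum>j<n. f ((B ^^ j) (B y))) - (\<Sum>j<n. f ((B ^^ j) y)) = f ((B ^^ n) y) - f y" by simp
      then have "u n (B y) - u n y = (f ((B ^^ n) y) - f y) / real n"
        by (simp add: u_def diff_divide_distrib[symmetric])
      moreover have "\<bar>f ((B ^^ n) y) - f y\<bar> \<le> 2 * C" using bd[of "(B ^^ n) y"] bd[of y] by linarith
      ultimately show ?thesis by (simp add: divide_right_mono abs_divide)
    qed
    then show "eventually (\<lambda>n. norm (u n (B y) - u n y) \<le> 2 * C / real n) sequentially" by simp
  qed
  have inv: "\<exists>k::nat. \<forall>m. \<exists>n\<ge>m. v n > c + 1 / real (Suc k)"
    if "\<exists>k::nat. \<forall>m. \<exists>n\<ge>m. w n > c + 1 / real (Suc k)" "(\<lambda>n. v n - w n) \<longlonglongrightarrow> 0" for v w :: "nat \<Rightarrow> real"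
  proof -
    from that(1) obtain k :: nat where k: "\<forall>m. \<exists>n\<ge>m. w n > c + 1 / real (Suc k)" by blast
    have "eventually (\<lambda>n. v n - w n > - (1 / real (Suc k) - 1 / real (Suc (Suc k)))) sequentially"
      by (rule order_tendstoD(1)[OF that(2)]) (simp add: frac_less2)
    then obtain N where N: "\<And>n. n \<ge> N \<Longrightarrow> v n - w n > - (1 / real (Suc k) - 1 / real (Suc (Suc k)))"
      by (auto simp: eventually_sequentially)
    have "\<exists>n\<ge>m. v n > c + 1 / real (Suc (Suc k))" for m
    proof -
      obtain n where "n \<ge> max m N" "w n > c + 1 / real (Suc k)" using k by blast
      then show ?thesis using N[of n] by (intro exI[of _ n]) auto
    qed
    then show ?thesis by blast
  qed
  have "B -` A \<inter> space P = A"
  proof -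
    have "B y \<in> A \<longleftrightarrow> y \<in> A" if y: "y \<in> space P" for y
    proof -
      have "(\<lambda>n. u n y - u n (B y)) \<longlonglongrightarrow> 0"
        using tendsto_minus[OF close[of y]] by simp
      then show ?thesis
        using inv[of "\<lambda>n. u n (B y)" "\<lambda>n. u n y"] inv[of "\<lambda>n. u n y" "\<lambda>n. u n (B y)"] close[of y] y B_space[OF y, of 1]
        unfolding A_def by auto
    qed
    then show ?thesis using sets.sets_into_space[of A P] by auto
  qed
  then have "prob A = 0 \<or> prob A = 1" by (intro B_erg) auto
  moreover have "prob A \<noteq> 1"
  proof
    assume "prob A = 1"
    then have "AE y in P. y \<in> A" by (simp add: AE_in_set_eq_1)
    then have "AE y in P. \<exists>n\<ge>1. (\<Sum>j<n. f ((B ^^ j) y)) > real n * c"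
    proof eventually_elim
      case (elim y)
      then obtain k n where n: "n \<ge> (1::nat)" "u n y > c + 1 / real (Suc k)" unfolding A_def by blast
      then have "u n y > c" by (smt (verit) divide_nonneg_nonneg of_nat_0_le_iff)
      then have "(\<Sum>j<n. f ((B ^^ j) y)) > real n * c" using n(1) by (simp add: u_def field_simps)
      then show ?case using n by blast
    qed
    then show False using le_integral_of_good_blocks[OF f bd, of c] c by simp
  qed
  ultimately have "AE y in P. y \<notin> A" by (simp add: prob_eq_0)
  then show ?thesis
  proof (rule AE_mp, intro AE_I2 impI)
    fix y assume "y \<in> space P" "y \<notin> A"
    then show "\<forall>k::nat. eventually (\<lambda>n. (\<Sum>j<n. f ((B ^^ j) y)) / real n \<le> c + 1 / real (Suc k)) sequentially"
      unfolding A_def u_def[symmetric] eventually_sequentially by (auto simp: not_less)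
  qed
qed

lemma ergodic_upper:
  fixes f :: "'a \<Rightarrow> real"
  assumes f: "f \<in> borel_measurable P" and bd: "\<And>y. \<bar>f y\<bar> \<le> C"
  shows "AE y in P. \<forall>e>0. eventually (\<lambda>n. (\<Sum>j<n. f ((B ^^ j) y)) / real n < (\<integral>y. f y \<partial>P) + e) sequentially"
proof -
  define I where "I = (\<integral>y. f y \<partial>P)"
  have "AE y in P. \<forall>i::nat. \<forall>k::nat. eventually (\<lambda>n. (\<Sum>j<n. f ((B ^^ j) y)) / real n \<le>
    (I + 1 / real (Suc i)) + 1 / real (Suc k)) sequentially"
    by (subst AE_all_countable, intro allI ergodic_limsup_le[OF f bd]) (simp add: I_def)
  then show ?thesis
  proof eventually_elim
    case (elim y)
    show ?case
    proof (intro allI impI)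
      fix e :: real assume e: "0 < e"
      obtain i :: nat where i: "1 / real (Suc i) < e / 2" using e nat_approx_posE[of "e/2"] by auto
      show "eventually (\<lambda>n. (\<Sum>j<n. f ((B ^^ j) y)) / real n < (\<integral>y. f y \<partial>P) + e) sequentially"
        using spec[OF spec[OF elim, of i], of i] by eventually_elim (use i in \<open>simp add: I_def\<close>)
    qed
  qed
qed

theorem birkhoff_ergodic_bounded:
  fixes f :: "'a \<Rightarrow> real"
  assumes f: "f \<in> borel_measurable P" and bd: "\<And>y. \<bar>f y\<bar> \<le> C"
  shows "AE y in P. (\<lambda>n. (\<Sum>j<n. f ((B ^^ j) y)) / real n) \<longlonglongrightarrow> (\<integral>y. f y \<partial>P)"
proof -
  have "AE y in P. \<forall>e>0. eventually (\<lambda>n. (\<Sum>j<n. - f ((B ^^ j) y)) / real n < (\<integral>y. - f y \<partial>P) + e) sequentially"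
    by (rule ergodic_upper[of "\<lambda>y. - f y" C]) (use f bd in auto)
  then show ?thesis using ergodic_upper[OF f bd]
  proof eventually_elim
    case (elim y)
    show ?case
    proof (rule order_tendstoI)
      fix a assume "a < (\<integral>y. f y \<partial>P)"
      then have "eventually (\<lambda>n. (\<Sum>j<n. - f ((B ^^ j) y)) / real n < (\<integral>y. - f y \<partial>P) + ((\<integral>y. f y \<partial>P) - a)) sequentially"
        using elim(1) by (auto elim!: allE[of _ "(\<integral>y. f y \<partial>P) - a"])
      then show "eventually (\<lambda>n. a < (\<Sum>j<n. f ((B ^^ j) y)) / real n) sequentially"
        by eventually_elim (simp add: sum_negf)
    next
      fix a assume "(\<integral>y. f y \<partial>P) < a"
      then show "eventually (\<lambda>n. (\<Sum>j<n. f ((B ^^ j) y)) / real n < a) sequentially"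
        using spec[OF elim(2), of "a - (\<integral>y. f y \<partial>P)"] by simp
    qed
  qed
qed

end

section \<open>A central limit theorem for bounded martingale differences\<close>

text \<open>The logarithm of \<open>1 + \<i> x\<close> is \<open>\<i> x + x^2 / 2\<close> up to
  third order, so the Gaussian factor restores agreement with \<open>iexp x\<close> up to third
  order. The errors \<open>1/6\<close> from Taylor's formula, \<open>1/2\<close> from the cross term
  and \<open>1/4\<close> from the expansion of the Gaussian factor add up to less than one.\<close>

lemma iexp_martingale_factor:
  fixes x :: real
  assumes x: "\<bar>x\<bar> \<le> 1"
  shows "cmod (iexp x - (1 + \<i> * of_real x) * of_real (exp (- (x\<^sup>2) / 2))) \<le> \<bar>x\<bar> ^ 3"
proof -
  define e where "e = exp (- (x\<^sup>2) / 2) - (1 - x\<^sup>2 / 2)"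
  have e: "\<bar>e\<bar> \<le> (x\<^sup>2 / 2)\<^sup>2 / 2"
  proof -
    have l: "exp (- (x\<^sup>2 / 2)) \<ge> 1 - x\<^sup>2 / 2" using exp_ge_add_one_self[of "- (x\<^sup>2 / 2)"] by simp
    have u: "exp (- (x\<^sup>2 / 2)) \<le> 1 - x\<^sup>2 / 2 + (x\<^sup>2 / 2)\<^sup>2 / 2"
    proof -
      have "1 - 0 + 0\<^sup>2 / 2 - exp (- 0) \<le> 1 - x\<^sup>2 / 2 + (x\<^sup>2 / 2)\<^sup>2 / 2 - exp (- (x\<^sup>2 / 2))"
      proof (rule DERIV_nonneg_imp_nondecreasing[of 0 "x\<^sup>2 / 2" "\<lambda>u. 1 - u + u\<^sup>2 / 2 - exp (- u)"])
        fix u :: real assume "0 \<le> u"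
        have "((\<lambda>u. 1 - u + u\<^sup>2 / 2 - exp (- u)) has_real_derivative (- 1 + u + exp (- u))) (at u)"
          by (auto intro!: derivative_eq_intros)
        moreover have "- 1 + u + exp (- u) \<ge> 0" using exp_ge_add_one_self[of "- u"] by simp
        ultimately show "\<exists>y. ((\<lambda>u. 1 - u + u\<^sup>2 / 2 - exp (- u)) has_real_derivative y) (at u) \<and> 0 \<le> y"
          by blast
      qed simp
      then show ?thesis by simp
    qed
    show ?thesis using l u by (simp add: e_def)
  qed
  \<comment> \<open>Multiplying out \<open>(1 + \<i> x) (1 - x^2 / 2 + e)\<close> leaves, beyond the
    Taylor polynomial of order two, the cross term \<open>- \<i> x^3 / 2\<close> and the term
    \<open>(1 + \<i> x) e\<close>.\<close>
  have "iexp x - (1 + \<i> * of_real x) * of_real (exp (- (x\<^sup>2) / 2)) =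
      (iexp x - (\<Sum>k\<le>2. (\<i> * x) ^ k / fact k)) + (\<i> * of_real (x ^ 3 / 2) - (1 + \<i> * of_real x) * of_real e)"
    by (simp add: e_def numeral_2_eq_2 power2_eq_square power3_eq_cube algebra_simps divide_simps)
  also have "cmod \<dots> \<le> \<bar>x\<bar> ^ 3 / 6 + (\<bar>x\<bar> ^ 3 / 2 + (1 + \<bar>x\<bar>) * \<bar>e\<bar>)"
  proof -
    have "cmod (iexp x - (\<Sum>k\<le>2. (\<i> * x) ^ k / fact k)) \<le> \<bar>x\<bar> ^ 3 / 6"
      using iexp_approx1[of x 2] by (simp add: numeral_3_eq_3 fact_numeral)
    moreover have "cmod (\<i> * of_real (x ^ 3 / 2)) \<le> \<bar>x\<bar> ^ 3 / 2"
      by (simp add: norm_mult norm_power power_abs del: of_real_power)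
    moreover have "cmod (1 + \<i> * of_real x) \<le> 1 + \<bar>x\<bar>" by (rule norm_triangle_le) (simp add: norm_mult)
    then have "cmod ((1 + \<i> * of_real x) * of_real e) \<le> (1 + \<bar>x\<bar>) * \<bar>e\<bar>"
      by (simp add: norm_mult mult_right_mono)
    ultimately show ?thesis
      by (intro norm_triangle_le[OF add_mono] norm_triangle_le_diff[OF add_mono])
  qed
  also have "\<dots> \<le> \<bar>x\<bar> ^ 3"
  proof -
    have "(x\<^sup>2 / 2)\<^sup>2 / 2 = \<bar>x\<bar> ^ 3 * \<bar>x\<bar> / 8"
      by (simp add: power2_eq_square power3_eq_cube algebra_simps)
    also have "\<dots> \<le> \<bar>x\<bar> ^ 3 / 8" using mult_left_mono[OF x, of "\<bar>x\<bar> ^ 3"] by simp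
    finally have "\<bar>e\<bar> \<le> \<bar>x\<bar> ^ 3 / 8" using e by simp
    then have "(1 + \<bar>x\<bar>) * \<bar>e\<bar> \<le> 2 * (\<bar>x\<bar> ^ 3 / 8)" using x by (intro mult_mono) auto
    then show ?thesis using zero_le_power[of "\<bar>x\<bar>" 3] by linarith
  qed
  finally show ?thesis .
qed

context ergodic_system
begin

text \<open>McLeish's argument: \<open>\<Prod>j<n. 1 + \<i> d\<^sub>j / sqrt n\<close> has expectation \<open>1\<close> and differs from
  \<open>exp (\<i> \<Sum>j<n. d\<^sub>j / sqrt n)\<close> asymptotically only by the factor \<open>exp (\<Sum>j<n. d\<^sub>j\<^sup>2 / (2 n))\<close>, to which
  the ergodic theorem applies.\<close>

theorem martingale_clt:
  fixes d :: "'a \<Rightarrow> real"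
  assumes F: "subalgebra P F" and dF [measurable]: "d \<in> borel_measurable F" and bd: "\<And>y. \<bar>d y\<bar> \<le> C"
    and BF [measurable]: "B \<in> measurable F F"
    and mart: "\<And>W K. W \<in> borel_measurable F \<Longrightarrow> (\<And>y. \<bar>W y\<bar> \<le> K) \<Longrightarrow> (\<integral>y. W (B y) * d y \<partial>P) = 0"
  shows "(\<lambda>n. \<integral>y. iexp ((\<Sum>j<n. d ((B ^^ j) y)) / sqrt (real n)) \<partial>P)
    \<longlonglongrightarrow> complex_of_real (exp (- (\<integral>y. (d y)\<^sup>2 \<partial>P) / 2))"
proof -
  have FP: "h \<in> borel_measurable F \<Longrightarrow> h \<in> borel_measurable P" for h :: "'a \<Rightarrow> 'd::topological_space"
    using measurable_from_subalg[OF F] .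
  have [measurable]: "d \<in> borel_measurable P" by (rule FP[OF dF])
  have C: "0 \<le> C" using bd by (metis abs_ge_zero order_trans)
  have [measurable]: "(B ^^ j) \<in> measurable F F" for j
    by (induction j) (auto intro: measurable_comp)
  define R where "R a m y = (\<Prod>j<m. 1 + \<i> * of_real (a * d ((B ^^ j) y)))" for a :: real and m y
  have RF [measurable]: "R a m \<in> borel_measurable F" for a m unfolding R_def by measurable
  have [measurable]: "R a m \<in> borel_measurable P" for a m by (rule FP[OF RF])
  \<comment> \<open>With \<open>a = 1 / sqrt n\<close> this keeps a product of \<open>n\<close>
    factors below \<open>exp (C^2 / 2)\<close>, uniformly in \<open>n\<close>.\<close>
  have fac: "cmod (1 + \<i> * of_real x) \<le> exp (x\<^sup>2 / 2)" for x :: real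
  proof -
    have "(cmod (1 + \<i> * of_real x))\<^sup>2 = 1 + x\<^sup>2" by (simp add: cmod_power2)
    also have "\<dots> \<le> exp (x\<^sup>2)" by (rule exp_ge_add_one_self)
    also have "\<dots> = (exp (x\<^sup>2 / 2))\<^sup>2" by (simp add: exp_double[symmetric] flip: exp_of_nat_mult)
    finally show ?thesis by (rule power2_le_imp_le) simp
  qed
  have Rb: "cmod (R a m y) \<le> exp (real m * (a * C)\<^sup>2 / 2)" for a m y
  proof -
    have "cmod (R a m y) \<le> (\<Prod>j<m. exp ((a * C)\<^sup>2 / 2))"
      unfolding R_def prod_norm[symmetric]
    proof (intro prod_mono conjI norm_ge_zero order_trans[OF fac])
      fix j
      have "\<bar>a * d ((B ^^ j) y)\<bar> \<le> \<bar>a * C\<bar>"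
        using bd[of "(B ^^ j) y"] C by (simp add: abs_mult mult_left_mono)
      then show "exp ((a * d ((B ^^ j) y))\<^sup>2 / 2) \<le> exp ((a * C)\<^sup>2 / 2)"
        by (simp add: abs_le_square_iff)
    qed
    then show ?thesis by (simp add: exp_of_nat_mult[symmetric])
  qed
  have RI: "integrable P (R a m)" for a m
    by (rule integrable_const_bound[OF AE_I2, OF Rb]) measurable
  have RBI: "integrable P (\<lambda>y. R a m (B y))" for a m
    by (rule integrable_const_bound[OF AE_I2, OF Rb]) measurable
  have Rd: "integrable P (\<lambda>y. R a m (B y) * of_real (d y))" "(\<integral>y. R a m (B y) * of_real (d y) \<partial>P) = 0" for a m
  proof -
    show 1: "integrable P (\<lambda>y. R a m (B y) * of_real (d y))"
    proof (rule integrable_const_bound[of _ "exp (real m * (a * C)\<^sup>2 / 2) * C"])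
      show "AE y in P. norm (R a m (B y) * complex_of_real (d y)) \<le> exp (real m * (a * C)\<^sup>2 / 2) * C"
        unfolding norm_mult using Rb bd by (intro AE_I2 mult_mono) auto
    qed measurable
    have "(\<integral>y. Re (R a m (B y)) * d y \<partial>P) = 0"
      by (rule mart[of "\<lambda>y. Re (R a m y)" "exp (real m * (a * C)\<^sup>2 / 2)"])
        (measurable, meson Rb abs_Re_le_cmod order_trans)
    moreover have "(\<integral>y. Im (R a m (B y)) * d y \<partial>P) = 0"
      by (rule mart[of "\<lambda>y. Im (R a m y)" "exp (real m * (a * C)\<^sup>2 / 2)"])
        (measurable, meson Rb abs_Im_le_cmod order_trans)
    ultimately show "(\<integral>y. R a m (B y) * of_real (d y) \<partial>P) = 0"
      using integral_Re[OF 1] integral_Im[OF 1] by (simp add: complex_eq_iff)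
  qed
  \<comment> \<open>\<open>B\<close> leads into the past, so the factor with \<open>j = 0\<close> is
    the newest. The remaining product is a function of \<open>B y\<close>, to which \<open>d\<close>
    is orthogonal by the martingale property.\<close>
  have ER: "(\<integral>y. R a m y \<partial>P) = 1" for a m
  proof (induction m)
    case (Suc m)
    have "R a (Suc m) y = R a m (B y) + \<i> * of_real a * (R a m (B y) * of_real (d y))" for y
      unfolding R_def
      by (simp only: prod.lessThan_Suc_shift) (simp add: funpow_swap1 comp_def funpow_Suc_right algebra_simps del: funpow.simps)
    then have "(\<integral>y. R a (Suc m) y \<partial>P) = (\<integral>y. R a m (B y) \<partial>P) + \<i> * of_real a * (\<integral>y. R a m (B y) * of_real (d y) \<partial>P)"
      using Rd(1) RBI by simp
    then show ?case using Suc by (simp add: Rd(2) integral_B)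
  qed (simp add: R_def prob_space)
  define a where "a n = 1 / sqrt (real n)" for n
  define Q where "Q n y = (\<Sum>j<n. (d ((B ^^ j) y))\<^sup>2) / real n" for n y
  have [measurable]: "Q n \<in> borel_measurable P" for n unfolding Q_def by measurable
  define \<sigma>2 where "\<sigma>2 = (\<integral>y. (d y)\<^sup>2 \<partial>P)"
  define e where "e n y = iexp ((\<Sum>j<n. d ((B ^^ j) y)) / sqrt (real n))" for n y
  have [measurable]: "e n \<in> borel_measurable P" for n unfolding e_def by measurable
  define D where "D n y = R (a n) n y * of_real (exp (- Q n y / 2))" for n y
  have [measurable]: "D n \<in> borel_measurable P" for n unfolding D_def by measurable
  have a2: "real n * (a n)\<^sup>2 \<le> 1" for n by (simp add: a_def power_divide)
  have Rn: "cmod (R (a n) n y) \<le> exp (C\<^sup>2 / 2)" for n y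
  proof -
    have "real n * (a n * C)\<^sup>2 / 2 \<le> C\<^sup>2 / 2"
      using mult_right_mono[OF a2[of n], of "C\<^sup>2"] by (simp add: power_mult_distrib algebra_simps)
    then show ?thesis using Rb[of "a n" n y] by (meson exp_le_cancel_iff order_trans)
  qed
  have Q0: "0 \<le> Q n y" for n y unfolding Q_def by (intro divide_nonneg_nonneg sum_nonneg) auto
  have diff: "cmod (e n y - D n y) \<le> C ^ 3 / sqrt (real n)" if n: "real n \<ge> C\<^sup>2" "n > 0" for n y
  proof -
    define x where "x j = a n * d ((B ^^ j) y)" for j
    have sq: "sqrt (real n) > 0" using n by simp
    have "C \<le> sqrt (real n)" using n C real_le_rsqrt by blast
    then have aC: "a n * C \<le> 1" using sq by (simp add: a_def)
    have an: "0 \<le> a n" by (simp add: a_def)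
    have xb: "\<bar>x j\<bar> \<le> a n * C" for j using bd[of "(B ^^ j) y"] an by (simp add: x_def abs_mult mult_left_mono)
    have "e n y = (\<Prod>j<n. iexp (x j))"
      unfolding e_def x_def exp_sum[symmetric, OF finite_lessThan]
      by (simp add: a_def sum_distrib_left sum_divide_distrib)
    moreover have "D n y = (\<Prod>j<n. (1 + \<i> * of_real (x j)) * of_real (exp (- ((x j)\<^sup>2) / 2)))"
    proof -
      have "- Q n y / 2 = (\<Sum>j<n. - ((x j)\<^sup>2) / 2)"
        unfolding Q_def x_def a_def by (simp add: power_mult_distrib power_divide sum_divide_distrib sum_negf)
      then have "exp (- Q n y / 2) = (\<Prod>j<n. exp (- ((x j)\<^sup>2) / 2))"
        by (simp add: exp_sum)
      then show ?thesis unfolding D_def R_def x_def by (simp only: prod.distrib of_real_prod)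
    qed
    \<comment> \<open>All factors of both products have modulus at most one, so the errors of the
      single factors simply add up: \<open>n\<close> terms of size
      \<open>(C / sqrt n)^3\<close>.\<close>
    moreover have "cmod ((\<Prod>j<n. iexp (x j)) - (\<Prod>j<n. (1 + \<i> * of_real (x j)) * of_real (exp (- ((x j)\<^sup>2) / 2))))
       \<le> (\<Sum>j<n. cmod (iexp (x j) - (1 + \<i> * of_real (x j)) * of_real (exp (- ((x j)\<^sup>2) / 2))))"
    proof (rule norm_prod_diff)
      fix j
      have "cmod ((1 + \<i> * of_real (x j)) * of_real (exp (- ((x j)\<^sup>2) / 2))) \<le> exp ((x j)\<^sup>2 / 2) * exp (- ((x j)\<^sup>2) / 2)"
        unfolding norm_mult by (intro mult_mono fac) auto
      then show "cmod ((1 + \<i> * of_real (x j)) * of_real (exp (- ((x j)\<^sup>2) / 2))) \<le> 1"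
        by (simp flip: exp_add)
    qed simp
    moreover have "\<dots> \<le> (\<Sum>j<n. (a n * C) ^ 3)"
    proof (intro sum_mono order_trans[OF iexp_martingale_factor])
      fix j
      show "\<bar>x j\<bar> \<le> 1" using xb[of j] aC by simp
      show "\<bar>x j\<bar> ^ 3 \<le> (a n * C) ^ 3" using xb by (intro power_mono) auto
    qed
    moreover have "(\<Sum>j<n. (a n * C) ^ 3) = C ^ 3 / sqrt (real n)"
      using n by (simp add: a_def power3_eq_cube field_simps)
    ultimately show ?thesis by simp
  qed
  have DI: "integrable P (D n)" for n
  proof (rule integrable_const_bound[of _ "exp (C\<^sup>2 / 2) * 1"])
    show "AE y in P. norm (D n y) \<le> exp (C\<^sup>2 / 2) * 1"
      unfolding D_def norm_mult using Rn Q0 by (intro AE_I2 mult_mono) auto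
  qed measurable
  have eI: "integrable P (e n)" for n
    by (rule integrable_const_bound[of _ 1]) (auto simp: e_def)
  have lim1: "(\<lambda>n. (\<integral>y. e n y \<partial>P) - (\<integral>y. D n y \<partial>P)) \<longlonglongrightarrow> 0"
  proof (rule Lim_null_comparison)
    show "(\<lambda>n. C ^ 3 / sqrt (real n)) \<longlonglongrightarrow> 0"
      by real_asymp
    have "eventually (\<lambda>n. n > nat \<lceil>C\<^sup>2\<rceil>) sequentially" by (rule eventually_gt_at_top)
    then show "eventually (\<lambda>n. norm ((\<integral>y. e n y \<partial>P) - (\<integral>y. D n y \<partial>P)) \<le> C ^ 3 / sqrt (real n)) sequentially"
    proof eventually_elim
      case (elim n)
      then have n: "real n \<ge> C\<^sup>2" "n > 0" by linarith+
      have "norm (\<integral>y. e n y - D n y \<partial>P) \<le> (\<integral>y. norm (e n y - D n y) \<partial>P)" by (rule integral_norm_bound)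
      also have "\<dots> \<le> (\<integral>y. C ^ 3 / sqrt (real n) \<partial>P)"
        by (rule integral_mono) (use diff[OF n] eI DI in auto)
      also have "\<dots> = C ^ 3 / sqrt (real n)" by (simp add: prob_space)
      finally show ?case using eI DI by simp
    qed
  qed
  \<comment> \<open>Nothing is said about a limit of \<open>R\<close>; its uniform bound and its
    expectation one suffice to replace the random exponent \<open>Q n\<close> by its ergodic limit
    \<open>\<sigma>2\<close>.\<close>
  have lim2: "(\<lambda>n. (\<integral>y. D n y \<partial>P) - exp (- \<sigma>2 / 2)) \<longlonglongrightarrow> 0"
  proof (rule Lim_null_comparison)
    define w where "w n = (\<integral>y. exp (C\<^sup>2 / 2) * \<bar>exp (- Q n y / 2) - exp (- \<sigma>2 / 2)\<bar> \<partial>P)" for n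
    have Qb: "\<bar>exp (- Q n y / 2) - exp (- \<sigma>2 / 2)\<bar> \<le> 1" for n y
    proof -
      have "0 \<le> \<sigma>2" unfolding \<sigma>2_def by simp
      then have "exp (- Q n y / 2) \<le> 1" "exp (- \<sigma>2 / 2) \<le> 1" using Q0 by auto
      moreover have "exp (- Q n y / 2) > 0" "exp (- \<sigma>2 / 2) > 0" by auto
      ultimately show ?thesis by linarith
    qed
    have "w \<longlonglongrightarrow> (\<integral>y. 0 \<partial>P)" unfolding w_def
    proof (rule integral_dominated_convergence)
      show "integrable P (\<lambda>y. exp (C\<^sup>2 / 2) * 1)" by simp
      show "AE y in P. norm (exp (C\<^sup>2 / 2) * \<bar>exp (- Q n y / 2) - exp (- \<sigma>2 / 2)\<bar>) \<le> exp (C\<^sup>2 / 2) * 1" for n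
        using Qb by auto
      have "AE y in P. (\<lambda>n. Q n y) \<longlonglongrightarrow> \<sigma>2"
        unfolding Q_def \<sigma>2_def
      proof (rule birkhoff_ergodic_bounded)
        show "\<bar>(d y)\<^sup>2\<bar> \<le> C\<^sup>2" for y using bd[of y] C by (simp add: abs_le_square_iff[symmetric])
      qed measurable
      then show "AE y in P. (\<lambda>n. exp (C\<^sup>2 / 2) * \<bar>exp (- Q n y / 2) - exp (- \<sigma>2 / 2)\<bar>) \<longlonglongrightarrow> 0"
      proof eventually_elim
        case (elim y)
        have "(\<lambda>n. exp (C\<^sup>2 / 2) * \<bar>exp (- Q n y / 2) - exp (- \<sigma>2 / 2)\<bar>)
          \<longlonglongrightarrow> exp (C\<^sup>2 / 2) * \<bar>exp (- \<sigma>2 / 2) - exp (- \<sigma>2 / 2)\<bar>"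
          by (intro tendsto_intros elim) simp
        then show ?case by simp
      qed
    qed measurable
    then show "w \<longlonglongrightarrow> 0" by simp
    have "norm ((\<integral>y. D n y \<partial>P) - exp (- \<sigma>2 / 2)) \<le> w n" for n
    proof -
      have "(\<integral>y. D n y \<partial>P) - exp (- \<sigma>2 / 2) = (\<integral>y. D n y - R (a n) n y * of_real (exp (- \<sigma>2 / 2)) \<partial>P)"
        using DI RI ER by simp
      also have "norm \<dots> \<le> (\<integral>y. norm (D n y - R (a n) n y * of_real (exp (- \<sigma>2 / 2))) \<partial>P)"
        by (rule integral_norm_bound)
      also have "\<dots> \<le> w n" unfolding w_def
      proof (rule integral_mono)
        show "integrable P (\<lambda>y. norm (D n y - R (a n) n y * of_real (exp (- \<sigma>2 / 2))))"
          using DI RI by simp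
        show "integrable P (\<lambda>y. exp (C\<^sup>2 / 2) * \<bar>exp (- Q n y / 2) - exp (- \<sigma>2 / 2)\<bar>)"
          by (rule integrable_const_bound[of _ "exp (C\<^sup>2 / 2) * 1"]) (use Qb in auto)
        fix y
        have "D n y - R (a n) n y * of_real (exp (- \<sigma>2 / 2)) = R (a n) n y * of_real (exp (- Q n y / 2) - exp (- \<sigma>2 / 2))"
          by (simp add: D_def algebra_simps)
        then show "norm (D n y - R (a n) n y * of_real (exp (- \<sigma>2 / 2))) \<le> exp (C\<^sup>2 / 2) * \<bar>exp (- Q n y / 2) - exp (- \<sigma>2 / 2)\<bar>"
          using Rn[of n y] by (simp only: norm_mult norm_of_real mult_right_mono abs_ge_zero)
      qed
      finally show ?thesis .
    qed
    then show "eventually (\<lambda>n. norm ((\<integral>y. D n y \<partial>P) - exp (- \<sigma>2 / 2)) \<le> w n) sequentially" by simp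
  qed
  have "(\<lambda>n. ((\<integral>y. e n y \<partial>P) - (\<integral>y. D n y \<partial>P)) + ((\<integral>y. D n y \<partial>P) - exp (- \<sigma>2 / 2)) + exp (- \<sigma>2 / 2)) \<longlonglongrightarrow> 0 + 0 + complex_of_real (exp (- \<sigma>2 / 2))"
    by (intro tendsto_intros lim1 lim2)
  then show ?thesis by (simp add: e_def \<sigma>2_def)
qed

end

section \<open>Convergence of characteristic functions of random vectors\<close>

text \<open>The real functions of the first \<open>d\<close> coordinates whose expectations are
  determined by characteristic functions; the phase \<open>b\<close> covers sines and constants. The
  product formula for cosines makes them an algebra, as Stone-Weierstrass requires.\<close>

inductive_set trig_poly :: "nat \<Rightarrow> ((nat \<Rightarrow> real) \<Rightarrow> real) set" for d where
  cosine: "(\<lambda>x. cos ((\<Sum>j<d. u j * x j) + b)) \<in> trig_poly d"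
| add: "p \<in> trig_poly d \<Longrightarrow> q \<in> trig_poly d \<Longrightarrow> (\<lambda>x. p x + q x) \<in> trig_poly d"
| scale: "p \<in> trig_poly d \<Longrightarrow> (\<lambda>x. c * p x) \<in> trig_poly d"

lemma trig_poly_const: "(\<lambda>_. c) \<in> trig_poly d"
  using trig_poly.scale[OF trig_poly.cosine[of "\<lambda>_. 0" d 0], of c] by simp

lemma trig_poly_sin:
  assumes "j < d"
  shows "(\<lambda>x. sin (\<delta> * x j)) \<in> trig_poly d"
proof -
  have "(\<Sum>i<d. (if i = j then \<delta> else 0) * x i) = \<delta> * x j" for x :: "nat \<Rightarrow> real"
    using assms by (simp add: if_distrib[of "\<lambda>c. c * _"] sum.delta cong: if_cong)
  then show ?thesis
    using trig_poly.cosine[of "\<lambda>i. if i = j then \<delta> else 0" d "- pi / 2"] by (simp add: cos_diff)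
qed

lemma trig_poly_mult_cos:
  assumes "q \<in> trig_poly d"
  shows "(\<lambda>x. cos ((\<Sum>j<d. u j * x j) + b) * q x) \<in> trig_poly d"
  using assms
proof induction
  case (cosine v b')
  have "(\<Sum>j<d. (u j + v j) * x j) = (\<Sum>j<d. u j * x j) + (\<Sum>j<d. v j * x j)"
    "(\<Sum>j<d. (u j - v j) * x j) = (\<Sum>j<d. u j * x j) - (\<Sum>j<d. v j * x j)" for x
    by (simp_all add: algebra_simps sum.distrib sum_subtractf)
  then have "cos ((\<Sum>j<d. u j * x j) + b) * cos ((\<Sum>j<d. v j * x j) + b') =
     1/2 * cos ((\<Sum>j<d. (u j - v j) * x j) + (b - b')) + 1/2 * cos ((\<Sum>j<d. (u j + v j) * x j) + (b + b'))" for x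
    using cos_times_cos[of "(\<Sum>j<d. u j * x j) + b" "(\<Sum>j<d. v j * x j) + b'"]
    by (simp add: add_divide_distrib add_ac diff_diff_eq add_diff_eq diff_add_eq)
  then show ?case by (simp only:) (intro trig_poly.intros)
next
  case (add p q)
  then show ?case using trig_poly.add[OF add.IH] by (simp add: distrib_left)
next
  case (scale p c)
  then show ?case using trig_poly.scale[OF scale.IH, of c] by (simp add: mult.left_commute)
qed

lemma trig_poly_mult:
  assumes "p \<in> trig_poly d" "q \<in> trig_poly d"
  shows "(\<lambda>x. p x * q x) \<in> trig_poly d"
  using assms(1)
proof induction
  case (cosine u b)
  then show ?case by (rule trig_poly_mult_cos[OF assms(2)])
next
  case (add p p')
  then show ?case using trig_poly.add[OF add.IH] by (simp add: distrib_right)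
next
  case (scale p c)
  then show ?case using trig_poly.scale[OF scale.IH, of c] by (simp add: mult.assoc)
qed

lemma trig_poly_measurable:
  assumes "q \<in> trig_poly d" "\<And>j. (\<lambda>\<omega>. V \<omega> j) \<in> borel_measurable M"
  shows "(\<lambda>\<omega>. q (V \<omega>)) \<in> borel_measurable M"
proof -
  note [measurable] = assms(2)
  show ?thesis using assms(1) by induction auto
qed

text \<open>With \<open>x\<^sub>j = arcsin (sin (\<delta> x\<^sub>j)) / \<delta>\<close> for \<open>\<bar>x\<^sub>j\<bar> \<le> A = \<pi> / (2 \<delta>)\<close>, a polynomial approximation on the cube
  of the values \<open>sin (\<delta> x\<^sub>j)\<close> becomes a trigonometric one, which is bounded on the whole space.\<close>

lemma trig_poly_approx:
  fixes h :: "(nat \<Rightarrow> real) \<Rightarrow> real"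
  assumes cont: "continuous_on UNIV h" and bd: "\<And>x. \<bar>h x\<bar> \<le> K"
    and dep: "\<And>x. h x = h (\<lambda>j. if j < d then x j else 0)"
    and A: "A > 0" and e: "e > 0"
  obtains q where "q \<in> trig_poly d" "\<And>x. \<bar>q x\<bar> \<le> K + e"
    "\<And>x. (\<And>j. j < d \<Longrightarrow> \<bar>x j\<bar> \<le> A) \<Longrightarrow> \<bar>h x - q x\<bar> \<le> e"
proof -
  define \<delta> where "\<delta> = pi / (2 * A)"
  have dA: "\<delta> * A = pi / 2" "\<delta> > 0" using A by (simp_all add: \<delta>_def field_simps)
  \<comment> \<open>The coordinates from \<open>d\<close> on are frozen at zero. This makes
    \<open>S\<close> a product of compact sets, hence compact in the product topology, and lets the
    first \<open>d\<close> coordinates separate its points.\<close>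
  define S where "S = Pi\<^sub>E UNIV (\<lambda>j::nat. if j < d then {-1..1::real} else {0})"
  have S: "x \<in> S \<Longrightarrow> j < d \<Longrightarrow> - 1 \<le> x j \<and> x j \<le> 1" "x \<in> S \<Longrightarrow> \<not> j < d \<Longrightarrow> x j = 0" for x j
    unfolding S_def by (drule PiE_mem[of _ _ _ j]; simp)+
  define s where "s x = (\<lambda>j. if j < d then sin (\<delta> * x j) else 0)" for x :: "nat \<Rightarrow> real"
  have sS: "s x \<in> S" for x by (simp add: s_def S_def PiE_UNIV_domain)
  \<comment> \<open>The ring contains the coordinates below \<open>d\<close>, because the
    substitution \<open>s\<close> turns coordinate \<open>j\<close> into
    \<open>sin (\<delta> * x j)\<close>.\<close>
  define R where "R = {f. continuous_on S f \<and> (\<lambda>x. f (s x)) \<in> trig_poly d}"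
  have "compact S"
  proof -
    have "compactin (product_topology (\<lambda>_::nat. euclidean) UNIV) S"
      unfolding S_def compactin_PiE by (auto simp: compactin_euclidean_iff)
    then show ?thesis by (simp add: euclidean_product_topology compactin_euclidean_iff)
  qed
  interpret function_ring_on R S
  proof
    show "compact S" by fact
    fix f g assume "f \<in> R" "g \<in> R"
    then show "(\<lambda>x. f x + g x) \<in> R" "(\<lambda>x. f x * g x) \<in> R"
      by (auto simp: R_def intro!: continuous_intros trig_poly.add trig_poly_mult)
  next
    fix c :: real show "(\<lambda>_. c) \<in> R" by (simp add: R_def trig_poly_const)
  next
    fix x y assume xy: "x \<in> S" "y \<in> S" "x \<noteq> y"
    then obtain j where j: "x j \<noteq> y j" by (auto simp: fun_eq_iff)
    then have jd: "j < d" using S(2)[OF xy(1)] S(2)[OF xy(2)] by force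
    have "continuous_on S (\<lambda>x. x j)"
      by (rule continuous_on_product_then_coordinatewise[OF continuous_on_id])
    then have "(\<lambda>x. x j) \<in> R" using jd trig_poly_sin[OF jd, of \<delta>] by (simp add: R_def s_def)
    then show "\<exists>f\<in>R. f x \<noteq> f y" using j by (intro bexI[of _ "\<lambda>x. x j"])
  qed (auto simp: R_def)
  define f where "f z = h (\<lambda>j. if j < d then arcsin (z j) / \<delta> else 0)" for z :: "nat \<Rightarrow> real"
  have "continuous_on S f"
    unfolding f_def
  proof (rule continuous_on_compose2[OF cont])
    show "continuous_on S (\<lambda>z j. if j < d then arcsin (z j) / \<delta> else 0)"
    proof (rule continuous_on_coordinatewise_then_product)
      fix j
      have "continuous_on S (\<lambda>x. x j)"
        by (rule continuous_on_product_then_coordinatewise[OF continuous_on_id])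
      then show "continuous_on S (\<lambda>z. if j < d then arcsin (z j) / \<delta> else 0)"
        using dA by (cases "j < d") (auto dest: S(1) intro!: continuous_intros)
    qed
  qed simp
  then obtain g where g: "g \<in> R" "\<And>x. x \<in> S \<Longrightarrow> \<bar>f x - g x\<bar> < e"
    using Stone_Weierstrass_basic[OF _ e, of f] by blast
  show thesis
  proof
    show "(\<lambda>x. g (s x)) \<in> trig_poly d" using g by (simp add: R_def)
    \<comment> \<open>\<open>s x\<close> lies in \<open>S\<close> for every \<open>x\<close>, so the
      approximation on the compact set bounds the composition on the whole space.\<close>
    show "\<bar>g (s x)\<bar> \<le> K + e" for x
      using g(2)[OF sS[of x]] bd[of "\<lambda>j. if j < d then arcsin (s x j) / \<delta> else 0"] unfolding f_def by linarith
    fix x :: "nat \<Rightarrow> real" assume x: "\<And>j. j < d \<Longrightarrow> \<bar>x j\<bar> \<le> A"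
    have "arcsin (s x j) / \<delta> = x j" if "j < d" for j
    proof -
      have "\<bar>\<delta> * x j\<bar> \<le> \<delta> * A" using x[OF that] dA by (simp add: abs_mult)
      then have "\<bar>\<delta> * x j\<bar> \<le> pi / 2" using dA by simp
      then have "arcsin (sin (\<delta> * x j)) = \<delta> * x j" by (intro arcsin_sin) auto
      then show ?thesis using that dA by (simp add: s_def)
    qed
    then have "f (s x) = h x" unfolding f_def by (subst (2) dep) (auto cong: if_cong)
    then show "\<bar>h x - g (s x)\<bar> \<le> e" using g(2)[OF sS[of x]] by simp
  qed
qed

text \<open>Linearity reduces the claim to one cosine, the real part of a rotated characteristic
  function. Integrability is carried through the induction because the integral of a sum is
  split.\<close>

lemma trig_poly_expectation_diff:
  assumes M: "prob_space M" and N: "prob_space N"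
    and V: "\<And>n j. (\<lambda>\<omega>. V n \<omega> j) \<in> borel_measurable M" and U: "\<And>n j. (\<lambda>\<omega>. U n \<omega> j) \<in> borel_measurable N"
    and chV: "\<And>u. (\<lambda>n. \<integral>\<omega>. iexp (\<Sum>j<d. u j * V n \<omega> j) \<partial>M) \<longlonglongrightarrow> \<psi> u"
    and chU: "\<And>u. (\<lambda>n. \<integral>\<omega>. iexp (\<Sum>j<d. u j * U n \<omega> j) \<partial>N) \<longlonglongrightarrow> \<psi> u"
    and q: "q \<in> trig_poly d"
  shows "(\<forall>n. integrable M (\<lambda>\<omega>. q (V n \<omega>))) \<and> (\<forall>n. integrable N (\<lambda>\<omega>. q (U n \<omega>))) \<and>
    (\<lambda>n. (\<integral>\<omega>. q (V n \<omega>) \<partial>M) - (\<integral>\<omega>. q (U n \<omega>) \<partial>N)) \<longlonglongrightarrow> 0"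
  using q
proof induction
  interpret M: prob_space M by fact
  interpret N: prob_space N by fact
  note [measurable] = V U
  {
    case (cosine u b)
    have iV: "integrable M (\<lambda>\<omega>. iexp (\<Sum>j<d. u j * V n \<omega> j))" for n
      by (rule M.integrable_const_bound[of _ 1]) auto
    have iU: "integrable N (\<lambda>\<omega>. iexp (\<Sum>j<d. u j * U n \<omega> j))" for n
      by (rule N.integrable_const_bound[of _ 1]) auto
    have c: "cos (x + b) = Re (iexp b * iexp x)" for x
      by (simp add: cos_add cis_conv_exp[symmetric] exp_Euler[symmetric] Re_exp Im_exp flip: exp_add)
    have eV: "(\<integral>\<omega>. cos ((\<Sum>j<d. u j * V n \<omega> j) + b) \<partial>M) = Re (iexp b * (\<integral>\<omega>. iexp (\<Sum>j<d. u j * V n \<omega> j) \<partial>M))" for n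
      unfolding c using integral_Re[of M "\<lambda>\<omega>. iexp b * iexp (\<Sum>j<d. u j * V n \<omega> j)"] iV by simp
    have eU: "(\<integral>\<omega>. cos ((\<Sum>j<d. u j * U n \<omega> j) + b) \<partial>N) = Re (iexp b * (\<integral>\<omega>. iexp (\<Sum>j<d. u j * U n \<omega> j) \<partial>N))" for n
      unfolding c using integral_Re[of N "\<lambda>\<omega>. iexp b * iexp (\<Sum>j<d. u j * U n \<omega> j)"] iU by simp
    have "(\<lambda>n. Re (iexp b * (\<integral>\<omega>. iexp (\<Sum>j<d. u j * V n \<omega> j) \<partial>M)) - Re (iexp b * (\<integral>\<omega>. iexp (\<Sum>j<d. u j * U n \<omega> j) \<partial>N)))
       \<longlonglongrightarrow> Re (iexp b * \<psi> u) - Re (iexp b * \<psi> u)"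
      by (intro tendsto_intros chV chU)
    moreover have "integrable M (\<lambda>\<omega>. cos ((\<Sum>j<d. u j * V n \<omega> j) + b))" for n
      by (rule M.integrable_const_bound[of _ 1]) auto
    moreover have "integrable N (\<lambda>\<omega>. cos ((\<Sum>j<d. u j * U n \<omega> j) + b))" for n
      by (rule N.integrable_const_bound[of _ 1]) auto
    ultimately show ?case by (simp add: eV eU)
  next
    case (add p q)
    then have "(\<lambda>n. ((\<integral>\<omega>. p (V n \<omega>) \<partial>M) - (\<integral>\<omega>. p (U n \<omega>) \<partial>N)) + ((\<integral>\<omega>. q (V n \<omega>) \<partial>M) - (\<integral>\<omega>. q (U n \<omega>) \<partial>N))) \<longlonglongrightarrow> 0 + 0"
      by (intro tendsto_add) auto
    then show ?case using add by (simp add: algebra_simps)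
  next
    case (scale p c)
    then have "(\<lambda>n. c * ((\<integral>\<omega>. p (V n \<omega>) \<partial>M) - (\<integral>\<omega>. p (U n \<omega>) \<partial>N))) \<longlonglongrightarrow> c * 0"
      by (intro tendsto_mult_left) auto
    then show ?case using scale by (simp add: algebra_simps)
  }
qed

text \<open>Chebyshev's inequality: off the cube some \<open>(x j)\<^sup>2 / A\<^sup>2\<close> is at
  least one, so the sum of these quotients pays for the trivial bound
  \<open>2 * K + e\<close>.\<close>

lemma expectation_trig_approx:
  fixes h :: "(nat \<Rightarrow> real) \<Rightarrow> real"
  assumes M: "prob_space M"
    and V [measurable]: "\<And>j. (\<lambda>\<omega>. V \<omega> j) \<in> borel_measurable M"
    and V2: "\<And>j. j < d \<Longrightarrow> integrable M (\<lambda>\<omega>. (V \<omega> j)\<^sup>2) \<and> (\<integral>\<omega>. (V \<omega> j)\<^sup>2 \<partial>M) \<le> c"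
    and h: "continuous_on UNIV h" "\<And>x. \<bar>h x\<bar> \<le> K" and A: "A > 0" and e: "e \<ge> 0"
    and q: "q \<in> trig_poly d" "\<And>x. \<bar>q x\<bar> \<le> K + e"
    "\<And>x. (\<And>j. j < d \<Longrightarrow> \<bar>x j\<bar> \<le> A) \<Longrightarrow> \<bar>h x - q x\<bar> \<le> e"
  shows "\<bar>(\<integral>\<omega>. h (V \<omega>) \<partial>M) - (\<integral>\<omega>. q (V \<omega>) \<partial>M)\<bar> \<le> e + (2 * K + e) * (real d * c / A\<^sup>2)"
proof -
  interpret prob_space M by fact
  have [measurable]: "V \<in> borel_measurable M" by (rule measurable_coordinatewise_then_product) measurable
  have hm [measurable]: "(\<lambda>\<omega>. h (V \<omega>)) \<in> borel_measurable M"
    using borel_measurable_continuous_onI[OF h(1)] by measurable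
  have qm [measurable]: "(\<lambda>\<omega>. q (V \<omega>)) \<in> borel_measurable M" by (rule trig_poly_measurable[OF q(1)]) measurable
  have K: "0 \<le> K" using h(2) by (metis abs_ge_zero order_trans)
  have ih: "integrable M (\<lambda>\<omega>. h (V \<omega>))" by (rule integrable_const_bound[of _ K]) (use h in auto)
  have iq: "integrable M (\<lambda>\<omega>. q (V \<omega>))" by (rule integrable_const_bound[of _ "K + e"]) (use q in auto)
  have pw: "\<bar>h x - q x\<bar> \<le> e + (2 * K + e) * (\<Sum>j<d. (x j)\<^sup>2 / A\<^sup>2)" for x
  proof (cases "\<forall>j<d. \<bar>x j\<bar> \<le> A")
    case True
    then have "\<bar>h x - q x\<bar> \<le> e" using q(3) by blast
    moreover have "0 \<le> (2 * K + e) * (\<Sum>j<d. (x j)\<^sup>2 / A\<^sup>2)" using K e by (intro mult_nonneg_nonneg sum_nonneg) auto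
    ultimately show ?thesis by simp
  next
    case False
    then obtain j where j: "j < d" "\<bar>x j\<bar> > A" by auto
    have "1 \<le> (x j)\<^sup>2 / A\<^sup>2" using j A by (simp add: abs_le_square_iff[symmetric])
    also have "\<dots> \<le> (\<Sum>j<d. (x j)\<^sup>2 / A\<^sup>2)" using j by (intro member_le_sum) auto
    finally have "(2 * K + e) * 1 \<le> (2 * K + e) * (\<Sum>j<d. (x j)\<^sup>2 / A\<^sup>2)" using K e by (intro mult_left_mono) auto
    moreover have "\<bar>h x - q x\<bar> \<le> 2 * K + e" using h(2)[of x] q(2)[of x] by linarith
    ultimately show ?thesis using e by simp
  qed
  have "\<bar>(\<integral>\<omega>. h (V \<omega>) \<partial>M) - (\<integral>\<omega>. q (V \<omega>) \<partial>M)\<bar> = \<bar>\<integral>\<omega>. h (V \<omega>) - q (V \<omega>) \<partial>M\<bar>"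
    using ih iq by simp
  also have "\<dots> \<le> (\<integral>\<omega>. \<bar>h (V \<omega>) - q (V \<omega>)\<bar> \<partial>M)" by (rule integral_abs_bound)
  also have "\<dots> \<le> (\<integral>\<omega>. e + (2 * K + e) * (\<Sum>j<d. (V \<omega> j)\<^sup>2 / A\<^sup>2) \<partial>M)"
    by (intro integral_mono Bochner_Integration.integrable_add integrable_mult_right
      Bochner_Integration.integrable_sum integrable_divide) (use ih iq V2 pw in auto)
  also have "\<dots> = e + (2 * K + e) * (\<Sum>j<d. (\<integral>\<omega>. (V \<omega> j)\<^sup>2 \<partial>M) / A\<^sup>2)"
  proof -
    have i: "integrable M (\<lambda>\<omega>. (V \<omega> j)\<^sup>2 / A\<^sup>2)" if "j \<in> {..<d}" for j
      using V2 that by simp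
    have "(\<integral>\<omega>. (\<Sum>j<d. (V \<omega> j)\<^sup>2 / A\<^sup>2) \<partial>M) = (\<Sum>j<d. \<integral>\<omega>. (V \<omega> j)\<^sup>2 / A\<^sup>2 \<partial>M)"
      by (rule Bochner_Integration.integral_sum[OF i])
    moreover have "integrable M (\<lambda>\<omega>. \<Sum>j<d. (V \<omega> j)\<^sup>2 / A\<^sup>2)"
      by (rule Bochner_Integration.integrable_sum[OF i])
    ultimately show ?thesis by (simp add: prob_space)
  qed
  also have "\<dots> \<le> e + (2 * K + e) * (\<Sum>j<d. c / A\<^sup>2)"
    by (intro add_left_mono mult_left_mono sum_mono divide_right_mono) (use V2 K e in auto)
  finally show ?thesis by simp
qed

text \<open>A form of the continuity theorem in which the common limit of the characteristic functions
  need not be identified as one of a random vector.\<close>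

theorem expectation_diff_of_char_tendsto:
  fixes h :: "(nat \<Rightarrow> real) \<Rightarrow> real"
  assumes M: "prob_space M" and N: "prob_space N"
    and V: "\<And>n j. (\<lambda>\<omega>. V n \<omega> j) \<in> borel_measurable M" and U: "\<And>n j. (\<lambda>\<omega>. U n \<omega> j) \<in> borel_measurable N"
    and V2: "\<And>n j. j < d \<Longrightarrow> integrable M (\<lambda>\<omega>. (V n \<omega> j)\<^sup>2) \<and> (\<integral>\<omega>. (V n \<omega> j)\<^sup>2 \<partial>M) \<le> c"
    and U2: "\<And>n j. j < d \<Longrightarrow> integrable N (\<lambda>\<omega>. (U n \<omega> j)\<^sup>2) \<and> (\<integral>\<omega>. (U n \<omega> j)\<^sup>2 \<partial>N) \<le> c"
    and chV: "\<And>u. (\<lambda>n. \<integral>\<omega>. iexp (\<Sum>j<d. u j * V n \<omega> j) \<partial>M) \<longlonglongrightarrow> \<psi> u"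
    and chU: "\<And>u. (\<lambda>n. \<integral>\<omega>. iexp (\<Sum>j<d. u j * U n \<omega> j) \<partial>N) \<longlonglongrightarrow> \<psi> u"
    and h: "continuous_on UNIV h" "\<And>x. \<bar>h x\<bar> \<le> K"
    and dep: "\<And>x. h x = h (\<lambda>j. if j < d then x j else 0)"
  shows "(\<lambda>n. (\<integral>\<omega>. h (V n \<omega>) \<partial>M) - (\<integral>\<omega>. h (U n \<omega>) \<partial>N)) \<longlonglongrightarrow> 0"
proof (rule LIMSEQ_I)
  fix r :: real assume r: "r > 0"
  \<comment> \<open>Five errors of size at most \<open>e\<close> are collected: two for each of the
    two passages to \<open>q\<close>, and one for the difference of the expectations of
    \<open>q\<close>.\<close>
  define e where "e = r / 6"
  have e: "e > 0" using r by (simp add: e_def)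
  have "((\<lambda>A. (2 * K + e) * (real d * c / A\<^sup>2)) \<longlongrightarrow> (2 * K + e) * 0) at_top"
    by (intro tendsto_intros tendsto_divide_0[OF tendsto_const] filterlim_at_top_imp_at_infinity)
      (auto intro!: filterlim_pow_at_top filterlim_ident)
  then have "eventually (\<lambda>A. (2 * K + e) * (real d * c / A\<^sup>2) < e \<and> A > 0) at_top"
    using e by (intro eventually_conj eventually_gt_at_top order_tendstoD(2)[where a = e]) auto
  then obtain A where A: "(2 * K + e) * (real d * c / A\<^sup>2) < e" "A > 0"
    by (metis (mono_tags, lifting) eventually_happens' trivial_limit_at_top_linorder)
  obtain q where q: "q \<in> trig_poly d" "\<And>x. \<bar>q x\<bar> \<le> K + e"
    "\<And>x. (\<And>j. j < d \<Longrightarrow> \<bar>x j\<bar> \<le> A) \<Longrightarrow> \<bar>h x - q x\<bar> \<le> e"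
    using trig_poly_approx[OF h dep A(2) e] by blast
  have aV: "\<bar>(\<integral>\<omega>. h (V n \<omega>) \<partial>M) - (\<integral>\<omega>. q (V n \<omega>) \<partial>M)\<bar> \<le> e + (2 * K + e) * (real d * c / A\<^sup>2)" for n
    by (rule expectation_trig_approx[OF M V V2 h A(2) less_imp_le[OF e] q])
  have aU: "\<bar>(\<integral>\<omega>. h (U n \<omega>) \<partial>N) - (\<integral>\<omega>. q (U n \<omega>) \<partial>N)\<bar> \<le> e + (2 * K + e) * (real d * c / A\<^sup>2)" for n
    by (rule expectation_trig_approx[OF N U U2 h A(2) less_imp_le[OF e] q])
  have "(\<lambda>n. (\<integral>\<omega>. q (V n \<omega>) \<partial>M) - (\<integral>\<omega>. q (U n \<omega>) \<partial>N)) \<longlonglongrightarrow> 0"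
    using trig_poly_expectation_diff[OF M N V U chV chU q(1)] by blast
  from LIMSEQ_D[OF this e] obtain n0 where n0: "\<And>n. n \<ge> n0 \<Longrightarrow> \<bar>(\<integral>\<omega>. q (V n \<omega>) \<partial>M) - (\<integral>\<omega>. q (U n \<omega>) \<partial>N)\<bar> < e"
    by auto
  have "norm ((\<integral>\<omega>. h (V n \<omega>) \<partial>M) - (\<integral>\<omega>. h (U n \<omega>) \<partial>N) - 0) < r" if "n \<ge> n0" for n
    using aV[of n] aU[of n] n0[OF that] A(1) e_def unfolding real_norm_def by linarith
  then show "\<exists>n0. \<forall>n\<ge>n0. norm ((\<integral>\<omega>. h (V n \<omega>) \<partial>M) - (\<integral>\<omega>. h (U n \<omega>) \<partial>N) - 0) < r" by blast
qed

section \<open>Positive semidefinite kernels\<close>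

text \<open>The points may repeat, so any further point can be appended to a finite family; the
  argument for the Schur complement relies on this.\<close>

definition psd_kernel :: "('a \<Rightarrow> 'a \<Rightarrow> real) \<Rightarrow> bool" where
  "psd_kernel K \<longleftrightarrow> (\<forall>s t. K s t = K t s) \<and>
     (\<forall>n (a :: nat \<Rightarrow> real) t. 0 \<le> (\<Sum>i<n. \<Sum>j<n. a i * a j * K (t i) (t j)))"

lemma psd_kernel_sym: "psd_kernel K \<Longrightarrow> K s t = K t s"
  unfolding psd_kernel_def by blast

lemma psd_kernel_diag: "psd_kernel K \<Longrightarrow> 0 \<le> K t t"
  unfolding psd_kernel_def by (drule conjunct2, drule spec[of _ 1], drule spec[of _ "\<lambda>_. 1"], drule spec[of _ "\<lambda>_. t"]) simp

lemma psd_kernel_two: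
  assumes "psd_kernel K"
  shows "0 \<le> a * a * K s s + 2 * a * b * K s t + b * b * K t t"
proof -
  have "0 \<le> (\<Sum>i<2. \<Sum>j<2. (if i = 0 then a else b) * (if j = 0 then a else b) *
      K (if i = (0::nat) then s else t) (if j = (0::nat) then s else t))"
    using assms unfolding psd_kernel_def
    by (elim conjE allE[of _ 2] allE[of _ "\<lambda>i::nat. if i = 0 then a else b"] allE[of _ "\<lambda>i::nat. if i = 0 then s else t"])
      assumption
  then show ?thesis using psd_kernel_sym[OF assms, of s t]
    by (simp add: numeral_2_eq_2 algebra_simps)
qed

lemma psd_kernel_Cauchy_Schwarz:
  assumes K: "psd_kernel K"
  shows "(K s t)\<^sup>2 \<le> K s s * K t t"
proof (cases "K t t = 0")
  case True
  have "K s t = 0"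
  proof (rule ccontr)
    assume n: "K s t \<noteq> 0"
    \<comment> \<open>With \<open>K t t = 0\<close> the form is linear in the second coefficient,
      which is chosen to give it the value \<open>- 1\<close>.\<close>
    have "0 \<le> 1 * 1 * K s s + 2 * 1 * (- (K s s + 1) / (2 * K s t)) * K s t
        + (- (K s s + 1) / (2 * K s t)) * (- (K s s + 1) / (2 * K s t)) * K t t"
      by (rule psd_kernel_two[OF K])
    then show False using n True by (simp add: field_simps)
  qed
  then show ?thesis using True by simp
next
  case False
  then have p: "K t t > 0" using psd_kernel_diag[OF K, of t] by simp
  \<comment> \<open>The coefficients are those of the minimizing combination, cleared of the
    denominator \<open>K t t\<close>.\<close>
  have "0 \<le> K t t * K t t * K s s + 2 * K t t * (- K s t) * K s t + (- K s t) * (- K s t) * K t t"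
    by (rule psd_kernel_two[OF K])
  then have "0 \<le> K t t * (K s s * K t t - (K s t)\<^sup>2)"
    by (simp add: power2_eq_square algebra_simps)
  then show ?thesis using p by (simp add: zero_le_mult_iff)
qed

text \<open>For \<open>K p p = 0\<close> the quotient below is \<open>0\<close> by convention, and the kernel is unchanged.\<close>

lemma psd_kernel_schur:
  assumes K: "psd_kernel K"
  shows "psd_kernel (\<lambda>s t. K s t - K s p * K t p / K p p)"
  unfolding psd_kernel_def
proof (intro conjI allI)
  show "K s t - K s p * K t p / K p p = K t s - K t p * K s p / K p p" for s t
    using psd_kernel_sym[OF K] by (simp add: mult.commute)
  fix n and a :: "nat \<Rightarrow> real" and t :: "nat \<Rightarrow> 'a"
  define Q where "Q = (\<Sum>i<n. \<Sum>j<n. a i * a j * K (t i) (t j))"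
  define r where "r = (\<Sum>i<n. a i * K (t i) p)"
  have eq: "(\<Sum>i<n. \<Sum>j<n. a i * a j * (K (t i) (t j) - K (t i) p * K (t j) p / K p p)) = Q - r * r / K p p"
  proof -
    have "r * r / K p p = (\<Sum>i<n. \<Sum>j<n. a i * a j * (K (t i) p * K (t j) p / K p p))"
      unfolding r_def sum_product sum_divide_distrib by (intro sum.cong refl) (simp add: mult_ac)
    then show ?thesis unfolding Q_def by (simp add: right_diff_distrib sum_subtractf)
  qed
  \<comment> \<open>The coefficient of the appended point \<open>p\<close> that minimizes
    \<open>Q + 2 * c * r + c * c * K p p\<close>; the minimal value is the quadratic form of the
    Schur complement. For \<open>K p p = 0\<close> it is zero.\<close>
  define c where "c = - r / K p p"
  define a' where "a' i = (if i < n then a i else c)" for i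
  define t' where "t' i = (if i < n then t i else p)" for i
  have "0 \<le> (\<Sum>i<Suc n. \<Sum>j<Suc n. a' i * a' j * K (t' i) (t' j))"
    using K unfolding psd_kernel_def by blast
  also have "\<dots> = (\<Sum>i<n. (\<Sum>j<n. a' i * a' j * K (t' i) (t' j)) + a' i * a' n * K (t' i) (t' n))
      + ((\<Sum>j<n. a' n * a' j * K (t' n) (t' j)) + a' n * a' n * K (t' n) (t' n))"
    by simp
  also have "\<dots> = (\<Sum>i<n. (\<Sum>j<n. a i * a j * K (t i) (t j)) + c * (a i * K (t i) p))
      + ((\<Sum>j<n. c * (a j * K (t j) p)) + c * c * K p p)"
  proof (intro arg_cong2[of _ _ _ _ "(+)"] sum.cong refl)
    fix j assume "j \<in> {..<n}"
    then show "a' n * a' j * K (t' n) (t' j) = c * (a j * K (t j) p)"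
      using psd_kernel_sym[OF K, of p "t j"] by (simp add: a'_def t'_def)
  qed (auto simp: a'_def t'_def)
  also have "\<dots> = Q + 2 * c * r + c * c * K p p"
    unfolding Q_def r_def by (simp add: sum.distrib sum_distrib_left mult_ac)
  also have "\<dots> = Q - r * r / K p p"
    by (cases "K p p = 0") (simp_all add: c_def field_simps)
  finally show "0 \<le> (\<Sum>i<n. \<Sum>j<n. a i * a j * (K (t i) (t j) - K (t i) p * K (t j) p / K p p))"
    by (simp add: eq)
qed

text \<open>Iterated Schur complements: for a Gaussian process with covariance \<open>K\<close> this
  is the conditional covariance given the values at the first \<open>m\<close> pivots.\<close>

primrec residual :: "('a \<Rightarrow> 'a \<Rightarrow> real) \<Rightarrow> (nat \<Rightarrow> 'a) \<Rightarrow> nat \<Rightarrow> 'a \<Rightarrow> 'a \<Rightarrow> real" where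
  "residual K p 0 = K"
| "residual K p (Suc m) = (\<lambda>s t. residual K p m s t -
     residual K p m s (p m) * residual K p m t (p m) / residual K p m (p m) (p m))"

text \<open>A vanishing pivot yields the zero function through division by zero, in accordance with
  \<open>residual\<close>, which does not change in that step.\<close>

definition cholesky :: "('a \<Rightarrow> 'a \<Rightarrow> real) \<Rightarrow> (nat \<Rightarrow> 'a) \<Rightarrow> nat \<Rightarrow> 'a \<Rightarrow> real" where
  "cholesky K p m t = residual K p m t (p m) / sqrt (residual K p m (p m) (p m))"

lemma psd_residual: "psd_kernel K \<Longrightarrow> psd_kernel (residual K p m)"
  by (induction m) (simp_all add: psd_kernel_schur)

lemma kernel_eq_residual_plus_cholesky:
  assumes K: "psd_kernel K"
  shows "K s t = residual K p M s t + (\<Sum>m<M. cholesky K p m s * cholesky K p m t)"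
proof (induction M)
  case (Suc M)
  have "sqrt (residual K p M (p M) (p M)) * sqrt (residual K p M (p M) (p M)) = residual K p M (p M) (p M)"
    using psd_kernel_diag[OF psd_residual[OF K]] by simp
  then have "cholesky K p M s * cholesky K p M t =
      residual K p M s (p M) * residual K p M t (p M) / residual K p M (p M) (p M)"
    unfolding cholesky_def by (simp add: times_divide_times_eq)
  then show ?case using Suc by simp
qed simp

text \<open>Eliminating a pivot annihilates its column, and later eliminations keep it zero. For a
  pivot of zero variance the column vanishes already by Cauchy-Schwarz.\<close>

lemma residual_pivot:
  assumes K: "psd_kernel K"
  shows "m < M \<Longrightarrow> residual K p M s (p m) = 0"
proof (induction M arbitrary: s)
  case (Suc M)
  note R = psd_residual[OF K, of p M]
  show ?case
  proof (cases "m = M")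
    case True
    have "residual K p M (p M) (p M) = 0 \<Longrightarrow> residual K p M s (p M) = 0"
      using psd_kernel_Cauchy_Schwarz[OF R, of s "p M"] by simp
    then show ?thesis using True by (cases "residual K p M (p M) (p M) = 0") auto
  next
    case False
    then have "residual K p M s (p m) = 0" "residual K p M (p m) (p M) = 0"
      using Suc psd_kernel_sym[OF R, of "p m" "p M"] by auto
    then show ?thesis by simp
  qed
qed simp

text \<open>Bessel's inequality: the residual is positive semidefinite, hence nonnegative at a
  single point and on the difference of two points.\<close>

lemma cholesky_sum_le:
  assumes K: "psd_kernel K"
  shows "(\<Sum>m<M. (cholesky K p m t)\<^sup>2) \<le> K t t"
    "(\<Sum>m<M. (cholesky K p m s - cholesky K p m t)\<^sup>2) \<le> K s s - 2 * K s t + K t t"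
proof -
  let ?c = "cholesky K p"
  show "(\<Sum>m<M. (?c m t)\<^sup>2) \<le> K t t"
    using kernel_eq_residual_plus_cholesky[OF K, of t t p M] psd_kernel_diag[OF psd_residual[OF K], of p M t]
    by (simp add: power2_eq_square)
  have "(\<Sum>m<M. (?c m s - ?c m t)\<^sup>2) =
    (\<Sum>m<M. ?c m s * ?c m s) - 2 * (\<Sum>m<M. ?c m s * ?c m t) + (\<Sum>m<M. ?c m t * ?c m t)"
    by (simp add: power2_eq_square algebra_simps sum.distrib sum_subtractf sum_distrib_left)
  then show "(\<Sum>m<M. (?c m s - ?c m t)\<^sup>2) \<le> K s s - 2 * K s t + K t t"
    using kernel_eq_residual_plus_cholesky[OF K, of s s p M] kernel_eq_residual_plus_cholesky[OF K, of s t p M]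
      kernel_eq_residual_plus_cholesky[OF K, of t t p M]
      psd_kernel_two[OF psd_residual[OF K], of 1 p M s "-1" t] by simp
qed

text \<open>The expression in \<open>dense\<close> is the squared distance from \<open>t\<close> to
  a pivot in the pseudometric of the kernel. Once that pivot is eliminated, the residual variance at
  \<open>t\<close> is at most this distance; Cauchy-Schwarz for the residual settles the values off
  the diagonal.\<close>

lemma cholesky_sums:
  assumes K: "psd_kernel K"
    and dense: "\<And>e. e > 0 \<Longrightarrow> \<exists>m. K t t - 2 * K t (p m) + K (p m) (p m) < e"
  shows "(\<lambda>m. cholesky K p m s * cholesky K p m t) sums K s t"
proof -
  let ?R = "residual K p"
  note R = psd_residual[OF K, of p]
  have tt: "(\<lambda>M. ?R M t t) \<longlonglongrightarrow> 0"
  proof (rule LIMSEQ_I)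
    fix e :: real assume "e > 0"
    then obtain m where m: "K t t - 2 * K t (p m) + K (p m) (p m) < e" using dense by blast
    have "norm (?R M t t - 0) < e" if "M \<ge> Suc m" for M
    proof -
      have "?R M t (p m) = 0" "?R M (p m) (p m) = 0" using residual_pivot[OF K] that by auto
      then have "?R M t t = K t t - 2 * K t (p m) + K (p m) (p m) -
         (\<Sum>k<M. (cholesky K p k t - cholesky K p k (p m))\<^sup>2)"
        using kernel_eq_residual_plus_cholesky[OF K, of t t p M] kernel_eq_residual_plus_cholesky[OF K, of t "p m" p M]
          kernel_eq_residual_plus_cholesky[OF K, of "p m" "p m" p M]
        by (simp add: power2_eq_square algebra_simps sum.distrib sum_subtractf sum_distrib_left)
      moreover have "0 \<le> (\<Sum>k<M. (cholesky K p k t - cholesky K p k (p m))\<^sup>2)" by (simp add: sum_nonneg)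
      moreover have "0 \<le> ?R M t t" by (rule psd_kernel_diag[OF R])
      ultimately show ?thesis using m by simp
    qed
    then show "\<exists>N. \<forall>M\<ge>N. norm (?R M t t - 0) < e" by blast
  qed
  have "(\<lambda>M. ?R M s t) \<longlonglongrightarrow> 0"
  proof (rule Lim_null_comparison)
    have "norm (?R M s t) \<le> sqrt (K s s * ?R M t t)" for M
    proof -
      have "?R M s s \<le> K s s"
        using kernel_eq_residual_plus_cholesky[OF K, of s s p M] by (simp add: sum_nonneg)
      then have "?R M s s * ?R M t t \<le> K s s * ?R M t t"
        using psd_kernel_diag[OF R] by (intro mult_right_mono)
      then have "(?R M s t)\<^sup>2 \<le> K s s * ?R M t t" using psd_kernel_Cauchy_Schwarz[OF R, of M s t] by simp
      then show ?thesis by (metis real_sqrt_abs real_sqrt_le_mono real_norm_def)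
    qed
    then show "eventually (\<lambda>M. norm (?R M s t) \<le> sqrt (K s s * ?R M t t)) sequentially" by simp
    have "(\<lambda>M. sqrt (K s s * ?R M t t)) \<longlonglongrightarrow> sqrt (K s s * 0)" by (intro tendsto_intros tt)
    then show "(\<lambda>M. sqrt (K s s * ?R M t t)) \<longlonglongrightarrow> 0" by simp
  qed
  then have "(\<lambda>M. K s t - ?R M s t) \<longlonglongrightarrow> K s t - 0" by (intro tendsto_intros)
  moreover have "K s t - ?R M s t = (\<Sum>m<M. cholesky K p m s * cholesky K p m t)" for M
    using kernel_eq_residual_plus_cholesky[OF K, of s t p M] by simp
  ultimately show ?thesis unfolding sums_def by simp
qed

section \<open>Martingale approximation on the path space\<close>

abbreviation (input) coord :: "int \<Rightarrow> (int \<Rightarrow> real) \<Rightarrow> real" where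
  "coord i y \<equiv> y i"

text \<open>The direction is chosen so that composition with the shift preserves measurability with
  respect to the coordinates \<open>i \<le> 0\<close>.\<close>

definition bshift :: "(int \<Rightarrow> real) \<Rightarrow> int \<Rightarrow> real" where
  "bshift y = (\<lambda>i. y (i - 1))"

lemma bshift_pow: "(bshift ^^ n) y = (\<lambda>i. y (i - int n))"
  by (induction n) (auto simp: bshift_def fun_eq_iff algebra_simps)

lemma measurable_coord: "sets P = sets path_space \<Longrightarrow> coord i \<in> borel_measurable P"
  by (subst measurable_cong_sets[of P path_space borel borel]) simp_all

lemma measurable_bshift: "sets P = sets path_space \<Longrightarrow> bshift \<in> measurable P P"
proof -
  have "bshift \<in> measurable path_space path_space"
    unfolding bshift_def by (intro measurable_PiM_single') (auto simp: space_PiM)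
  then show "sets P = sets path_space \<Longrightarrow> bshift \<in> measurable P P"
    by (subst measurable_cong_sets[of P path_space P path_space])
qed

lemma space_path: "sets P = sets path_space \<Longrightarrow> space P = UNIV"
  using sets_eq_imp_space_eq[of P path_space] by (simp add: space_PiM)

lemma space_past [simp]: "space (past M Y) = space M"
  unfolding past_def by (intro space_measure_of) auto

lemma measurable_past: "i \<le> 0 \<Longrightarrow> Y i \<in> borel_measurable (past M Y)"
proof (rule measurableI)
  fix A :: "real set" assume "i \<le> 0" "A \<in> sets borel"
  then have "Y i -` A \<inter> space M \<in> sets (past M Y)"
    unfolding past_def by (intro in_measure_of) auto
  then show "Y i -` A \<inter> space (past M Y) \<in> sets (past M Y)" by simp
qed simp

lemma subalgebra_past:
  assumes "\<And>i. Y i \<in> borel_measurable M"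
  shows "subalgebra M (past M Y)"
proof -
  have "sets (past M Y) \<subseteq> sets M"
    unfolding past_def using assms
    by (subst sets_measure_of) (auto intro!: sets.sigma_sets_subset)
  then show ?thesis by (simp add: subalgebra_def)
qed

lemma measurable_pastI:
  assumes "f \<in> space N \<rightarrow> space M"
    and "\<And>i. i \<le> 0 \<Longrightarrow> (\<lambda>x. Y i (f x)) \<in> borel_measurable N"
  shows "f \<in> measurable N (past M Y)"
  unfolding past_def
proof (rule measurable_measure_of)
  fix A assume "A \<in> {Y i -` B \<inter> space M |i B. i \<le> 0 \<and> B \<in> sets borel}"
  then obtain i B where A: "A = Y i -` B \<inter> space M" "i \<le> 0" "B \<in> sets borel" by blast
  have "f -` A \<inter> space N = (\<lambda>x. Y i (f x)) -` B \<inter> space N" using assms(1) by (auto simp: A)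
  then show "f -` A \<inter> space N \<in> sets N" using measurable_sets[OF assms(2)[OF A(2)] A(3)] by simp
qed (use assms(1) in auto)

lemma norm_iexp_diff_le: "norm (iexp a - iexp b) \<le> \<bar>a - b\<bar>" for a b :: real
proof -
  have "iexp a - iexp b = iexp b * (iexp (a - b) - 1)"
    by (simp add: exp_diff algebra_simps exp_minus field_simps)
  then show ?thesis using iexp_approx1[of "a - b" 0] by (simp add: norm_mult)
qed

lemma norm_square_le: "\<bar>x\<bar> \<le> K \<Longrightarrow> norm (x\<^sup>2) \<le> K\<^sup>2" for x K :: real
  using power_mono[of "\<bar>x\<bar>" K 2] by simp

text \<open>The mixing condition is tested against bounded weights from the past. It then involves
  integrals only and can be carried over to an image measure; conditional expectations with a
  pointwise bound are recovered in \<open>mixf_cond_exp\<close>. \<open>\<psi>\<close> is a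
  decreasing rate and not the coefficient itself.\<close>

locale mixing_path = prob_space P for P :: "(int \<Rightarrow> real) measure" +
  fixes \<psi> :: "nat \<Rightarrow> real"
  assumes sets_P: "sets P = sets path_space"
    and bshift_pres: "distr P P bshift = P"
    and bshift_erg: "\<And>A. A \<in> sets P \<Longrightarrow> bshift -` A = A \<Longrightarrow> prob A = 0 \<or> prob A = 1"
    and psi_nonneg: "\<And>k. 0 \<le> \<psi> k"
    and psi_decr: "\<And>j k. 1 \<le> j \<Longrightarrow> j \<le> k \<Longrightarrow> \<psi> k \<le> \<psi> j"
    and psi_sqrt_summable: "summable (\<lambda>k. sqrt (\<psi> (Suc k) / real (Suc k)))"
    and mixing: "\<And>W K k t. W \<in> borel_measurable (past P coord) \<Longrightarrow> (\<And>y. \<bar>W y\<bar> \<le> K) \<Longrightarrow> 1 \<le> k \<Longrightarrow>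
       \<bar>\<integral>y. W y * (indicator {..t} (y (int k)) - distr_fun P coord t) \<partial>P\<bar> \<le> \<psi> k * (\<integral>y. \<bar>W y\<bar> \<partial>P)"
begin

abbreviation "\<F> \<equiv> past P coord"

lemma coord_meas [measurable]: "coord i \<in> borel_measurable P"
  by (rule measurable_coord[OF sets_P])

lemma space_P [simp]: "space P = UNIV" by (rule space_path[OF sets_P])

lemma prob_UNIV [simp]: "prob UNIV = 1" using prob_space by simp

lemma half_space_meas [measurable]: "{y. y i \<le> t} \<in> sets P"
proof -
  have "{y \<in> space P. y i \<le> t} \<in> sets P" by measurable
  then show ?thesis by simp
qed

lemma subalg: "subalgebra P \<F>" by (rule subalgebra_past) measurable

lemma meas_F_P: "f \<in> borel_measurable \<F> \<Longrightarrow> f \<in> borel_measurable P"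
  by (rule measurable_from_subalg[OF subalg])

lemma coord_meas_F: "i \<le> 0 \<Longrightarrow> coord i \<in> borel_measurable \<F>"
  by (rule measurable_past)

lemma bshift_meas_F [measurable]: "bshift \<in> measurable \<F> \<F>"
  by (rule measurable_pastI) (auto simp: bshift_def coord_meas_F)

sublocale ergodic_system P bshift
  by unfold_locales (use measurable_bshift[OF sets_P] bshift_pres bshift_erg in auto)

sublocale past: finite_measure_subalgebra P \<F>
  by unfold_locales (rule subalg)

lemma integral_shift:
  assumes "f \<in> borel_measurable P"
  shows "(\<integral>y. f (\<lambda>i. y (i - int n)) \<partial>P) = (\<integral>y. (f y :: 'c::{banach, second_countable_topology}) \<partial>P)"
  using integral_B_pow[OF assms, of n] by (simp add: bshift_pow)

abbreviation "F \<equiv> distr_fun P coord"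

lemma F_eq: "F t = prob {y. y 0 \<le> t}"
  unfolding distr_fun_def cdf_def by (subst measure_distr) (auto simp: vimage_def)

lemma bounded_integrable:
  fixes f :: "(int \<Rightarrow> real) \<Rightarrow> 'c::{banach, second_countable_topology}"
  assumes "f \<in> borel_measurable P" "\<And>y. norm (f y) \<le> K"
  shows "integrable P f"
  by (rule integrable_const_bound[of _ K]) (use assms in auto)

text \<open>One constant serves as uniform bound of \<open>Z\<close> and as factor of the rate. Both
  bounds are subadditive, which admits the linear combinations of centered indicators.\<close>

definition mixf :: "real \<Rightarrow> (real \<Rightarrow> real) \<Rightarrow> bool" where
  "mixf c Z \<longleftrightarrow> Z \<in> borel_measurable borel \<and> (\<forall>x. \<bar>Z x\<bar> \<le> c) \<and> (\<integral>y. Z (y 0) \<partial>P) = 0 \<and>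
     (\<forall>W K k. W \<in> borel_measurable \<F> \<longrightarrow> (\<forall>y. \<bar>W y\<bar> \<le> K) \<longrightarrow> 1 \<le> k \<longrightarrow>
       \<bar>\<integral>y. W y * Z (y (int k)) \<partial>P\<bar> \<le> c * \<psi> k * (\<integral>y. \<bar>W y\<bar> \<partial>P))"

lemma
  assumes "mixf c Z"
  shows mixf_meas: "Z \<in> borel_measurable borel" and mixf_bound: "\<bar>Z x\<bar> \<le> c"
    and mixf_mean: "(\<integral>y. Z (y 0) \<partial>P) = 0"
    and mixf_mix: "W \<in> borel_measurable \<F> \<Longrightarrow> (\<And>y. \<bar>W y\<bar> \<le> K) \<Longrightarrow> 1 \<le> k \<Longrightarrow>
       \<bar>\<integral>y. W y * Z (y (int k)) \<partial>P\<bar> \<le> c * \<psi> k * (\<integral>y. \<bar>W y\<bar> \<partial>P)"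
  using assms unfolding mixf_def by blast+

lemma mixf_nonneg: "mixf c Z \<Longrightarrow> 0 \<le> c"
  using mixf_bound by (metis abs_ge_zero order_trans)

lemma mixf_integrable:
  assumes "mixf c Z" shows "integrable P (\<lambda>y. Z (y i))"
  using mixf_meas[OF assms] mixf_bound[OF assms] by (intro bounded_integrable[where K=c]) auto

lemma mixf_integrable_mult:
  assumes "mixf c Z" "W \<in> borel_measurable P" "\<And>y. \<bar>W y\<bar> \<le> K"
  shows "integrable P (\<lambda>y. W y * Z (y i))"
proof (rule bounded_integrable[where K="K * c"])
  show "(\<lambda>y. W y * Z (y i)) \<in> borel_measurable P" using mixf_meas[OF assms(1)] assms(2) by measurable
  show "norm (W y * Z (y i)) \<le> K * c" for y
    unfolding real_norm_def abs_mult
    by (intro mult_mono assms(3) mixf_bound[OF assms(1)] order_trans[OF abs_ge_zero assms(3)]) auto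
qed

lemma mixf_add:
  assumes "mixf c Z" "mixf c' Z'"
  shows "mixf (c + c') (\<lambda>x. Z x + Z' x)"
  unfolding mixf_def
proof (intro conjI allI impI)
  show "(\<lambda>x. Z x + Z' x) \<in> borel_measurable borel"
    using mixf_meas[OF assms(1)] mixf_meas[OF assms(2)] by measurable
  show "\<bar>Z x + Z' x\<bar> \<le> c + c'" for x using mixf_bound[OF assms(1), of x] mixf_bound[OF assms(2), of x] by linarith
  show "(\<integral>y. Z (y 0) + Z' (y 0) \<partial>P) = 0"
    using mixf_integrable[OF assms(1)] mixf_integrable[OF assms(2)] mixf_mean[OF assms(1)] mixf_mean[OF assms(2)] by simp
  fix W :: "(int \<Rightarrow> real) \<Rightarrow> real" and K :: real and k :: nat
  assume W: "W \<in> borel_measurable \<F>" "\<forall>y. \<bar>W y\<bar> \<le> K" and k: "1 \<le> k"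
  have "(\<integral>y. W y * (Z (y (int k)) + Z' (y (int k))) \<partial>P) = (\<integral>y. W y * Z (y (int k)) \<partial>P) + (\<integral>y. W y * Z' (y (int k)) \<partial>P)"
    using mixf_integrable_mult[OF assms(1) meas_F_P[OF W(1)], of K] mixf_integrable_mult[OF assms(2) meas_F_P[OF W(1)], of K] W(2)
    by (simp add: distrib_left)
  then show "\<bar>\<integral>y. W y * (Z (y (int k)) + Z' (y (int k))) \<partial>P\<bar> \<le> (c + c') * \<psi> k * (\<integral>y. \<bar>W y\<bar> \<partial>P)"
    using mixf_mix[OF assms(1) W(1) _ k, of K] mixf_mix[OF assms(2) W(1) _ k, of K] W(2) by (simp add: algebra_simps)
qed

lemma mixf_scale:
  assumes "mixf c Z"
  shows "mixf (\<bar>a\<bar> * c) (\<lambda>x. a * Z x)"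
  unfolding mixf_def
proof (intro conjI allI impI)
  show "(\<lambda>x. a * Z x) \<in> borel_measurable borel"
    using mixf_meas[OF assms(1)] by measurable
  show "\<bar>a * Z x\<bar> \<le> \<bar>a\<bar> * c" for x using mixf_bound[OF assms(1), of x] by (simp add: abs_mult mult_left_mono)
  show "(\<integral>y. a * Z (y 0) \<partial>P) = 0" using mixf_mean[OF assms(1)] by simp
  fix W :: "(int \<Rightarrow> real) \<Rightarrow> real" and K :: real and k :: nat
  assume W: "W \<in> borel_measurable \<F>" "\<forall>y. \<bar>W y\<bar> \<le> K" and k: "1 \<le> k"
  have "(\<integral>y. W y * (a * Z (y (int k))) \<partial>P) = a * (\<integral>y. W y * Z (y (int k)) \<partial>P)"
    by (simp add: mult.left_commute)
  moreover have "\<bar>a\<bar> * \<bar>\<integral>y. W y * Z (y (int k)) \<partial>P\<bar> \<le> \<bar>a\<bar> * (c * \<psi> k * (\<integral>y. \<bar>W y\<bar> \<partial>P))"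
    using mixf_mix[OF assms(1) W(1) _ k, of K] W(2) by (intro mult_left_mono) auto
  ultimately show "\<bar>\<integral>y. W y * (a * Z (y (int k))) \<partial>P\<bar> \<le> \<bar>a\<bar> * c * \<psi> k * (\<integral>y. \<bar>W y\<bar> \<partial>P)"
    by (simp add: abs_mult mult.assoc)
qed

definition ev :: "real \<Rightarrow> real \<Rightarrow> real" where
  "ev t x = indicator {..t} x - F t"

lemma F_bounds: "0 \<le> F t" "F t \<le> 1" by (simp_all add: F_eq)

lemma ev_bound: "\<bar>ev t x\<bar> \<le> 1"
  using F_bounds[of t] by (auto simp: ev_def indicator_def)

lemma ev_measurable [measurable]: "ev t \<in> borel_measurable borel"
  unfolding ev_def by measurable

lemma ind_coord: "indicator {..t} (y i) = (indicator {y. y i \<le> t} y :: real)"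
  by (simp add: indicator_def)

lemma mixf_ev: "mixf 1 (ev t)"
  unfolding mixf_def
proof (intro conjI allI impI)
  show "(\<integral>y. ev t (y 0) \<partial>P) = 0"
    unfolding ev_def ind_coord by (subst Bochner_Integration.integral_diff) (auto simp: F_eq integrable_indicator_iff less_top[symmetric])
  fix W :: "(int \<Rightarrow> real) \<Rightarrow> real" and K :: real and k :: nat
  assume "W \<in> borel_measurable \<F>" "\<forall>y. \<bar>W y\<bar> \<le> K" "1 \<le> k"
  then show "\<bar>\<integral>y. W y * ev t (y (int k)) \<partial>P\<bar> \<le> 1 * \<psi> k * (\<integral>y. \<bar>W y\<bar> \<partial>P)"
    unfolding ev_def using mixing[of W K k t] by simp
qed (use ev_bound in auto)

lemma mixf_sum:
  "finite I \<Longrightarrow> mixf (\<Sum>j\<in>I. \<bar>a j\<bar>) (\<lambda>x. \<Sum>j\<in>I. a j * ev (t j) x)"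
proof (induction rule: finite_induct)
  case empty
  then show ?case by (simp add: mixf_def)
next
  case (insert j I)
  then show ?case using mixf_add[OF mixf_scale[OF mixf_ev, of "a j" "t j"] insert.IH] by simp
qed

text \<open>\<open>E\<close> is the conditional expectation of \<open>Z (y k)\<close> given the past, clipped so that its essential bound
  holds everywhere.\<close>

lemma mixf_cond_exp:
  assumes Z: "mixf c Z" and k: "1 \<le> k"
  obtains E where "E \<in> borel_measurable \<F>" "\<And>y. \<bar>E y\<bar> \<le> c * \<psi> k"
    "\<And>W K. W \<in> borel_measurable \<F> \<Longrightarrow> (\<And>y. \<bar>W y\<bar> \<le> K) \<Longrightarrow> (\<integral>y. W y * E y \<partial>P) = (\<integral>y. W y * Z (y (int k)) \<partial>P)"
proof -
  define b where "b = c * \<psi> k"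
  have b: "0 \<le> b" using mixf_nonneg[OF Z] psi_nonneg by (simp add: b_def)
  define R where "R = real_cond_exp P \<F> (\<lambda>y. Z (y (int k)))"
  have RF [measurable]: "R \<in> borel_measurable \<F>" unfolding R_def by (rule borel_measurable_cond_exp)
  have [measurable]: "R \<in> borel_measurable P" by (rule meas_F_P[OF RF])
  have IR: "integrable P R" unfolding R_def by (rule past.real_cond_exp_int(1)[OF mixf_integrable[OF Z]])
  have WR: "(\<integral>y. W y * R y \<partial>P) = (\<integral>y. W y * Z (y (int k)) \<partial>P)"
    if W: "W \<in> borel_measurable \<F>" "\<And>y. \<bar>W y\<bar> \<le> K" for W K
    unfolding R_def
    by (rule past.real_cond_exp_intg(2)[OF mixf_integrable_mult[OF Z meas_F_P[OF W(1)] W(2)] W(1)])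
       (use mixf_meas[OF Z] in measurable)
  \<comment> \<open>Tested against the indicator of the event where \<open>s * R\<close> exceeds
    \<open>b\<close>, the mixing bound limits the integral of \<open>s * R\<close> over this event
    to \<open>b\<close> times its probability, so the event is null.\<close>
  have side: "AE y in P. s * R y \<le> b" if s: "s = 1 \<or> s = - 1" for s
  proof -
    define D where "D = {y. s * R y > b}"
    have DF: "D \<in> sets \<F>"
    proof -
      have "{y \<in> space \<F>. s * R y > b} \<in> sets \<F>" by measurable
      then show ?thesis by (simp add: D_def)
    qed
    have DP: "D \<in> sets P" using DF subalg by (auto simp: subalgebra_def)
    have WF: "(\<lambda>y. s * indicator D y :: real) \<in> borel_measurable \<F>" using DF by measurable
    have Wb: "\<bar>s * indicator D y\<bar> \<le> (1::real)" for y using s by (auto simp: indicator_def)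
    have "(\<integral>y. (s * indicator D y) * R y \<partial>P) \<le> b * (\<integral>y. \<bar>s * indicator D y\<bar> \<partial>P)"
      using mixf_mix[OF Z WF Wb k] WR[OF WF Wb] by (simp add: b_def)
    moreover have "(\<integral>y. \<bar>s * indicator D y\<bar> \<partial>P) = (\<integral>y. indicator D y \<partial>P)"
      using s by (intro Bochner_Integration.integral_cong) (auto simp: indicator_def)
    moreover have i1: "integrable P (\<lambda>y. (s * indicator D y) * R y)"
      by (rule Bochner_Integration.integrable_bound[OF IR]) (use s DP in \<open>auto simp: indicator_def\<close>)
    moreover have i2: "integrable P (\<lambda>y. indicator D y :: real)"
      using DP by (intro bounded_integrable[where K=1]) (auto simp: indicator_def)
    ultimately have le: "(\<integral>y. indicator D y * (s * R y - b) \<partial>P) \<le> 0"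
      by (simp add: algebra_simps)
    have nn: "0 \<le> indicator D y * (s * R y - b)" for y by (auto simp: D_def indicator_def)
    have "integrable P (\<lambda>y. indicator D y * (s * R y - b))"
      using i1 i2 by (simp add: algebra_simps)
    moreover have "(\<integral>y. indicator D y * (s * R y - b) \<partial>P) = 0"
      using le nn by (intro antisym) auto
    ultimately have "AE y in P. indicator D y * (s * R y - b) = 0"
      using nn by (subst (asm) integral_nonneg_eq_0_iff_AE) auto
    then show ?thesis by eventually_elim (auto simp: D_def indicator_def split: if_splits)
  qed
  define E where "E y = max (- b) (min b (R y))" for y
  have EF: "E \<in> borel_measurable \<F>" unfolding E_def by measurable
  have ER: "AE y in P. E y = R y"
    using side[of 1] side[of "- 1"] by (auto simp: E_def max_def min_def elim!: eventually_elim2)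
  show thesis
  proof (rule that[OF EF])
    show "\<bar>E y\<bar> \<le> c * \<psi> k" for y unfolding E_def b_def[symmetric] using b by auto
    fix W :: "(int \<Rightarrow> real) \<Rightarrow> real" and K :: real assume W: "W \<in> borel_measurable \<F>" "\<And>y. \<bar>W y\<bar> \<le> K"
    have "(\<integral>y. W y * E y \<partial>P) = (\<integral>y. W y * R y \<partial>P)"
      using meas_F_P[OF W(1)] meas_F_P[OF EF] ER by (intro integral_cong_AE) (auto elim!: eventually_mono)
    then show "(\<integral>y. W y * E y \<partial>P) = (\<integral>y. W y * Z (y (int k)) \<partial>P)" using WR[OF W] by simp
  qed
qed

text \<open>The terms \<open>a k\<close> of the convergent series decrease, so
  \<open>(k + 1) * a k\<close> is at most the sum \<open>A\<close>. Since
  \<open>\<psi> (k + 1)\<close> is \<open>(k + 1) * a k * a k\<close>, it is at most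
  \<open>A * a k\<close>.\<close>

lemma psi_summable: "summable (\<lambda>k. \<psi> (Suc k))"
proof -
  define a where "a k = sqrt (\<psi> (Suc k) / real (Suc k))" for k
  have a: "summable a" "\<And>k. 0 \<le> a k" unfolding a_def using psi_sqrt_summable psi_nonneg by auto
  define A where "A = suminf a"
  have le: "\<psi> (Suc k) \<le> A * a k" for k
  proof -
    have "real (Suc k) * a k = (\<Sum>j<Suc k. a k)" by simp
    also have "\<dots> \<le> (\<Sum>j<Suc k. a j)"
    proof (rule sum_mono)
      fix j assume "j \<in> {..<Suc k}"
      then show "a k \<le> a j"
        unfolding a_def by (intro real_sqrt_le_mono frac_le psi_nonneg psi_decr) auto
    qed
    also have "\<dots> \<le> A" unfolding A_def by (rule sum_le_suminf[OF a(1)]) (use a in auto)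
    finally have "real (Suc k) * a k * a k \<le> A * a k" by (rule mult_right_mono) (rule a)
    moreover have "real (Suc k) * a k * a k = \<psi> (Suc k)"
      using psi_nonneg by (simp add: a_def mult.assoc)
    ultimately show ?thesis by simp
  qed
  show ?thesis
    by (rule summable_comparison_test'[OF summable_mult[OF a(1), of A]]) (use le psi_nonneg in auto)
qed

text \<open>The sums run backwards in time, so that they are measurable with respect to the past.\<close>

definition bsum :: "(real \<Rightarrow> real) \<Rightarrow> nat \<Rightarrow> (int \<Rightarrow> real) \<Rightarrow> real" where
  "bsum Z n y = (\<Sum>j<n. Z (y (- int j)))"

lemma bsum_meas [measurable]: "Z \<in> borel_measurable borel \<Longrightarrow> bsum Z n \<in> borel_measurable P"
  unfolding bsum_def by (intro borel_measurable_sum measurable_compose[OF coord_meas])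

lemma bsum_meas_F:
  assumes [measurable]: "Z \<in> borel_measurable borel"
  shows "bsum Z n \<in> borel_measurable \<F>"
proof -
  have "(\<lambda>y. y (- int j)) \<in> borel_measurable \<F>" for j using coord_meas_F[of "- int j"] by simp
  then show ?thesis unfolding bsum_def by (intro borel_measurable_sum measurable_compose[OF _ assms])
qed

lemma bsum_bound: "(\<And>x. \<bar>Z x\<bar> \<le> c) \<Longrightarrow> \<bar>bsum Z n y\<bar> \<le> real n * c"
  unfolding bsum_def using sum_norm_bound[of "{..<n}" "\<lambda>j. Z (y (- int j))" c] by simp

text \<open>Gordin's decomposition: \<open>g\<close> is the sum of the predictions of the future, and \<open>Z + g - g \<circ> bshift\<close>
  is a martingale difference.\<close>

lemma gordin:
  assumes Z: "mixf c Z"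
  obtains d g D G where "d \<in> borel_measurable \<F>" "\<And>y. \<bar>d y\<bar> \<le> D" "\<And>y. \<bar>g y\<bar> \<le> G"
    "\<And>W K. W \<in> borel_measurable \<F> \<Longrightarrow> (\<And>y. \<bar>W y\<bar> \<le> K) \<Longrightarrow> (\<integral>y. W (bshift y) * d y \<partial>P) = 0"
    "\<And>n y. bsum Z n y = (\<Sum>j<n. d ((bshift ^^ j) y)) - g y + g ((bshift ^^ n) y)"
proof -
  define Q where "Q k E \<longleftrightarrow> E \<in> borel_measurable \<F> \<and> (\<forall>y. \<bar>E y\<bar> \<le> c * \<psi> (Suc k)) \<and>
    (\<forall>W K. W \<in> borel_measurable \<F> \<longrightarrow> (\<forall>y. \<bar>W y\<bar> \<le> K) \<longrightarrow>
       (\<integral>y. W y * E y \<partial>P) = (\<integral>y. W y * Z (y (int (Suc k))) \<partial>P))" for k E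
  have "\<exists>E. Q k E" for k
  proof (rule mixf_cond_exp[OF Z, of "Suc k"])
    fix E assume "E \<in> borel_measurable \<F>" "\<And>y. \<bar>E y\<bar> \<le> c * \<psi> (Suc k)"
      "\<And>W K. W \<in> borel_measurable \<F> \<Longrightarrow> (\<And>y. \<bar>W y\<bar> \<le> K) \<Longrightarrow> (\<integral>y. W y * E y \<partial>P) = (\<integral>y. W y * Z (y (int (Suc k))) \<partial>P)"
    then show ?thesis unfolding Q_def by (intro exI[of _ E]) auto
  qed simp
  then obtain E where "\<And>k. Q k (E k)" using choice[of Q] by blast
  then have E: "\<And>k. E k \<in> borel_measurable \<F>" "\<And>k y. \<bar>E k y\<bar> \<le> c * \<psi> (Suc k)"
    "\<And>k W K. W \<in> borel_measurable \<F> \<Longrightarrow> (\<And>y. \<bar>W y\<bar> \<le> K) \<Longrightarrow>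
       (\<integral>y. W y * E k y \<partial>P) = (\<integral>y. W y * Z (y (int (Suc k))) \<partial>P)"
    unfolding Q_def by blast+
  note [measurable] = E(1) mixf_meas[OF Z]
  have [measurable]: "E k \<in> borel_measurable P" for k by (rule meas_F_P[OF E(1)])
  have sb: "summable (\<lambda>k. c * \<psi> (Suc k))" by (rule summable_mult[OF psi_summable])
  have sE: "summable (\<lambda>k. \<bar>E k y\<bar>)" for y
    by (rule summable_comparison_test'[OF sb, of 0]) (use E(2) in auto)
  define G where "G = (\<Sum>k. c * \<psi> (Suc k))"
  define g where "g y = (\<Sum>k. E k y)" for y
  have gF: "g \<in> borel_measurable \<F>" unfolding g_def by measurable
  have [measurable]: "g \<in> borel_measurable P" by (rule meas_F_P[OF gF])
  have gb: "\<bar>g y\<bar> \<le> G" for y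
  proof -
    have "\<bar>g y\<bar> \<le> (\<Sum>k. \<bar>E k y\<bar>)" unfolding g_def by (rule summable_rabs[OF sE])
    also have "\<dots> \<le> G" unfolding G_def by (rule suminf_le[OF E(2) sE sb])
    finally show ?thesis .
  qed
  \<comment> \<open>Against a weight from the past each prediction can be replaced by the value that
    it predicts, so pairing with \<open>g\<close> amounts to a series of pairings with future
    coordinates.\<close>
  have Wg: "(\<lambda>k. \<integral>y. W y * Z (y (int (Suc k))) \<partial>P) sums (\<integral>y. W y * g y \<partial>P)"
    if W: "W \<in> borel_measurable \<F>" "\<And>y. \<bar>W y\<bar> \<le> K" for W K
  proof -
    have [measurable]: "W \<in> borel_measurable P" by (rule meas_F_P[OF W(1)])
    have WE: "\<bar>W y * E k y\<bar> \<le> K * (c * \<psi> (Suc k))" for k y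
      unfolding abs_mult by (intro mult_mono W E(2) order_trans[OF abs_ge_zero W(2)]) auto
    have i: "integrable P (\<lambda>y. W y * E k y)" for k
      by (rule bounded_integrable[where K="K * (c * \<psi> (Suc k))"]) (use WE in auto)
    have "(\<lambda>k. \<integral>y. W y * E k y \<partial>P) sums (\<integral>y. (\<Sum>k. W y * E k y) \<partial>P)"
    proof (rule sums_integral[OF i])
      show "AE y in P. summable (\<lambda>k. norm (W y * E k y))"
        using summable_mult[OF sE] by (auto simp: abs_mult)
      have "(\<integral>y. norm (W y * E k y) \<partial>P) \<le> K * (c * \<psi> (Suc k))" for k
      proof -
        have "(\<integral>y. norm (W y * E k y) \<partial>P) \<le> (\<integral>y. K * (c * \<psi> (Suc k)) \<partial>P)"
          by (rule integral_mono) (use i WE in auto)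
        then show ?thesis by (simp add: prob_space)
      qed
      then show "summable (\<lambda>k. \<integral>y. norm (W y * E k y) \<partial>P)"
        by (intro summable_comparison_test'[OF summable_mult[OF sb, of K], of 0]) auto
    qed
    moreover have "(\<Sum>k. W y * E k y) = W y * g y" for y
      unfolding g_def by (rule suminf_mult[OF summable_rabs_cancel[OF sE]])
    ultimately show ?thesis by (simp add: E(3)[OF W])
  qed
  define d where "d y = Z (y 0) + g y - g (bshift y)" for y
  have [measurable]: "(\<lambda>y. y 0) \<in> borel_measurable \<F>" using coord_meas_F[of 0] by simp
  show thesis
  proof (rule that)
    show "d \<in> borel_measurable \<F>"
      unfolding d_def using gF measurable_compose[OF bshift_meas_F gF] by measurable
    show "\<bar>d y\<bar> \<le> c + 2 * G" for y
      unfolding d_def using mixf_bound[OF Z, of "y 0"] gb[of y] gb[of "bshift y"] by linarith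
    show "\<bar>g y\<bar> \<le> G" for y by (rule gb)
    fix W :: "(int \<Rightarrow> real) \<Rightarrow> real" and K :: real assume W: "W \<in> borel_measurable \<F>" "\<And>y. \<bar>W y\<bar> \<le> K"
    have WB: "(\<lambda>y. W (bshift y)) \<in> borel_measurable \<F>" "\<And>y. \<bar>W (bshift y)\<bar> \<le> K"
      using measurable_compose[OF bshift_meas_F W(1)] W(2) by auto
    have [measurable]: "W \<in> borel_measurable P" "(\<lambda>y. W (bshift y)) \<in> borel_measurable P"
      by (rule meas_F_P[OF W(1)], rule meas_F_P[OF WB(1)])
    have Wgi: "integrable P (\<lambda>y. W (bshift y) * g y)" "integrable P (\<lambda>y. W (bshift y) * g (bshift y))"
      by (rule bounded_integrable[where K="K * G"], measurable, unfold real_norm_def abs_mult,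
          intro mult_mono W gb order_trans[OF abs_ge_zero W(2)] abs_ge_zero)+
    have sh: "(\<integral>y. W y * Z (y (int (Suc k))) \<partial>P) = (\<integral>y. W (bshift y) * Z (y (int k)) \<partial>P)" for k
    proof -
      have "(\<integral>y. W y * Z (y (int (Suc k))) \<partial>P) = (\<integral>y. W (bshift y) * Z (bshift y (int (Suc k))) \<partial>P)"
        by (rule integral_B[symmetric]) measurable
      then show ?thesis by (simp add: bshift_def)
    qed
    \<comment> \<open>By stationarity the pairing of \<open>W\<close> with \<open>g\<close> is the
      series of pairings of \<open>W \<circ> bshift\<close> with \<open>Z (y k)\<close> from
      \<open>k = 0\<close> on, while the pairing of \<open>W \<circ> bshift\<close> with
      \<open>g\<close> is the same series from \<open>k = 1\<close> on. The two differ by the term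
      \<open>k = 0\<close>, which makes \<open>d\<close> orthogonal to
      \<open>W \<circ> bshift\<close>.\<close>
    have "(\<lambda>k. \<integral>y. W (bshift y) * Z (y (int k)) \<partial>P) sums (\<integral>y. W y * g y \<partial>P)"
      using Wg[OF W] by (simp only: sh)
    moreover have "(\<lambda>k. \<integral>y. W (bshift y) * Z (y (int k)) \<partial>P) sums ((\<integral>y. W (bshift y) * g y \<partial>P) + (\<integral>y. W (bshift y) * Z (y (int 0)) \<partial>P))"
      using Wg[OF WB] by (rule sums_Suc[where f="\<lambda>k. \<integral>y. W (bshift y) * Z (y (int k)) \<partial>P"])
    ultimately have "(\<integral>y. W y * g y \<partial>P) = (\<integral>y. W (bshift y) * g y \<partial>P) + (\<integral>y. W (bshift y) * Z (y 0) \<partial>P)"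
      by (simp only: of_nat_0) (rule sums_unique2)
    moreover have "(\<integral>y. W y * g y \<partial>P) = (\<integral>y. W (bshift y) * g (bshift y) \<partial>P)"
      using integral_B[of "\<lambda>y. W y * g y"] by simp
    moreover have "integrable P (\<lambda>y. W (bshift y) * Z (y 0))"
      by (rule mixf_integrable_mult[OF Z _ WB(2)]) measurable
    ultimately show "(\<integral>y. W (bshift y) * d y \<partial>P) = 0"
      unfolding d_def using Wgi by (simp add: algebra_simps)
  next
    show "bsum Z n y = (\<Sum>j<n. d ((bshift ^^ j) y)) - g y + g ((bshift ^^ n) y)" for n y
    proof (induction n)
      case (Suc n)
      have "d ((bshift ^^ n) y) = Z (y (- int n)) + g ((bshift ^^ n) y) - g ((bshift ^^ Suc n) y)"
        by (simp add: d_def bshift_pow)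
      then show ?case using Suc by (simp add: bsum_def)
    qed (simp add: bsum_def)
  qed
qed

text \<open>The sum differs from its martingale part by at most \<open>2 * G\<close>, which
  disappears under the normalization. The martingale has variance exactly \<open>n * V\<close>, so
  \<open>V\<close> is identified with the given \<open>v\<close> by uniqueness of limits and the
  second moment of \<open>d\<close> is never computed.\<close>

lemma bsum_clt:
  assumes Z: "mixf c Z" and var: "(\<lambda>n. (\<integral>y. (bsum Z n y)\<^sup>2 \<partial>P) / real n) \<longlonglongrightarrow> v"
  shows "(\<lambda>n. \<integral>y. iexp (bsum Z n y / sqrt (real n)) \<partial>P) \<longlonglongrightarrow> complex_of_real (exp (- v / 2))"
proof (rule gordin[OF Z])
  fix d g :: "(int \<Rightarrow> real) \<Rightarrow> real" and D G
  assume d: "d \<in> borel_measurable \<F>" "\<And>y. \<bar>d y\<bar> \<le> D" and g: "\<And>y. \<bar>g y\<bar> \<le> G"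
    and mart: "\<And>W K. W \<in> borel_measurable \<F> \<Longrightarrow> (\<And>y. \<bar>W y\<bar> \<le> K) \<Longrightarrow> (\<integral>y. W (bshift y) * d y \<partial>P) = 0"
    and dec: "\<And>n y. bsum Z n y = (\<Sum>j<n. d ((bshift ^^ j) y)) - g y + g ((bshift ^^ n) y)"
  note [measurable] = mixf_meas[OF Z]
  have [measurable]: "d \<in> borel_measurable P" by (rule meas_F_P[OF d(1)])
  define m where "m n y = (\<Sum>j<n. d ((bshift ^^ j) y))" for n y
  have [measurable]: "(bshift ^^ j) \<in> measurable \<F> \<F>" for j
    by (induction j) (auto intro: measurable_comp)
  have mF: "m n \<in> borel_measurable \<F>" for n
    unfolding m_def using d(1) by measurable
  have [measurable]: "m n \<in> borel_measurable P" for n by (rule meas_F_P[OF mF])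
  have mb: "\<bar>m n y\<bar> \<le> real n * D" for n y
    unfolding m_def using sum_norm_bound[of "{..<n}" "\<lambda>j. d ((bshift ^^ j) y)" D] d(2) by simp
  have G: "0 \<le> G" using g by (metis abs_ge_zero order_trans)
  have mS: "\<bar>bsum Z n y - m n y\<bar> \<le> 2 * G" for n y
    unfolding dec m_def using g[of y] g[of "(bshift ^^ n) y"] by linarith
  define V where "V = (\<integral>y. (d y)\<^sup>2 \<partial>P)"
  have V: "0 \<le> V" by (simp add: V_def)
  have im2: "integrable P (\<lambda>y. (m n y)\<^sup>2)" for n
    by (rule bounded_integrable[where K="(real n * D)\<^sup>2"]) (measurable, rule norm_square_le[OF mb])
  have id2: "integrable P (\<lambda>y. (d y)\<^sup>2)"
    by (rule bounded_integrable[where K="D\<^sup>2"]) (measurable, rule norm_square_le[OF d(2)])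
  \<comment> \<open>The newest increment \<open>d\<close> is orthogonal to
    \<open>m n \<circ> bshift\<close>, so the variances add.\<close>
  have m2: "(\<integral>y. (m n y)\<^sup>2 \<partial>P) = real n * V" for n
  proof (induction n)
    case (Suc n)
    have rec: "m (Suc n) y = d y + m n (bshift y)" for y
      unfolding m_def by (simp only: sum.lessThan_Suc_shift) (simp add: funpow_swap1 comp_def funpow_Suc_right del: funpow.simps)
    have i1: "integrable P (\<lambda>y. (m n (bshift y))\<^sup>2)"
      by (rule bounded_integrable[where K="(real n * D)\<^sup>2"]) (measurable, rule norm_square_le[OF mb])
    have i2: "integrable P (\<lambda>y. m n (bshift y) * d y)"
      by (rule bounded_integrable[where K="real n * D * D"])
        (auto simp: abs_mult intro!: mult_mono mb d order_trans[OF abs_ge_zero mb])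
    have "(\<integral>y. (m (Suc n) y)\<^sup>2 \<partial>P) = (\<integral>y. (d y)\<^sup>2 + 2 * (m n (bshift y) * d y) + (m n (bshift y))\<^sup>2 \<partial>P)"
      unfolding rec by (intro Bochner_Integration.integral_cong) (auto simp: power2_sum algebra_simps)
    also have "\<dots> = V + 2 * (\<integral>y. m n (bshift y) * d y \<partial>P) + (\<integral>y. (m n (bshift y))\<^sup>2 \<partial>P)"
      using i1 i2 id2 by (simp add: V_def)
    also have "\<dots> = V + real n * V"
      using mart[OF mF mb] integral_B[of "\<lambda>y. (m n y)\<^sup>2"] Suc by simp
    finally show ?case by (simp add: algebra_simps)
  qed (simp add: m_def)
  have "(\<lambda>n. (\<integral>y. (bsum Z n y)\<^sup>2 \<partial>P) / real n - V) \<longlonglongrightarrow> 0"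
  proof (rule Lim_null_comparison)
    show "(\<lambda>n. 4 * G * (sqrt V / sqrt (real n) + G / real n)) \<longlonglongrightarrow> 0" by real_asymp
    have "norm ((\<integral>y. (bsum Z n y)\<^sup>2 \<partial>P) / real n - V) \<le> 4 * G * (sqrt V / sqrt (real n) + G / real n)" if n: "n > 0" for n
    proof -
      have ib2: "integrable P (\<lambda>y. (bsum Z n y)\<^sup>2)"
        by (rule bounded_integrable[where K="(real n * c)\<^sup>2"])
          (measurable, rule norm_square_le[OF bsum_bound[OF mixf_bound[OF Z]]])
      have im: "integrable P (\<lambda>y. \<bar>m n y\<bar>)" by (rule bounded_integrable[where K="real n * D"]) (use mb in auto)
      have pw: "\<bar>(bsum Z n y)\<^sup>2 - (m n y)\<^sup>2\<bar> \<le> 2 * G * (2 * \<bar>m n y\<bar> + 2 * G)" for y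
      proof -
        have "(bsum Z n y)\<^sup>2 - (m n y)\<^sup>2 = (bsum Z n y - m n y) * (bsum Z n y + m n y)"
          by (simp add: power2_eq_square algebra_simps)
        moreover have "\<bar>bsum Z n y + m n y\<bar> \<le> 2 * \<bar>m n y\<bar> + 2 * G" using mS[of n y] by linarith
        ultimately show ?thesis using mS[of n y] G by (simp add: abs_mult mult_mono)
      qed
      have "\<bar>(\<integral>y. (bsum Z n y)\<^sup>2 \<partial>P) - (\<integral>y. (m n y)\<^sup>2 \<partial>P)\<bar> = \<bar>\<integral>y. (bsum Z n y)\<^sup>2 - (m n y)\<^sup>2 \<partial>P\<bar>"
        using ib2 im2 by simp
      also have "\<dots> \<le> (\<integral>y. \<bar>(bsum Z n y)\<^sup>2 - (m n y)\<^sup>2\<bar> \<partial>P)" by (rule integral_abs_bound)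
      also have "\<dots> \<le> (\<integral>y. 2 * G * (2 * \<bar>m n y\<bar> + 2 * G) \<partial>P)"
        by (rule integral_mono) (use ib2 im2 im pw in auto)
      also have "\<dots> = 2 * G * (2 * (\<integral>y. \<bar>m n y\<bar> \<partial>P) + 2 * G)"
        using im by (simp add: prob_space)
      also have "\<dots> \<le> 2 * G * (2 * sqrt (real n * V) + 2 * G)"
      proof -
        have "(\<integral>y. \<bar>m n y\<bar> \<partial>P)\<^sup>2 \<le> (\<integral>y. \<bar>m n y\<bar>\<^sup>2 \<partial>P)"
        proof -
          have "0 \<le> (\<integral>y. (\<bar>m n y\<bar> - (\<integral>y. \<bar>m n y\<bar> \<partial>P))\<^sup>2 \<partial>P)" by simp
          also have "\<dots> = (\<integral>y. \<bar>m n y\<bar>\<^sup>2 \<partial>P) - (\<integral>y. \<bar>m n y\<bar> \<partial>P)\<^sup>2"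
            using im im2 by (intro variance_eq) auto
          finally show ?thesis by simp
        qed
        then have "(\<integral>y. \<bar>m n y\<bar> \<partial>P) \<le> sqrt (real n * V)" by (intro real_le_rsqrt) (simp add: m2)
        then show ?thesis using G by (intro mult_left_mono add_right_mono) auto
      qed
      finally have "\<bar>(\<integral>y. (bsum Z n y)\<^sup>2 \<partial>P) - real n * V\<bar> \<le> 4 * G * (sqrt (real n) * sqrt V + G)"
        by (simp add: m2 real_sqrt_mult algebra_simps)
      then have "\<bar>(\<integral>y. (bsum Z n y)\<^sup>2 \<partial>P) - real n * V\<bar> / real n \<le> 4 * G * (sqrt (real n) * sqrt V + G) / real n"
        by (rule divide_right_mono) simp
      moreover have "\<bar>(\<integral>y. (bsum Z n y)\<^sup>2 \<partial>P) - real n * V\<bar> / real n = \<bar>(\<integral>y. (bsum Z n y)\<^sup>2 \<partial>P) / real n - V\<bar>"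
      proof -
        have "(\<integral>y. (bsum Z n y)\<^sup>2 \<partial>P) / real n - V = ((\<integral>y. (bsum Z n y)\<^sup>2 \<partial>P) - real n * V) / real n"
          using n by (simp add: field_simps)
        then show ?thesis by (simp add: abs_divide)
      qed
      moreover have "4 * G * (sqrt (real n) * sqrt V + G) / real n = 4 * G * (sqrt V / sqrt (real n) + G / real n)"
      proof -
        have "sqrt (real n) / real n = 1 / sqrt (real n)" using n by (simp add: real_div_sqrt field_simps)
        then have "sqrt (real n) * sqrt V / real n = sqrt V / sqrt (real n)"
          by (metis (no_types, opaque_lifting) mult.commute mult.right_neutral times_divide_eq_right)
        then have "(sqrt (real n) * sqrt V + G) / real n = sqrt V / sqrt (real n) + G / real n"
          by (simp only: add_divide_distrib)
        then show ?thesis by (metis times_divide_eq_right)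
      qed
      ultimately show ?thesis by (simp only: real_norm_def)
    qed
    then show "eventually (\<lambda>n. norm ((\<integral>y. (bsum Z n y)\<^sup>2 \<partial>P) / real n - V) \<le> 4 * G * (sqrt V / sqrt (real n) + G / real n)) sequentially"
      by (intro eventually_mono[OF eventually_gt_at_top[of 0]])
  qed
  then have "(\<lambda>n. (\<integral>y. (bsum Z n y)\<^sup>2 \<partial>P) / real n) \<longlonglongrightarrow> V" by (rule LIM_zero_cancel)
  then have vV: "v = V" by (rule LIMSEQ_unique[OF var])
  have "(\<lambda>n. (\<integral>y. iexp (bsum Z n y / sqrt (real n)) \<partial>P) - (\<integral>y. iexp (m n y / sqrt (real n)) \<partial>P)) \<longlonglongrightarrow> 0"
  proof (rule Lim_null_comparison)
    show "(\<lambda>n. 2 * G / sqrt (real n)) \<longlonglongrightarrow> 0" by real_asymp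
    have "norm ((\<integral>y. iexp (bsum Z n y / sqrt (real n)) \<partial>P) - (\<integral>y. iexp (m n y / sqrt (real n)) \<partial>P)) \<le> 2 * G / sqrt (real n)" for n
    proof -
      have i1: "integrable P (\<lambda>y. iexp (bsum Z n y / sqrt (real n)))"
        by (rule bounded_integrable[where K=1]) (auto simp del: of_real_divide)
      have i2: "integrable P (\<lambda>y. iexp (m n y / sqrt (real n)))"
        by (rule bounded_integrable[where K=1]) (auto simp del: of_real_divide)
      have "norm ((\<integral>y. iexp (bsum Z n y / sqrt (real n)) \<partial>P) - (\<integral>y. iexp (m n y / sqrt (real n)) \<partial>P))
        = norm (\<integral>y. iexp (bsum Z n y / sqrt (real n)) - iexp (m n y / sqrt (real n)) \<partial>P)"
        by (subst Bochner_Integration.integral_diff[OF i1 i2]) simp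
      also have "\<dots> \<le> (\<integral>y. norm (iexp (bsum Z n y / sqrt (real n)) - iexp (m n y / sqrt (real n))) \<partial>P)"
        by (rule integral_norm_bound)
      also have "\<dots> \<le> (\<integral>y. 2 * G / sqrt (real n) \<partial>P)"
      proof (rule integral_mono)
        show "integrable P (\<lambda>y. norm (iexp (bsum Z n y / sqrt (real n)) - iexp (m n y / sqrt (real n))))"
          by (intro integrable_norm Bochner_Integration.integrable_diff i1 i2)
        fix y
        have "norm (iexp (bsum Z n y / sqrt (real n)) - iexp (m n y / sqrt (real n))) \<le> \<bar>bsum Z n y / sqrt (real n) - m n y / sqrt (real n)\<bar>"
          by (rule norm_iexp_diff_le)
        also have "\<dots> = \<bar>bsum Z n y - m n y\<bar> / sqrt (real n)" by (simp add: diff_divide_distrib[symmetric] abs_divide)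
        also have "\<dots> \<le> 2 * G / sqrt (real n)" by (intro divide_right_mono mS) auto
        finally show "norm (iexp (bsum Z n y / sqrt (real n)) - iexp (m n y / sqrt (real n))) \<le> 2 * G / sqrt (real n)" .
      qed simp
      finally show ?thesis by (simp add: prob_space)
    qed
    then show "eventually (\<lambda>n. norm ((\<integral>y. iexp (bsum Z n y / sqrt (real n)) \<partial>P) - (\<integral>y. iexp (m n y / sqrt (real n)) \<partial>P)) \<le> 2 * G / sqrt (real n)) sequentially"
      by simp
  qed
  moreover have "(\<lambda>n. \<integral>y. iexp (m n y / sqrt (real n)) \<partial>P) \<longlonglongrightarrow> complex_of_real (exp (- V / 2))"
    unfolding m_def V_def by (rule martingale_clt[OF subalg d bshift_meas_F mart])
  ultimately have "(\<lambda>n. ((\<integral>y. iexp (bsum Z n y / sqrt (real n)) \<partial>P) - (\<integral>y. iexp (m n y / sqrt (real n)) \<partial>P))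
      + (\<integral>y. iexp (m n y / sqrt (real n)) \<partial>P)) \<longlonglongrightarrow> 0 + complex_of_real (exp (- V / 2))"
    by (rule tendsto_add)
  then show ?thesis by (simp only: vV diff_add_cancel add_0_left)
qed

end

section \<open>Covariance estimates\<close>

lemma cesaro_tendsto:
  fixes x :: "nat \<Rightarrow> real"
  assumes x: "x \<longlonglongrightarrow> L"
  shows "(\<lambda>n. (\<Sum>i<n. x i) / real n) \<longlonglongrightarrow> L"
proof (rule LIMSEQ_I)
  fix e :: real assume e: "e > 0"
  from LIMSEQ_D[OF x half_gt_zero[OF e]] obtain N where N: "\<And>n. n \<ge> N \<Longrightarrow> \<bar>x n - L\<bar> < e / 2" by auto
  define A where "A = (\<Sum>i<N. \<bar>x i - L\<bar>)"
  have A: "0 \<le> A" by (simp add: A_def sum_nonneg)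
  obtain N' :: nat where N': "2 * A < real N' * e" using e reals_Archimedean3 by blast
  have "norm ((\<Sum>i<n. x i) / real n - L) < e" if n: "n \<ge> max N N' + 1" for n
  proof -
    have n0: "real n > 0" using n by simp
    have "\<bar>(\<Sum>i<n. x i - L)\<bar> \<le> (\<Sum>i<n. \<bar>x i - L\<bar>)" by (rule sum_abs)
    also have "\<dots> = A + (\<Sum>i\<in>{N..<n}. \<bar>x i - L\<bar>)"
      unfolding A_def lessThan_atLeast0 using n by (subst sum.atLeastLessThan_concat) auto
    also have "\<dots> \<le> A + (\<Sum>i\<in>{N..<n}. e / 2)"
      by (intro add_left_mono sum_mono) (use N less_imp_le in auto)
    also have "\<dots> \<le> A + real n * (e / 2)" using e by simp
    also have "\<dots> < real n * e"
    proof -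
      have "real N' * e \<le> real n * e" using n e by (intro mult_right_mono) auto
      then show ?thesis using N' by simp
    qed
    finally have "\<bar>(\<Sum>i<n. x i - L)\<bar> / real n < e" using n0 by (simp add: divide_less_eq mult.commute)
    moreover have "(\<Sum>i<n. x i) / real n - L = (\<Sum>i<n. x i - L) / real n"
      using n0 by (simp add: sum_subtractf field_simps)
    ultimately show ?thesis by (simp add: abs_divide)
  qed
  then show "\<exists>n0. \<forall>n\<ge>n0. norm ((\<Sum>i<n. x i) / real n - L) < e" by blast
qed

text \<open>For \<open>i < 2 ^ (q + 1)\<close> the weight \<open>(1 / sqrt 2) ^ (q + 1)\<close> is
  at most \<open>1 / sqrt (i + 1)\<close>. Hence each term is at most \<open>1 / sqrt 2\<close>
  times its predecessor plus one dyadic block of the given series; adding up, the total is at most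
  \<open>1 / sqrt 2\<close> times itself plus \<open>A\<close>.\<close>

lemma dyadic_average_sum_le:
  fixes a :: "nat \<Rightarrow> real"
  assumes a: "\<And>i. 0 \<le> a i" and A: "\<And>n. (\<Sum>i<n. a i / sqrt (real (Suc i))) \<le> A"
  shows "(\<Sum>q<r. (1 / sqrt 2) ^ q * (\<Sum>i<2 ^ q. a i)) \<le> A / (1 - 1 / sqrt 2)"
proof -
  define x where "x = 1 / sqrt (2::real)"
  define s where "s q = x ^ q * (\<Sum>i<2 ^ q. a i)" for q
  have x: "0 < x" "x < 1" by (auto simp: x_def)
  have s0: "0 \<le> s q" for q unfolding s_def using x a by (intro mult_nonneg_nonneg sum_nonneg) auto
  have step: "s (Suc q) \<le> x * s q + (\<Sum>i\<in>{2 ^ q..<2 ^ Suc q}. a i / sqrt (real (Suc i)))" for q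
  proof -
    have "(\<Sum>i<2 ^ Suc q. a i) = (\<Sum>i<2 ^ q. a i) + (\<Sum>i\<in>{2 ^ q..<2 ^ Suc q}. a i)"
      unfolding lessThan_atLeast0 by (subst sum.atLeastLessThan_concat) auto
    then have "s (Suc q) = x * s q + (\<Sum>i\<in>{2 ^ q..<2 ^ Suc q}. x ^ Suc q * a i)"
      by (simp add: s_def sum_distrib_left algebra_simps)
    also have "\<dots> \<le> x * s q + (\<Sum>i\<in>{2 ^ q..<2 ^ Suc q}. a i / sqrt (real (Suc i)))"
    proof (intro add_left_mono sum_mono)
      fix i :: nat assume "i \<in> {2 ^ q..<2 ^ Suc q}"
      then have "real (Suc i) \<le> 2 ^ Suc q"
        by (metis Suc_leI atLeastLessThan_iff of_nat_le_iff of_nat_numeral of_nat_power)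
      then have "sqrt (real (Suc i)) \<le> sqrt 2 ^ Suc q"
        by (metis real_sqrt_le_mono real_sqrt_power)
      then have "1 / sqrt 2 ^ Suc q \<le> 1 / sqrt (real (Suc i))" by (intro divide_left_mono) auto
      then have "x ^ Suc q \<le> 1 / sqrt (real (Suc i))" by (simp only: x_def power_one_over)
      then show "x ^ Suc q * a i \<le> a i / sqrt (real (Suc i))"
        using mult_right_mono[OF _ a[of i]] by fastforce
    qed
    finally show ?thesis .
  qed
  have claim: "(\<Sum>q<Suc r. s q) \<le> x * (\<Sum>q<Suc r. s q) - x * s r + (\<Sum>i<2 ^ r. a i / sqrt (real (Suc i)))" for r
  proof (induction r)
    case (Suc r)
    have "(\<Sum>i<2 ^ Suc r. a i / sqrt (real (Suc i))) = (\<Sum>i<2 ^ r. a i / sqrt (real (Suc i)))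
      + (\<Sum>i\<in>{2 ^ r..<2 ^ Suc r}. a i / sqrt (real (Suc i)))"
      unfolding lessThan_atLeast0 by (subst sum.atLeastLessThan_concat) auto
    moreover have "(\<Sum>q<Suc (Suc r). s q) = (\<Sum>q<Suc r. s q) + s (Suc r)" by simp
    ultimately show ?case using Suc step[of r] by (simp only: distrib_left)
  qed (simp add: s_def)
  have "(\<Sum>q<r. s q) \<le> (\<Sum>q<Suc r. s q)" using s0 by simp
  also have "(\<Sum>q<Suc r. s q) \<le> x * (\<Sum>q<Suc r. s q) + A"
  proof -
    have "0 \<le> x * s r" using x s0 by simp
    then show ?thesis using claim[of r] A[of "2 ^ r"] by linarith
  qed
  then have "(\<Sum>q<Suc r. s q) \<le> A / (1 - x)"
    using x by (simp only: pos_le_divide_eq diff_gt_0_iff_gt) (simp add: algebra_simps)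
  finally show ?thesis by (simp add: s_def x_def)
qed

context mixing_path
begin

text \<open>The prediction \<open>E\<close> of \<open>Z (y k)\<close> is bounded by
  \<open>c * \<psi> k\<close>, and its \<open>L^1\<close> norm is at most that of \<open>Z\<close>.
  The product of the two bounds controls its second moment, and Cauchy-Schwarz concludes. At the
  price of a square root of the rate, \<open>W\<close> enters through its second moment.\<close>

lemma mixf_L2:
  assumes Z: "mixf c Z" and k: "1 \<le> k" and W: "W \<in> borel_measurable \<F>" "\<And>y. \<bar>W y\<bar> \<le> K"
  shows "\<bar>\<integral>y. W y * Z (y (int k)) \<partial>P\<bar> \<le> sqrt (c * \<psi> k * (\<integral>y. \<bar>Z (y 0)\<bar> \<partial>P)) * sqrt (\<integral>y. (W y)\<^sup>2 \<partial>P)"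
proof (rule mixf_cond_exp[OF Z k])
  fix E :: "(int \<Rightarrow> real) \<Rightarrow> real"
  assume E: "E \<in> borel_measurable \<F>" "\<And>y. \<bar>E y\<bar> \<le> c * \<psi> k"
    and EZ: "\<And>W K. W \<in> borel_measurable \<F> \<Longrightarrow> (\<And>y. \<bar>W y\<bar> \<le> K) \<Longrightarrow> (\<integral>y. W y * E y \<partial>P) = (\<integral>y. W y * Z (y (int k)) \<partial>P)"
  have [measurable]: "W \<in> borel_measurable P" "E \<in> borel_measurable P" using W E by (auto intro: meas_F_P)
  note [measurable] = mixf_meas[OF Z]
  have K: "0 \<le> K" using W(2) by (metis abs_ge_zero order_trans)
  have iW2: "integrable P (\<lambda>y. (W y)\<^sup>2)"
    by (rule bounded_integrable[where K="K\<^sup>2"]) (measurable, rule norm_square_le[OF W(2)])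
  have iE2: "integrable P (\<lambda>y. (E y)\<^sup>2)"
    by (rule bounded_integrable[where K="(c * \<psi> k)\<^sup>2"]) (measurable, rule norm_square_le[OF E(2)])
  have iE: "integrable P E" by (rule bounded_integrable[where K="c * \<psi> k"]) (use E(2) in auto)
  have iZ: "integrable P (\<lambda>y. \<bar>Z (y (int k))\<bar>)" using mixf_integrable[OF Z] by simp
  have "(\<integral>y. \<bar>E y\<bar> \<partial>P) \<le> (\<integral>y. \<bar>Z (y 0)\<bar> \<partial>P)"
  proof -
    have sF: "(\<lambda>y. sgn (E y)) \<in> borel_measurable \<F>" using E(1) by measurable
    have sb: "\<bar>sgn (E y)\<bar> \<le> 1" for y by (simp add: abs_sgn_eq)
    have "(\<integral>y. \<bar>E y\<bar> \<partial>P) = (\<integral>y. sgn (E y) * Z (y (int k)) \<partial>P)"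
      using EZ[OF sF sb] by (simp add: abs_sgn mult.commute)
    also have "\<dots> \<le> (\<integral>y. \<bar>Z (y (int k))\<bar> \<partial>P)"
    proof (rule integral_mono[OF mixf_integrable_mult[OF Z meas_F_P[OF sF] sb] iZ])
      fix y show "sgn (E y) * Z (y (int k)) \<le> \<bar>Z (y (int k))\<bar>"
        by (auto simp: sgn_if)
    qed
    also have "\<dots> = (\<integral>y. \<bar>Z (y 0)\<bar> \<partial>P)"
      using integral_shift[of "\<lambda>y. \<bar>Z (y (int k))\<bar>" k] by simp
    finally show ?thesis .
  qed
  then have "c * \<psi> k * (\<integral>y. \<bar>E y\<bar> \<partial>P) \<le> c * \<psi> k * (\<integral>y. \<bar>Z (y 0)\<bar> \<partial>P)"
    using mixf_nonneg[OF Z] psi_nonneg by (intro mult_left_mono) auto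
  moreover have "(\<integral>y. (E y)\<^sup>2 \<partial>P) \<le> (\<integral>y. c * \<psi> k * \<bar>E y\<bar> \<partial>P)"
  proof (rule integral_mono[OF iE2])
    show "(E y)\<^sup>2 \<le> c * \<psi> k * \<bar>E y\<bar>" for y
      using mult_right_mono[OF E(2)[of y] abs_ge_zero[of "E y"]] by (simp add: power2_eq_square)
  qed (use iE in auto)
  ultimately have E2: "(\<integral>y. (E y)\<^sup>2 \<partial>P) \<le> c * \<psi> k * (\<integral>y. \<bar>Z (y 0)\<bar> \<partial>P)" using iE by simp
  have "\<bar>\<integral>y. W y * E y \<partial>P\<bar> \<le> sqrt (\<integral>y. (E y)\<^sup>2 \<partial>P) * sqrt (\<integral>y. (W y)\<^sup>2 \<partial>P)"
  proof -
    have iWE: "integrable P (\<lambda>y. W y * E y)"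
      by (rule bounded_integrable[where K="K * (c * \<psi> k)"])
        (auto simp: abs_mult intro!: mult_mono W E order_trans[OF abs_ge_zero W(2)])
    have q: "0 \<le> a\<^sup>2 * (\<integral>y. (W y)\<^sup>2 \<partial>P) - 2 * a * b * (\<integral>y. W y * E y \<partial>P) + b\<^sup>2 * (\<integral>y. (E y)\<^sup>2 \<partial>P)" for a b
    proof -
      have "0 \<le> (\<integral>y. (a * W y - b * E y)\<^sup>2 \<partial>P)" by simp
      also have "\<dots> = (\<integral>y. a\<^sup>2 * (W y)\<^sup>2 - 2 * a * b * (W y * E y) + b\<^sup>2 * (E y)\<^sup>2 \<partial>P)"
        by (intro Bochner_Integration.integral_cong) (auto simp: power2_eq_square algebra_simps)
      finally show ?thesis using iWE iW2 iE2 by simp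
    qed
    define \<alpha> where "\<alpha> = sqrt (\<integral>y. (E y)\<^sup>2 \<partial>P)"
    define \<beta> where "\<beta> = sqrt (\<integral>y. (W y)\<^sup>2 \<partial>P)"
    define I where "I = (\<integral>y. W y * E y \<partial>P)"
    have sq: "(\<integral>y. (E y)\<^sup>2 \<partial>P) = \<alpha>\<^sup>2" "(\<integral>y. (W y)\<^sup>2 \<partial>P) = \<beta>\<^sup>2" by (simp_all add: \<alpha>_def \<beta>_def)
    have nn: "0 \<le> \<alpha>" "0 \<le> \<beta>" by (simp_all add: \<alpha>_def \<beta>_def)
    have q': "0 \<le> a\<^sup>2 * \<beta>\<^sup>2 - 2 * a * b * I + b\<^sup>2 * \<alpha>\<^sup>2" for a b
      using q[of a b] by (simp only: sq I_def)
    have "\<bar>I\<bar> \<le> \<alpha> * \<beta>"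
    proof (cases "\<alpha> = 0 \<or> \<beta> = 0")
      case True
      have "I = 0"
      proof (rule ccontr)
        assume I: "I \<noteq> 0"
        from True show False
        proof
          assume "\<alpha> = 0"
          \<comment> \<open>Here and in the other case the free coefficient gives the quadratic form
            the value \<open>- 1\<close>.\<close>
          then show False using q'[of 1 "(\<beta>\<^sup>2 + 1) / (2 * I)"] I by (simp add: field_simps)
        next
          assume "\<beta> = 0"
          then show False using q'[of "(\<alpha>\<^sup>2 + 1) / (2 * I)" 1] I by (simp add: field_simps)
        qed
      qed
      then show ?thesis using nn by simp
    next
      case False
      then have p: "\<alpha> * \<beta> > 0" using nn by auto
      have "2 * (\<alpha> * \<beta>) * I \<le> 2 * (\<alpha> * \<beta>) * (\<alpha> * \<beta>)" "2 * (\<alpha> * \<beta>) * (- I) \<le> 2 * (\<alpha> * \<beta>) * (\<alpha> * \<beta>)"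
        using q'[of \<alpha> \<beta>] q'[of \<alpha> "- \<beta>"] by (simp_all add: power2_eq_square algebra_simps)
      then have "I \<le> \<alpha> * \<beta>" "- I \<le> \<alpha> * \<beta>" using p by (simp_all only: mult_le_cancel_left_pos)
      then show ?thesis by simp
    qed
    then show ?thesis by (simp add: \<alpha>_def \<beta>_def I_def)
  qed
  also have "\<dots> \<le> sqrt (c * \<psi> k * (\<integral>y. \<bar>Z (y 0)\<bar> \<partial>P)) * sqrt (\<integral>y. (W y)\<^sup>2 \<partial>P)"
    by (intro mult_right_mono real_sqrt_le_mono E2) auto
  finally show ?thesis by (simp add: EZ[OF W])
qed

section \<open>Second moments of block sums\<close>

definition cov :: "(real \<Rightarrow> real) \<Rightarrow> (real \<Rightarrow> real) \<Rightarrow> nat \<Rightarrow> real" where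
  "cov Z Z' k = (\<integral>y. Z (y 0) * Z' (y (int k)) \<partial>P)"

lemma mixf_coord_meas: "mixf c Z \<Longrightarrow> (\<lambda>y. Z (y i)) \<in> borel_measurable P"
  using mixf_meas by measurable

lemma mixf_integrable_coord_mult:
  assumes "mixf c Z" "mixf c' Z'"
  shows "integrable P (\<lambda>y. Z (y i) * Z' (y j))"
  by (rule mixf_integrable_mult[OF assms(2) mixf_coord_meas[OF assms(1)] mixf_bound[OF assms(1)]])

lemma integral_coord_mult:
  assumes "mixf c Z" "mixf c' Z'"
  shows "(\<integral>y. Z (y (- int j)) * Z' (y (int k - int j)) \<partial>P) = cov Z Z' k"
  unfolding cov_def
  using integral_shift[of "\<lambda>y. Z (y 0) * Z' (y (int k))" j] mixf_coord_meas[OF assms(1)] mixf_coord_meas[OF assms(2)]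
  by simp

lemma cov_abs_le:
  assumes "mixf c Z" "mixf c' Z'"
  shows "\<bar>cov Z Z' (Suc k)\<bar> \<le> c' * \<psi> (Suc k) * (\<integral>y. \<bar>Z (y 0)\<bar> \<partial>P)"
  unfolding cov_def
proof (rule mixf_mix[OF assms(2) _ mixf_bound[OF assms(1)]])
  show "(\<lambda>y. Z (y 0)) \<in> borel_measurable \<F>"
    by (rule measurable_compose[OF coord_meas_F mixf_meas[OF assms(1)]]) simp
qed simp

text \<open>The coordinate \<open>- n\<close> is older than the whole block, so \<open>Z'\<close>
  moves to the first, earlier argument of \<open>cov\<close>, and the lags run from \<open>1\<close>
  to \<open>n\<close>.\<close>

lemma integral_bsum_mult_last:
  assumes "mixf c Z" "mixf c' Z'"
  shows "(\<integral>y. bsum Z n y * Z' (y (- int n)) \<partial>P) = (\<Sum>k<n. cov Z' Z (Suc k))"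
proof -
  have "(\<integral>y. bsum Z n y * Z' (y (- int n)) \<partial>P) = (\<Sum>i<n. \<integral>y. Z (y (- int i)) * Z' (y (- int n)) \<partial>P)"
    unfolding bsum_def sum_distrib_right
    by (rule Bochner_Integration.integral_sum) (rule mixf_integrable_coord_mult[OF assms])
  also have "\<dots> = (\<Sum>i<n. cov Z' Z (Suc (n - Suc i)))"
  proof (intro sum.cong refl)
    fix i assume "i \<in> {..<n}"
    then have "- int i = int (Suc (n - Suc i)) - int n" by auto
    then show "(\<integral>y. Z (y (- int i)) * Z' (y (- int n)) \<partial>P) = cov Z' Z (Suc (n - Suc i))"
      using integral_coord_mult[OF assms(2,1), of n "Suc (n - Suc i)"] by (simp only: mult.commute)
  qed
  also have "\<dots> = (\<Sum>k<n. cov Z' Z (Suc k))" by (rule sum.nat_diff_reindex)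
  finally show ?thesis .
qed

lemma bsum_mixf_bound: "mixf c Z \<Longrightarrow> \<bar>bsum Z n y\<bar> \<le> real n * c"
  using bsum_bound mixf_bound by blast

lemma integrable_bsum_mult:
  assumes "mixf c Z" "mixf c' Z'"
  shows "integrable P (\<lambda>y. bsum Z n y * bsum Z' n y)" "integrable P (\<lambda>y. bsum Z n y * Z' (y i))"
proof -
  note [measurable] = mixf_meas[OF assms(1)] mixf_meas[OF assms(2)]
  show "integrable P (\<lambda>y. bsum Z n y * bsum Z' n y)"
    by (rule bounded_integrable[where K="(real n * c) * (real n * c')"], measurable)
      (unfold real_norm_def abs_mult, intro mult_mono bsum_mixf_bound assms abs_ge_zero mult_nonneg_nonneg mixf_nonneg[OF assms(1)], auto)
  show "integrable P (\<lambda>y. bsum Z n y * Z' (y i))"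
    by (rule mixf_integrable_mult[OF assms(2) _ bsum_mixf_bound[OF assms(1)]]) measurable
qed

text \<open>The blocks grow by one older coordinate at a time. The outcome is a sum of partial sums,
  the shape to which the Cesaro limit applies.\<close>

lemma integral_bsum_mult:
  assumes "mixf c Z" "mixf c' Z'"
  shows "(\<integral>y. bsum Z n y * bsum Z' n y \<partial>P) =
    (\<Sum>m<n. cov Z Z' 0 + (\<Sum>k<m. cov Z Z' (Suc k) + cov Z' Z (Suc k)))"
proof (induction n)
  case (Suc n)
  have "(\<integral>y. bsum Z (Suc n) y * bsum Z' (Suc n) y \<partial>P) =
    (\<integral>y. bsum Z n y * bsum Z' n y + bsum Z n y * Z' (y (- int n)) + bsum Z' n y * Z (y (- int n))
      + Z (y (- int n)) * Z' (y (- int n)) \<partial>P)"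
    by (intro Bochner_Integration.integral_cong refl) (simp add: bsum_def algebra_simps)
  also have "\<dots> = (\<integral>y. bsum Z n y * bsum Z' n y \<partial>P) + (\<Sum>k<n. cov Z' Z (Suc k)) + (\<Sum>k<n. cov Z Z' (Suc k)) + cov Z Z' 0"
    using integrable_bsum_mult[OF assms] integrable_bsum_mult[OF assms(2,1)] mixf_integrable_coord_mult[OF assms]
      integral_bsum_mult_last[OF assms] integral_bsum_mult_last[OF assms(2,1)] integral_coord_mult[OF assms, of n 0]
    by simp
  finally show ?case using Suc by (simp add: sum.distrib algebra_simps)
qed (simp add: bsum_def)

definition "\<Psi> = (\<Sum>k. \<psi> (Suc k))"

text \<open>The summand \<open>1\<close> accounts for lag zero, the factor \<open>4\<close> for the
  two orders of a pair of times and for the mixing constant \<open>2\<close> of the indicator of an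
  interval.\<close>

definition "cst = 1 + 4 * \<Psi>"

lemma Psi_nonneg: "0 \<le> \<Psi>" unfolding \<Psi>_def by (rule suminf_nonneg[OF psi_summable psi_nonneg])

lemma cst_ge: "1 \<le> cst" using Psi_nonneg by (simp add: cst_def)

lemma sum_psi_le: "(\<Sum>k<m. \<psi> (Suc k)) \<le> \<Psi>"
  unfolding \<Psi>_def by (rule sum_le_suminf[OF psi_summable]) (auto simp: psi_nonneg)

lemma coord_set_meas: "I \<in> sets borel \<Longrightarrow> {y. y i \<in> I} \<in> sets P"
  using measurable_sets[OF coord_meas, of I i] by (simp add: vimage_def)

text \<open>Since \<open>Z\<close> is centered, one factor of each covariance can be replaced by the
  indicator of \<open>I\<close>, whose \<open>L^1\<close> norm is \<open>p\<close>. The bound is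
  therefore proportional to the probability of \<open>I\<close>, which suits the tails as well as
  the increments.\<close>

lemma bsum_indicator_second_moment:
  assumes Z: "mixf c Z" and I: "I \<in> sets borel" and ZI: "\<And>x. Z x = indicator I x - p"
    and c: "c \<le> 2"
  shows "(\<integral>y. (bsum Z n y)\<^sup>2 \<partial>P) \<le> real n * p * cst"
proof -
  have int: "integrable P (\<lambda>y. indicator I (y i) :: real)" for i
    by (rule bounded_integrable[where K=1]) (use I in \<open>auto simp: indicator_def\<close>)
  have m0: "(\<integral>y. indicator I (y 0) \<partial>P) = p"
  proof -
    have "(\<integral>y. Z (y 0) \<partial>P) = (\<integral>y. indicator I (y 0) \<partial>P) - p"
      unfolding ZI using int by (simp)
    then show ?thesis using mixf_mean[OF Z] by simp
  qed
  then have p: "0 \<le> p" by (metis Bochner_Integration.integral_nonneg indicator_pos_le)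
  have Zm: "(\<integral>y. Z (y (int k)) \<partial>P) = 0" for k
    using integral_shift[of "\<lambda>y. Z (y (int k))" k] mixf_coord_meas[OF Z] mixf_mean[OF Z] by simp
  have ind: "cov Z Z k = (\<integral>y. indicator I (y 0) * Z (y (int k)) \<partial>P)" for k
  proof -
    have i: "integrable P (\<lambda>y. indicator I (y 0) * Z (y (int k)))"
      by (rule mixf_integrable_mult[OF Z, where K=1]) (use I in \<open>auto simp: indicator_def\<close>)
    have "cov Z Z k = (\<integral>y. indicator I (y 0) * Z (y (int k)) - p * Z (y (int k)) \<partial>P)"
      unfolding cov_def by (intro Bochner_Integration.integral_cong refl) (simp add: ZI algebra_simps)
    then show ?thesis using i mixf_integrable[OF Z] Zm by simp
  qed
  have c0: "cov Z Z 0 \<le> p"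
  proof -
    have "cov Z Z 0 \<le> (\<integral>y. indicator I (y 0) \<partial>P)"
      unfolding ind
    proof (rule integral_mono)
      show "integrable P (\<lambda>y. indicator I (y 0) * Z (y (int 0)))"
        by (rule mixf_integrable_mult[OF Z, where K=1]) (use I in \<open>auto simp: indicator_def\<close>)
      show "indicator I (y 0) * Z (y (int 0)) \<le> indicator I (y 0)" for y
        using p by (auto simp: ZI indicator_def)
    qed (rule int)
    then show ?thesis by (simp add: m0)
  qed
  have ck: "cov Z Z (Suc k) \<le> 2 * \<psi> (Suc k) * p" for k
  proof -
    have "(\<lambda>y. indicator I (y 0) :: real) \<in> borel_measurable \<F>"
      by (rule measurable_compose[OF coord_meas_F borel_measurable_indicator[OF I]]) simp
    moreover have "\<bar>indicator I (y 0) :: real\<bar> \<le> 1" for y :: "int \<Rightarrow> real" by (simp add: indicator_def)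
    ultimately have "\<bar>cov Z Z (Suc k)\<bar> \<le> c * \<psi> (Suc k) * (\<integral>y. \<bar>indicator I (y 0)\<bar> \<partial>P)"
      unfolding ind by (rule mixf_mix[OF Z]) simp
    then have "\<bar>cov Z Z (Suc k)\<bar> \<le> c * \<psi> (Suc k) * p" by (simp add: m0)
    also have "\<dots> \<le> 2 * \<psi> (Suc k) * p" using c p psi_nonneg by (intro mult_right_mono) auto
    finally show ?thesis by simp
  qed
  have "(\<integral>y. (bsum Z n y)\<^sup>2 \<partial>P) = (\<Sum>m<n. cov Z Z 0 + (\<Sum>k<m. cov Z Z (Suc k) + cov Z Z (Suc k)))"
    using integral_bsum_mult[OF Z Z, of n] by (simp add: power2_eq_square)
  also have "\<dots> \<le> (\<Sum>m<n. p * cst)"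
  proof (rule sum_mono)
    fix m
    have "(\<Sum>k<m. cov Z Z (Suc k) + cov Z Z (Suc k)) \<le> (\<Sum>k<m. \<psi> (Suc k) * (4 * p))"
    proof (rule sum_mono)
      show "cov Z Z (Suc k) + cov Z Z (Suc k) \<le> \<psi> (Suc k) * (4 * p)" for k using ck[of k] by (simp add: mult_ac)
    qed
    also have "\<dots> = (\<Sum>k<m. \<psi> (Suc k)) * (4 * p)" by (simp add: sum_distrib_right)
    also have "\<dots> \<le> \<Psi> * (4 * p)" using p by (intro mult_right_mono sum_psi_le) auto
    finally show "cov Z Z 0 + (\<Sum>k<m. cov Z Z (Suc k) + cov Z Z (Suc k)) \<le> p * cst"
      using c0 by (simp add: cst_def algebra_simps)
  qed
  finally show ?thesis by (simp add: mult.assoc)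
qed

lemma bsum_uminus: "bsum (\<lambda>x. - Z x) n y = - bsum Z n y" by (simp add: bsum_def sum_negf)

lemma bsum_diff: "bsum (\<lambda>x. Z x - Z' x) n y = bsum Z n y - bsum Z' n y"
  by (simp add: bsum_def sum_subtractf)

lemma bsum_ev_second_moment:
  "(\<integral>y. (bsum (ev t) n y)\<^sup>2 \<partial>P) \<le> real n * F t * cst"
  "(\<integral>y. (bsum (ev t) n y)\<^sup>2 \<partial>P) \<le> real n * (1 - F t) * cst"
proof -
  show "(\<integral>y. (bsum (ev t) n y)\<^sup>2 \<partial>P) \<le> real n * F t * cst"
    by (rule bsum_indicator_second_moment[OF mixf_ev, of "{..t}"]) (auto simp: ev_def)
  \<comment> \<open>Up to the sign, \<open>ev t\<close> is also the centered indicator of the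
    complementary half-line, of probability \<open>1 - F t\<close>.\<close>
  have "mixf 1 (\<lambda>x. - ev t x)" using mixf_scale[OF mixf_ev, of "- 1" t] by simp
  then have "(\<integral>y. (bsum (\<lambda>x. - ev t x) n y)\<^sup>2 \<partial>P) \<le> real n * (1 - F t) * cst"
    by (rule bsum_indicator_second_moment[of _ _ "{t<..}"]) (auto simp: ev_def indicator_def)
  then show "(\<integral>y. (bsum (ev t) n y)\<^sup>2 \<partial>P) \<le> real n * (1 - F t) * cst"
    by (simp add: bsum_uminus)
qed

lemma bsum_ev_diff_second_moment:
  assumes "u \<le> v"
  shows "(\<integral>y. (bsum (ev v) n y - bsum (ev u) n y)\<^sup>2 \<partial>P) \<le> real n * (F v - F u) * cst"
proof -
  have "mixf 2 (\<lambda>x. ev v x - ev u x)"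
    using mixf_add[OF mixf_ev[of v] mixf_scale[OF mixf_ev, of "- 1" u]] by simp
  then have "(\<integral>y. (bsum (\<lambda>x. ev v x - ev u x) n y)\<^sup>2 \<partial>P) \<le> real n * (F v - F u) * cst"
    by (rule bsum_indicator_second_moment[of _ _ "{u<..v}"]) (use assms in \<open>auto simp: ev_def indicator_def\<close>)
  then show ?thesis by (simp add: bsum_diff)
qed

section \<open>The limiting covariance kernel\<close>

text \<open>\<open>t\<close> belongs to time \<open>0\<close> and \<open>s\<close> to time
  \<open>k\<close>, the order of \<open>lag_cov\<close>.\<close>

definition gam :: "nat \<Rightarrow> real \<Rightarrow> real \<Rightarrow> real" where
  "gam k s t = cov (ev t) (ev s) k"

lemma ev_abs_integral: "(\<integral>y. \<bar>ev t (y 0)\<bar> \<partial>P) = 2 * (F t * (1 - F t))"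
proof -
  have int: "integrable P (\<lambda>y. indicator {..t} (y 0) :: real)"
    by (rule bounded_integrable[where K=1]) (auto simp: indicator_def)
  have m: "(\<integral>y. indicator {..t} (y 0) \<partial>P) = F t"
    unfolding ind_coord by (simp add: F_eq)
  have e: "\<bar>ev t x\<bar> = (1 - 2 * F t) * indicator {..t} x + F t" for x
    using F_bounds[of t] by (auto simp: ev_def indicator_def)
  have "(\<integral>y. \<bar>ev t (y 0)\<bar> \<partial>P) = (1 - 2 * F t) * (\<integral>y. indicator {..t} (y 0) \<partial>P) + F t"
    unfolding e using int by (subst Bochner_Integration.integral_add) auto
  then have "(\<integral>y. \<bar>ev t (y 0)\<bar> \<partial>P) = (1 - 2 * F t) * F t + F t"
    by (simp only: m)
  then show ?thesis by (simp add: algebra_simps)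
qed

lemma gam_abs_le: "\<bar>gam (Suc k) s t\<bar> \<le> \<psi> (Suc k)"
proof -
  have "(\<integral>y. \<bar>ev t (y 0)\<bar> \<partial>P) \<le> (\<integral>y. 1 \<partial>P)"
    by (rule integral_mono) (use mixf_integrable[OF mixf_ev, of t 0] ev_bound in auto)
  then have "\<psi> (Suc k) * (\<integral>y. \<bar>ev t (y 0)\<bar> \<partial>P) \<le> \<psi> (Suc k) * 1"
    using psi_nonneg by (intro mult_left_mono) (auto simp: prob_space)
  then show ?thesis using cov_abs_le[OF mixf_ev mixf_ev, of t s k] unfolding gam_def by simp
qed

lemma gam_summable: "summable (\<lambda>k. gam (Suc k) s t)"
  by (rule summable_comparison_test'[OF psi_summable, of 0]) (use gam_abs_le in auto)

text \<open>Each lag enters once in either direction of time, so this is the symmetric part of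
  \<open>C_kernel\<close>; it arises as the limit of the covariances of normalized block
  sums.\<close>

definition Kern :: "real \<Rightarrow> real \<Rightarrow> real" where
  "Kern s t = gam 0 s t + (\<Sum>k. gam (Suc k) s t + gam (Suc k) t s)"

lemma bsum_cov_tendsto: "(\<lambda>n. (\<integral>y. bsum (ev s) n y * bsum (ev t) n y \<partial>P) / real n) \<longlonglongrightarrow> Kern s t"
proof -
  have c0: "cov (ev s) (ev t) 0 = gam 0 s t" by (simp add: gam_def cov_def mult.commute)
  have "(\<lambda>m. \<Sum>k<m. gam (Suc k) t s + gam (Suc k) s t) \<longlonglongrightarrow> (\<Sum>k. gam (Suc k) s t + gam (Suc k) t s)"
    using summable_LIMSEQ[OF summable_add[OF gam_summable[of s t] gam_summable[of t s]]] by (simp add: add.commute)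
  then have "(\<lambda>m. gam 0 s t + (\<Sum>k<m. gam (Suc k) t s + gam (Suc k) s t)) \<longlonglongrightarrow> Kern s t"
    unfolding Kern_def by (intro tendsto_add tendsto_const)
  from cesaro_tendsto[OF this] show ?thesis
    unfolding integral_bsum_mult[OF mixf_ev mixf_ev] c0 by (simp add: gam_def)
qed

lemma bsum_lincomb: "bsum (\<lambda>x. \<Sum>j\<in>I. a j * ev (t j) x) n y = (\<Sum>j\<in>I. a j * bsum (ev (t j)) n y)"
  unfolding bsum_def sum_distrib_left by (rule sum.swap)

lemma bsum_lincomb_var_tendsto:
  assumes "finite I"
  shows "(\<lambda>n. (\<integral>y. (bsum (\<lambda>x. \<Sum>j\<in>I. a j * ev (t j) x) n y)\<^sup>2 \<partial>P) / real n)
    \<longlonglongrightarrow> (\<Sum>i\<in>I. \<Sum>j\<in>I. a i * a j * Kern (t i) (t j))"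
proof -
  have "(\<integral>y. (bsum (\<lambda>x. \<Sum>j\<in>I. a j * ev (t j) x) n y)\<^sup>2 \<partial>P) / real n =
     (\<Sum>i\<in>I. \<Sum>j\<in>I. a i * a j * ((\<integral>y. bsum (ev (t i)) n y * bsum (ev (t j)) n y \<partial>P) / real n))" for n
  proof -
    have "(\<integral>y. (bsum (\<lambda>x. \<Sum>j\<in>I. a j * ev (t j) x) n y)\<^sup>2 \<partial>P) =
      (\<integral>y. (\<Sum>i\<in>I. \<Sum>j\<in>I. a i * a j * (bsum (ev (t i)) n y * bsum (ev (t j)) n y)) \<partial>P)"
      unfolding bsum_lincomb power2_eq_square sum_product
      by (intro Bochner_Integration.integral_cong sum.cong refl) (simp add: mult_ac)
    also have "\<dots> = (\<Sum>i\<in>I. \<Sum>j\<in>I. a i * a j * (\<integral>y. bsum (ev (t i)) n y * bsum (ev (t j)) n y \<partial>P))"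
      using integrable_bsum_mult(1)[OF mixf_ev mixf_ev] by simp
    finally show ?thesis by (simp add: sum_divide_distrib)
  qed
  then show ?thesis by (simp only:) (intro tendsto_intros bsum_cov_tendsto)
qed

lemma Kern_sym: "Kern s t = Kern t s"
  unfolding Kern_def by (simp add: gam_def cov_def mult.commute add.commute)

text \<open>The quadratic forms are limits of second moments of normalized sums.\<close>

lemma psd_Kern: "psd_kernel Kern"
  unfolding psd_kernel_def
proof (intro conjI allI)
  show "Kern s t = Kern t s" for s t by (rule Kern_sym)
  fix n and a t :: "nat \<Rightarrow> real"
  show "0 \<le> (\<Sum>i<n. \<Sum>j<n. a i * a j * Kern (t i) (t j))"
    by (rule LIMSEQ_le_const[OF bsum_lincomb_var_tendsto[OF finite_lessThan]]) auto
qed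

lemma bsum_lincomb_clt:
  assumes "finite I"
  shows "(\<lambda>n. \<integral>y. iexp (\<Sum>j\<in>I. a j * (bsum (ev (t j)) n y / sqrt (real n))) \<partial>P)
    \<longlonglongrightarrow> complex_of_real (exp (- (\<Sum>i\<in>I. \<Sum>j\<in>I. a i * a j * Kern (t i) (t j)) / 2))"
  using bsum_clt[OF mixf_sum[OF assms] bsum_lincomb_var_tendsto[OF assms], of a t]
  unfolding bsum_lincomb by (simp only: sum_divide_distrib times_divide_eq_right)

lemma Kern_diag_le: "Kern t t \<le> F t * cst" "Kern t t \<le> (1 - F t) * cst"
proof -
  have *: "Kern t t \<le> b" if "\<And>n. (\<integral>y. (bsum (ev t) n y)\<^sup>2 \<partial>P) \<le> real n * b" for b
  proof (rule LIMSEQ_le_const2[OF bsum_cov_tendsto])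
    have "(\<integral>y. bsum (ev t) n y * bsum (ev t) n y \<partial>P) / real n \<le> b" if "n \<ge> 1" for n
      using \<open>\<And>n. (\<integral>y. (bsum (ev t) n y)\<^sup>2 \<partial>P) \<le> real n * b\<close>[of n] that
      by (simp add: power2_eq_square divide_le_eq mult.commute)
    then show "\<exists>N. \<forall>n\<ge>N. (\<integral>y. bsum (ev t) n y * bsum (ev t) n y \<partial>P) / real n \<le> b" by blast
  qed
  show "Kern t t \<le> F t * cst" "Kern t t \<le> (1 - F t) * cst"
    using bsum_ev_second_moment[of t] by (auto intro!: * simp: mult.assoc)
qed

lemma Kern_diff_le:
  assumes "u \<le> v"
  shows "Kern u u - 2 * Kern u v + Kern v v \<le> (F v - F u) * cst"
proof (rule LIMSEQ_le_const2)
  show "(\<lambda>n. (\<integral>y. bsum (ev u) n y * bsum (ev u) n y \<partial>P) / real n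
      - 2 * ((\<integral>y. bsum (ev u) n y * bsum (ev v) n y \<partial>P) / real n)
      + (\<integral>y. bsum (ev v) n y * bsum (ev v) n y \<partial>P) / real n) \<longlonglongrightarrow> Kern u u - 2 * Kern u v + Kern v v"
    by (intro tendsto_intros bsum_cov_tendsto)
  have "(\<integral>y. bsum (ev u) n y * bsum (ev u) n y \<partial>P) / real n
      - 2 * ((\<integral>y. bsum (ev u) n y * bsum (ev v) n y \<partial>P) / real n)
      + (\<integral>y. bsum (ev v) n y * bsum (ev v) n y \<partial>P) / real n \<le> (F v - F u) * cst" if n: "n \<ge> 1" for n
  proof -
    have "(\<integral>y. (bsum (ev v) n y - bsum (ev u) n y)\<^sup>2 \<partial>P) =
      (\<integral>y. bsum (ev u) n y * bsum (ev u) n y - 2 * (bsum (ev u) n y * bsum (ev v) n y) + bsum (ev v) n y * bsum (ev v) n y \<partial>P)"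
      by (intro Bochner_Integration.integral_cong refl) (simp add: power2_eq_square algebra_simps)
    also have "\<dots> = (\<integral>y. bsum (ev u) n y * bsum (ev u) n y \<partial>P) - 2 * (\<integral>y. bsum (ev u) n y * bsum (ev v) n y \<partial>P)
       + (\<integral>y. bsum (ev v) n y * bsum (ev v) n y \<partial>P)"
      using integrable_bsum_mult(1)[OF mixf_ev mixf_ev] by simp
    finally have "((\<integral>y. bsum (ev u) n y * bsum (ev u) n y \<partial>P) - 2 * (\<integral>y. bsum (ev u) n y * bsum (ev v) n y \<partial>P)
       + (\<integral>y. bsum (ev v) n y * bsum (ev v) n y \<partial>P)) / real n \<le> (F v - F u) * cst"
      using bsum_ev_diff_second_moment[OF assms, of n] n by (simp add: divide_le_eq mult_ac)
    then show ?thesis by (simp add: add_divide_distrib diff_divide_distrib)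
  qed
  then show "\<exists>N. \<forall>n\<ge>N. (\<integral>y. bsum (ev u) n y * bsum (ev u) n y \<partial>P) / real n
      - 2 * ((\<integral>y. bsum (ev u) n y * bsum (ev v) n y \<partial>P) / real n)
      + (\<integral>y. bsum (ev v) n y * bsum (ev v) n y \<partial>P) / real n \<le> (F v - F u) * cst" by blast
qed

lemma lag_cov_eq: "lag_cov P coord k s t = gam k s t"
proof -
  have i1: "integrable P (\<lambda>y. indicator {..r} (y i) :: real)" for i r
    by (rule bounded_integrable[where K=1]) (auto simp: indicator_def)
  have i2: "integrable P (\<lambda>y. indicator {..t} (y 0) * indicator {..s} (y (int k)) :: real)"
    by (rule bounded_integrable[where K=1]) (auto simp: indicator_def)
  have m: "(\<integral>y. indicator {..r} (y (int i)) \<partial>P) = F r" for i r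
    using integral_shift[of "\<lambda>y. indicator {..r} (y (int i)) :: real" i] unfolding ind_coord by (simp add: F_eq)
  have "(\<integral>y. indicator {..t} (y 0) * indicator {..s} (y (int k)) \<partial>P) = (\<integral>y. (indicator {y. y 0 \<le> t \<and> y (int k) \<le> s} y :: real) \<partial>P)"
    by (intro Bochner_Integration.integral_cong) (auto simp: indicator_def)
  then have m2: "(\<integral>y. indicator {..t} (y 0) * indicator {..s} (y (int k)) \<partial>P) = prob {y. y 0 \<le> t \<and> y (int k) \<le> s}"
    by simp
  have "gam k s t = (\<integral>y. indicator {..t} (y 0) * indicator {..s} (y (int k)) - F s * indicator {..t} (y 0)
     - F t * indicator {..s} (y (int k)) + F t * F s \<partial>P)"
    unfolding gam_def cov_def ev_def by (intro Bochner_Integration.integral_cong refl) (simp add: algebra_simps)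
  also have "\<dots> = prob {y. y 0 \<le> t \<and> y (int k) \<le> s} - F s * F t - F t * F s + F t * F s"
    using i1 i2 m[of t 0] m[of s k] by (simp add: m2 prob_space)
  finally show ?thesis by (simp add: lag_cov_def)
qed

lemma C_kernel_eq: "C_kernel P coord s t = gam 0 s t + 2 * (\<Sum>k. gam (Suc k) s t)"
proof -
  have "F (min t s) = prob {y. y 0 \<le> t \<and> y 0 \<le> s}" unfolding F_eq by (intro arg_cong[of _ _ prob]) auto
  then have "gam 0 s t = F (min t s) - F t * F s"
    unfolding lag_cov_eq[symmetric] lag_cov_def by simp
  then show ?thesis by (simp add: C_kernel_def lag_cov_eq)
qed

lemma C_kernel_sym_part: "C_kernel P coord s t + C_kernel P coord t s = 2 * Kern s t"
  unfolding C_kernel_eq Kern_def using suminf_add[OF gam_summable[of s t] gam_summable[of t s]]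
  by (simp add: gam_def cov_def mult.commute)

section \<open>Tail weights and bounds for the kernel\<close>

definition tailp :: "real \<Rightarrow> real" where "tailp x = prob {y. \<bar>y 0\<bar> > x}"

text \<open>The argument is halved because \<open>F t\<close> for negative \<open>t\<close> is the
  probability of a closed half-line, whereas \<open>tailp\<close> refers to a strict inequality. The
  root is there because the weight is to bound standard deviations.\<close>

definition wt :: "real \<Rightarrow> real" where "wt t = sqrt (tailp (\<bar>t\<bar> / 2))"

lemma wt_nonneg: "0 \<le> wt t" by (simp add: wt_def tailp_def)

lemma wt_le_one: "wt t \<le> 1" by (simp add: wt_def tailp_def)

lemma abs_coord_gt_meas: "{y. \<bar>y i\<bar> > x} \<in> sets P" for x :: real
proof -
  have "{z :: real. \<bar>z\<bar> > x} \<in> sets borel" by measurable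
  from coord_set_meas[OF this] show ?thesis by simp
qed

lemma upper_tail_le_wt:
  assumes "0 \<le> t"
  shows "1 - F t \<le> (wt t)\<^sup>2"
proof -
  have "1 - F t = prob {y. y 0 > t}"
    unfolding F_eq using prob_compl[OF half_space_meas[of 0 t]] by (simp add: Compl_eq_Diff_UNIV[symmetric] Collect_neg_eq[symmetric] not_le)
  also have "\<dots> \<le> tailp (\<bar>t\<bar> / 2)"
    unfolding tailp_def by (rule finite_measure_mono[OF _ abs_coord_gt_meas]) (use assms in auto)
  finally show ?thesis by (simp add: wt_def tailp_def)
qed

lemma lower_tail_le_wt:
  assumes "t < 0"
  shows "F t \<le> (wt t)\<^sup>2"
proof -
  have "F t \<le> tailp (\<bar>t\<bar> / 2)"
    unfolding tailp_def F_eq by (rule finite_measure_mono[OF _ abs_coord_gt_meas]) (use assms in auto)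
  then show ?thesis by (simp add: wt_def tailp_def)
qed

lemma half_line_le_wt: "F t \<le> (wt t)\<^sup>2 \<or> 1 - F t \<le> (wt t)\<^sup>2"
  using upper_tail_le_wt[of t] lower_tail_le_wt[of t] by linarith

lemma variance_le_wt: "F t * (1 - F t) \<le> (wt t)\<^sup>2"
proof -
  have "F t * (1 - F t) \<le> F t" "F t * (1 - F t) \<le> 1 - F t"
    using F_bounds[of t] by (auto simp: mult_le_cancel_left1 mult_le_cancel_right1 mult_left_le mult_left_le_one_le)
  then show ?thesis using half_line_le_wt[of t] by linarith
qed

lemma bsum_ev_le_wt: "(\<integral>y. (bsum (ev t) n y)\<^sup>2 \<partial>P) \<le> real n * cst * (wt t)\<^sup>2"
proof -
  have "real n * x * cst \<le> real n * cst * (wt t)\<^sup>2" if "x \<le> (wt t)\<^sup>2" for x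
    using mult_left_mono[OF that, of "real n * cst"] cst_ge by (simp add: mult_ac)
  then show ?thesis using bsum_ev_second_moment[of t n] half_line_le_wt[of t] order_trans by blast
qed

lemma Kern_diag_le_wt: "Kern t t \<le> cst * (wt t)\<^sup>2"
proof -
  have "x * cst \<le> cst * (wt t)\<^sup>2" if "x \<le> (wt t)\<^sup>2" for x
    using mult_left_mono[OF that, of cst] cst_ge by (simp add: mult_ac)
  then show ?thesis using Kern_diag_le[of t] half_line_le_wt[of t] order_trans by blast
qed

text \<open>For \<open>a \<le> b\<close> the covariance at lag zero is
  \<open>F a * (1 - F b)\<close>. It lies below both variances \<open>F a * (1 - F a)\<close> and
  \<open>F b * (1 - F b)\<close>, hence below their geometric mean.\<close>

lemma gam0_le: "\<bar>gam 0 s t\<bar> \<le> wt s * wt t"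
proof -
  define x where "x = gam 0 s t"
  have "F (min t s) = prob {y. y 0 \<le> t \<and> y 0 \<le> s}" unfolding F_eq by (intro arg_cong[of _ _ prob]) auto
  then have x: "x = F (min t s) - F t * F s"
    unfolding x_def lag_cov_eq[symmetric] lag_cov_def by simp
  have mono: "F a \<le> F b" if "a \<le> b" for a b
    unfolding F_eq by (rule finite_measure_mono) (use that in auto)
  have key: "0 \<le> F a * (1 - F b) \<and> F a * (1 - F b) \<le> wt a * wt b" if "a \<le> b" for a b
  proof -
    have "F a * (1 - F b) \<le> F a * (1 - F a)" "F a * (1 - F b) \<le> F b * (1 - F b)"
      using mono[OF that] F_bounds by (auto intro!: mult_left_mono mult_right_mono)
    then have l: "F a * (1 - F b) \<le> (wt a)\<^sup>2" "F a * (1 - F b) \<le> (wt b)\<^sup>2"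
      using variance_le_wt[of a] variance_le_wt[of b] by linarith+
    have nn: "0 \<le> F a * (1 - F b)" using F_bounds by simp
    have "(F a * (1 - F b)) * (F a * (1 - F b)) \<le> (wt a)\<^sup>2 * (wt b)\<^sup>2" by (intro mult_mono l nn) auto
    then have "(F a * (1 - F b))\<^sup>2 \<le> (wt a * wt b)\<^sup>2" by (simp add: power2_eq_square mult_ac)
    then have "F a * (1 - F b) \<le> wt a * wt b"
      by (rule power2_le_imp_le) (simp add: wt_nonneg)
    then show ?thesis using nn by blast
  qed
  show ?thesis
  proof (cases "s \<le> t")
    case True
    then have "x = F s * (1 - F t)" by (simp add: x min_def algebra_simps)
    then show ?thesis using key[OF True] by (simp add: x_def)
  next
    case False
    then have "x = F t * (1 - F s)" by (simp add: x min_def algebra_simps)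
    then show ?thesis using key[of t s] False by (simp add: x_def mult.commute)
  qed
qed

text \<open>With \<open>U n = \<Sum>m<n. \<Sum>k=1..m. gam k s t\<close>, the cross covariance of two adjacent blocks of length \<open>n\<close> is
  \<open>U (2 n) - 2 U n\<close>, so that \<open>U (2^r) / 2^r\<close> telescopes; its limit is the series.\<close>

lemma gam_series_le:
  obtains A where "\<And>s t. \<bar>\<Sum>k. gam (Suc k) s t\<bar> \<le> A * (wt s * wt t)" "0 \<le> A"
proof
  define a where "a i = sqrt (\<psi> (Suc i))" for i
  define A where "A = (\<Sum>k. sqrt (\<psi> (Suc k) / real (Suc k)))"
  define x where "x = 1 / sqrt (2::real)"
  have x: "0 < x" "x < 1" by (auto simp: x_def)
  have A0: "0 \<le> A" unfolding A_def by (rule suminf_nonneg[OF psi_sqrt_summable]) (simp add: psi_nonneg)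
  have aA: "(\<Sum>q<r. x ^ q * (\<Sum>i<2 ^ q. a i)) \<le> A / (1 - x)" for r
    unfolding x_def
  proof (rule dyadic_average_sum_le)
    show "0 \<le> a i" for i by (simp add: a_def psi_nonneg)
    show "(\<Sum>i<n. a i / sqrt (real (Suc i))) \<le> A" for n
      unfolding A_def a_def real_sqrt_divide[symmetric]
      by (rule sum_le_suminf[OF psi_sqrt_summable]) (auto simp: psi_nonneg)
  qed
  show "0 \<le> sqrt (2 * cst) * (A / (1 - x))"
    using A0 x cst_ge by simp
  fix s t
  define \<sigma> where "\<sigma> m = (\<Sum>k<m. gam (Suc k) s t)" for m
  define U where "U n = (\<Sum>m<n. \<sigma> m)" for n
  \<comment> \<open>The cross covariance between the block of times \<open>1 - n, ..., 0\<close> and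
    the block of times \<open>1, ..., n\<close>.\<close>
  define X where "X n = (\<integral>y. bsum (ev t) n y * (\<Sum>i<n. ev s (y (int (Suc i)))) \<partial>P)" for n
  define b where "b = sqrt (2 * cst) * (wt s * wt t)"
  have b: "0 \<le> b" using wt_nonneg cst_ge by (simp add: b_def)
  have XU: "U (2 * n) = 2 * U n + X n" for n
  proof -
    have "X n = (\<Sum>i<n. \<integral>y. bsum (ev t) n y * ev s (y (int (Suc i))) \<partial>P)"
      unfolding X_def sum_distrib_left
      by (rule Bochner_Integration.integral_sum) (rule integrable_bsum_mult[OF mixf_ev mixf_ev])
    also have "\<dots> = (\<Sum>i<n. \<Sum>j<n. gam (Suc (i + j)) s t)"
    proof (intro sum.cong refl)
      fix i
      have "(\<integral>y. bsum (ev t) n y * ev s (y (int (Suc i))) \<partial>P) = (\<Sum>j<n. \<integral>y. ev t (y (- int j)) * ev s (y (int (Suc i))) \<partial>P)"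
        unfolding bsum_def sum_distrib_right
        by (rule Bochner_Integration.integral_sum) (rule mixf_integrable_coord_mult[OF mixf_ev mixf_ev])
      also have "\<dots> = (\<Sum>j<n. gam (Suc (i + j)) s t)"
      proof (intro sum.cong refl)
        fix j
        have "int (Suc (i + j)) - int j = int (Suc i)" by simp
        then show "(\<integral>y. ev t (y (- int j)) * ev s (y (int (Suc i))) \<partial>P) = gam (Suc (i + j)) s t"
          unfolding gam_def using integral_coord_mult[OF mixf_ev mixf_ev, of t j s "Suc (i + j)"] by (simp only:)
      qed
      finally show "(\<integral>y. bsum (ev t) n y * ev s (y (int (Suc i))) \<partial>P) = (\<Sum>j<n. gam (Suc (i + j)) s t)" .
    qed
    also have "\<dots> = (\<Sum>i<n. \<sigma> (i + n) - \<sigma> i)"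
    proof (intro sum.cong refl)
      fix i
      have "\<sigma> (i + n) = \<sigma> i + (\<Sum>j<n. gam (Suc (i + j)) s t)" by (induction n) (simp_all add: \<sigma>_def)
      then show "(\<Sum>j<n. gam (Suc (i + j)) s t) = \<sigma> (i + n) - \<sigma> i" by simp
    qed
    finally have "X n = (\<Sum>i<n. \<sigma> (i + n)) - U n" by (simp add: U_def sum_subtractf)
    moreover have "U (n + m) = U n + (\<Sum>i<m. \<sigma> (i + n))" for m
      by (induction m) (simp_all add: U_def add.commute)
    then have "U (2 * n) = U n + (\<Sum>i<n. \<sigma> (i + n))" by (simp only: mult_2[of n])
    ultimately show ?thesis by linarith
  qed
  \<comment> \<open>The whole past block is one weight in \<open>mixf_L2\<close>, with standard
    deviation of order \<open>sqrt n\<close>. Each future coordinate thus contributes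
    \<open>sqrt n * sqrt (\<psi> (i + 1))\<close> and one tail weight for each of \<open>s\<close>
    and \<open>t\<close>.\<close>
  have Xb: "\<bar>X n\<bar> \<le> b * sqrt (real n) * (\<Sum>i<n. a i)" for n
  proof -
    have "X n = (\<Sum>i<n. \<integral>y. bsum (ev t) n y * ev s (y (int (Suc i))) \<partial>P)"
      unfolding X_def sum_distrib_left
      by (rule Bochner_Integration.integral_sum) (rule integrable_bsum_mult[OF mixf_ev mixf_ev])
    also have "\<bar>\<dots>\<bar> \<le> (\<Sum>i<n. \<bar>\<integral>y. bsum (ev t) n y * ev s (y (int (Suc i))) \<partial>P\<bar>)" by (rule sum_abs)
    also have "\<dots> \<le> (\<Sum>i<n. (b * sqrt (real n)) * a i)"
    proof (rule sum_mono)
      fix i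
      have "\<bar>\<integral>y. bsum (ev t) n y * ev s (y (int (Suc i))) \<partial>P\<bar>
        \<le> sqrt (1 * \<psi> (Suc i) * (\<integral>y. \<bar>ev s (y 0)\<bar> \<partial>P)) * sqrt (\<integral>y. (bsum (ev t) n y)\<^sup>2 \<partial>P)"
        by (rule mixf_L2[OF mixf_ev _ bsum_meas_F[OF ev_measurable] bsum_mixf_bound[OF mixf_ev]]) simp
      also have "\<dots> \<le> sqrt (\<psi> (Suc i) * (2 * (wt s)\<^sup>2)) * sqrt (real n * cst * (wt t)\<^sup>2)"
        using psi_nonneg variance_le_wt[of s] F_bounds[of s]
        by (intro mult_mono real_sqrt_le_mono bsum_ev_le_wt) (auto simp: ev_abs_integral intro!: mult_left_mono)
      also have "\<dots> = (b * sqrt (real n)) * a i"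
        using wt_nonneg by (simp add: a_def b_def real_sqrt_mult real_sqrt_abs abs_of_nonneg)
      finally show "\<bar>\<integral>y. bsum (ev t) n y * ev s (y (int (Suc i))) \<partial>P\<bar> \<le> (b * sqrt (real n)) * a i" .
    qed
    finally show ?thesis by (simp add: sum_distrib_left)
  qed
  have Ur: "\<bar>U (2 ^ r)\<bar> / 2 ^ r \<le> b * (\<Sum>q<r. x ^ q * (\<Sum>i<2 ^ q. a i))" for r
  proof (induction r)
    case 0
    then show ?case by (simp add: U_def \<sigma>_def)
  next
    case (Suc r)
    have "\<bar>U (2 ^ Suc r)\<bar> / 2 ^ Suc r \<le> (2 * \<bar>U (2 ^ r)\<bar> + \<bar>X (2 ^ r)\<bar>) / 2 ^ Suc r"
      by (intro divide_right_mono) (use XU[of "2 ^ r"] in auto)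
    also have "\<dots> = \<bar>U (2 ^ r)\<bar> / 2 ^ r + \<bar>X (2 ^ r)\<bar> / 2 ^ Suc r"
      by (simp add: add_divide_distrib)
    also have "\<bar>X (2 ^ r)\<bar> / 2 ^ Suc r \<le> \<bar>X (2 ^ r)\<bar> / 2 ^ r" by (intro divide_left_mono) auto
    also have "\<dots> \<le> (b * sqrt (2 ^ r) * (\<Sum>i<2 ^ r. a i)) / 2 ^ r"
      using Xb[of "2 ^ r"] by (intro divide_right_mono) auto
    also have "\<dots> = b * (x ^ r * (\<Sum>i<2 ^ r. a i))"
    proof -
      have "sqrt (2 ^ r) / 2 ^ r = x ^ r"
      proof -
        have "(2::real) ^ r = sqrt 2 ^ r * sqrt 2 ^ r" by (simp add: power_mult_distrib[symmetric])
        then show ?thesis by (simp add: x_def real_sqrt_power power_one_over)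
      qed
      then have "b * sqrt (2 ^ r) * (\<Sum>i<2 ^ r. a i) / 2 ^ r = b * ((sqrt (2 ^ r) / 2 ^ r) * (\<Sum>i<2 ^ r. a i))"
        by (simp add: field_simps)
      then show ?thesis using \<open>sqrt (2 ^ r) / 2 ^ r = x ^ r\<close> by simp
    qed
    finally show ?case using Suc by (simp add: distrib_left)
  qed
  \<comment> \<open>\<open>U n / n\<close> is a Cesaro average of the partial sums, so it tends to
    the sum of the series, in particular along the powers of two.\<close>
  have "(\<lambda>n. U n / real n) \<longlonglongrightarrow> (\<Sum>k. gam (Suc k) s t)"
    unfolding U_def by (rule cesaro_tendsto) (unfold \<sigma>_def, rule summable_LIMSEQ[OF gam_summable])
  then have "((\<lambda>n. U n / real n) \<circ> (\<lambda>r. 2 ^ r)) \<longlonglongrightarrow> (\<Sum>k. gam (Suc k) s t)"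
    by (rule LIMSEQ_subseq_LIMSEQ) (simp add: strict_mono_def)
  then have "(\<lambda>r. \<bar>U (2 ^ r)\<bar> / 2 ^ r) \<longlonglongrightarrow> \<bar>\<Sum>k. gam (Suc k) s t\<bar>"
    using tendsto_rabs by (fastforce simp: comp_def abs_divide)
  then have "\<bar>\<Sum>k. gam (Suc k) s t\<bar> \<le> b * (A / (1 - x))"
  proof (rule LIMSEQ_le_const2)
    have "\<bar>U (2 ^ r)\<bar> / 2 ^ r \<le> b * (A / (1 - x))" for r
      using Ur[of r] mult_left_mono[OF aA[of r] b] by simp
    then show "\<exists>N. \<forall>r\<ge>N. \<bar>U (2 ^ r)\<bar> / 2 ^ r \<le> b * (A / (1 - x))" by blast
  qed
  then show "\<bar>\<Sum>k. gam (Suc k) s t\<bar> \<le> sqrt (2 * cst) * (A / (1 - x)) * (wt s * wt t)"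
    by (simp add: b_def mult_ac)
qed

lemma C_kernel_le:
  obtains A where "\<And>s t. \<bar>C_kernel P coord s t\<bar> \<le> A * (wt s * wt t)"
proof (rule gam_series_le)
  fix A assume A: "\<And>s t. \<bar>\<Sum>k. gam (Suc k) s t\<bar> \<le> A * (wt s * wt t)"
  show thesis
  proof (rule that)
    show "\<bar>C_kernel P coord s t\<bar> \<le> (1 + 2 * A) * (wt s * wt t)" for s t
      unfolding C_kernel_eq using A[of s t] gam0_le[of s t] by (simp add: algebra_simps abs_le_iff)
  qed
qed

end

section \<open>Gaussian random variables\<close>

lemma (in prob_space) L1_le_L2:
  fixes X :: "'a \<Rightarrow> real"
  assumes X: "X \<in> borel_measurable M" and X2: "integrable M (\<lambda>\<omega>. (X \<omega>)\<^sup>2)" and e: "(\<integral>\<omega>. (X \<omega>)\<^sup>2 \<partial>M) \<le> e\<^sup>2" "0 \<le> e"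
  shows "integrable M (\<lambda>\<omega>. \<bar>X \<omega>\<bar>)" "(\<integral>\<omega>. \<bar>X \<omega>\<bar> \<partial>M) \<le> e"
proof -
  note [measurable] = X
  show i: "integrable M (\<lambda>\<omega>. \<bar>X \<omega>\<bar>)"
  proof (rule Bochner_Integration.integrable_bound)
    show "integrable M (\<lambda>\<omega>. 1 + (X \<omega>)\<^sup>2)" using X2 by simp
    have "\<bar>x\<bar> \<le> 1 + x\<^sup>2" for x :: real
      using zero_le_power2[of "\<bar>x\<bar> - 1"] unfolding power2_diff by (simp add: algebra_simps)
    then show "AE \<omega> in M. norm \<bar>X \<omega>\<bar> \<le> norm (1 + (X \<omega>)\<^sup>2)" by (auto simp: abs_of_nonneg)
  qed measurable
  have "0 \<le> (\<integral>\<omega>. (\<bar>X \<omega>\<bar> - (\<integral>\<omega>. \<bar>X \<omega>\<bar> \<partial>M))\<^sup>2 \<partial>M)" by simp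
  also have "\<dots> = (\<integral>\<omega>. \<bar>X \<omega>\<bar>\<^sup>2 \<partial>M) - (\<integral>\<omega>. \<bar>X \<omega>\<bar> \<partial>M)\<^sup>2"
    using i X2 by (intro variance_eq) auto
  finally have "(\<integral>\<omega>. \<bar>X \<omega>\<bar> \<partial>M)\<^sup>2 \<le> (\<integral>\<omega>. (X \<omega>)\<^sup>2 \<partial>M)" by simp
  then have "(\<integral>\<omega>. \<bar>X \<omega>\<bar> \<partial>M)\<^sup>2 \<le> e\<^sup>2" using e(1) by (rule order_trans)
  then show "(\<integral>\<omega>. \<bar>X \<omega>\<bar> \<partial>M) \<le> e" by (rule power2_le_imp_le[OF _ e(2)])
qed

text \<open>Interchanging expectation and integration turns a pointwise bound on second moments into
  a bound on the expected \<open>L^1\<close> norm. It yields both the grid error and the Cauchy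
  property of the Gaussian series.\<close>

lemma expectation_integral_abs_le:
  fixes \<phi> :: "'a \<Rightarrow> real \<Rightarrow> real"
  assumes Q: "prob_space Q" and m: "case_prod \<phi> \<in> borel_measurable (Q \<Otimes>\<^sub>M lborel)"
    and e: "integrable lborel e" "\<And>t. 0 \<le> e t"
    and i: "\<And>t. integrable Q (\<lambda>\<omega>. (\<phi> \<omega> t)\<^sup>2)" and le: "\<And>t. (\<integral>\<omega>. (\<phi> \<omega> t)\<^sup>2 \<partial>Q) \<le> (e t)\<^sup>2"
  shows "integrable Q (\<lambda>\<omega>. \<integral>t. \<bar>\<phi> \<omega> t\<bar> \<partial>lborel)"
    "(\<integral>\<omega>. (\<integral>t. \<bar>\<phi> \<omega> t\<bar> \<partial>lborel) \<partial>Q) \<le> (\<integral>t. e t \<partial>lborel)"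
proof -
  interpret Q: prob_space Q by fact
  interpret pair_sigma_finite Q lborel ..
  note [measurable] = m
  have mt: "(\<lambda>\<omega>. \<phi> \<omega> t) \<in> borel_measurable Q" for t
    using measurable_compose[OF measurable_Pair2' m, of t] by simp
  have "(\<integral>\<^sup>+\<omega>. ennreal (\<integral>t. \<bar>\<phi> \<omega> t\<bar> \<partial>lborel) \<partial>Q) \<le> (\<integral>\<^sup>+\<omega>. (\<integral>\<^sup>+t. ennreal \<bar>\<phi> \<omega> t\<bar> \<partial>lborel) \<partial>Q)"
  proof (rule nn_integral_mono)
    fix \<omega>
    \<comment> \<open>Where the path is not integrable the integral on the left is zero by
      convention, and the inequality still holds.\<close>
    show "ennreal (\<integral>t. \<bar>\<phi> \<omega> t\<bar> \<partial>lborel) \<le> (\<integral>\<^sup>+t. ennreal \<bar>\<phi> \<omega> t\<bar> \<partial>lborel)"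
      by (cases "integrable lborel (\<lambda>t. \<bar>\<phi> \<omega> t\<bar>)")
        (auto simp: nn_integral_eq_integral not_integrable_integral_eq)
  qed
  also have "\<dots> = (\<integral>\<^sup>+t. (\<integral>\<^sup>+\<omega>. ennreal \<bar>\<phi> \<omega> t\<bar> \<partial>Q) \<partial>lborel)"
    by (rule Fubini'[symmetric]) measurable
  also have "\<dots> \<le> (\<integral>\<^sup>+t. ennreal (e t) \<partial>lborel)"
  proof (rule nn_integral_mono)
    fix t
    note L = Q.L1_le_L2[OF mt i le e(2)]
    show "(\<integral>\<^sup>+\<omega>. ennreal \<bar>\<phi> \<omega> t\<bar> \<partial>Q) \<le> ennreal (e t)"
      using L by (subst nn_integral_eq_integral) (auto intro: ennreal_leI)
  qed
  also have "\<dots> = ennreal (\<integral>t. e t \<partial>lborel)"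
    by (rule nn_integral_eq_integral) (use e in auto)
  finally have fin: "(\<integral>\<^sup>+\<omega>. ennreal (\<integral>t. \<bar>\<phi> \<omega> t\<bar> \<partial>lborel) \<partial>Q) \<le> ennreal (\<integral>t. e t \<partial>lborel)" .
  have mI: "(\<lambda>\<omega>. \<integral>t. \<bar>\<phi> \<omega> t\<bar> \<partial>lborel) \<in> borel_measurable Q" by measurable
  show I: "integrable Q (\<lambda>\<omega>. \<integral>t. \<bar>\<phi> \<omega> t\<bar> \<partial>lborel)"
    by (rule integrableI_nonneg[OF mI]) (use le_less_trans[OF fin ennreal_less_top] in auto)
  have "ennreal (\<integral>\<omega>. (\<integral>t. \<bar>\<phi> \<omega> t\<bar> \<partial>lborel) \<partial>Q) \<le> ennreal (\<integral>t. e t \<partial>lborel)"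
    using fin by (subst (asm) nn_integral_eq_integral[OF I]) auto
  then show "(\<integral>\<omega>. (\<integral>t. \<bar>\<phi> \<omega> t\<bar> \<partial>lborel) \<partial>Q) \<le> (\<integral>t. e t \<partial>lborel)"
    by (subst (asm) ennreal_le_iff) (auto intro!: Bochner_Integration.integral_nonneg e)
qed

text \<open>Levy uniqueness identifies the law with that of \<open>sqrt v\<close> times a standard
  normal variable, from which density and second moment are read off; for \<open>v = 0\<close> the
  law is the point mass at zero.\<close>

lemma gaussian_of_char:
  fixes X :: "'a \<Rightarrow> real"
  assumes M: "prob_space M" and X: "X \<in> borel_measurable M" and v: "0 \<le> v"
    and ch: "\<And>t. (\<integral>\<omega>. iexp (t * X \<omega>) \<partial>M) = complex_of_real (exp (- (t\<^sup>2 * v) / 2))"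
  shows "distr M borel X = return borel 0 \<or> (\<exists>\<sigma>>0. distributed M lborel X (normal_density 0 \<sigma>))"
    and "integrable M (\<lambda>\<omega>. (X \<omega>)\<^sup>2)" and "(\<integral>\<omega>. (X \<omega>)\<^sup>2 \<partial>M) = v"
proof -
  interpret M: prob_space M by fact
  note [measurable] = X
  let ?D = "std_normal_distribution"
  interpret D: real_distribution ?D by (rule real_dist_normal_dist)
  define sd where "sd = sqrt v"
  have sd: "sd\<^sup>2 = v" "0 \<le> sd" using v by (simp_all add: sd_def)
  have [measurable]: "(\<lambda>x. sd * x) \<in> borel_measurable ?D" by measurable
  have eq: "distr M borel X = distr ?D borel (\<lambda>x. sd * x)"
  proof (rule Levy_uniqueness)
    show "real_distribution (distr M borel X)" by (rule M.real_distribution_distr[OF X])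
    show "real_distribution (distr ?D borel (\<lambda>x. sd * x))" by (rule D.real_distribution_distr) measurable
    show "char (distr M borel X) = char (distr ?D borel (\<lambda>x. sd * x))"
    proof
      fix t
      have "char (distr M borel X) t = (\<integral>\<omega>. iexp (t * X \<omega>) \<partial>M)"
        unfolding char_def by (rule integral_distr) measurable
      also have "\<dots> = char ?D (t * sd)"
        unfolding ch char_std_normal_distribution by (simp add: power_mult_distrib sd)
      also have "\<dots> = (\<integral>x. iexp (t * (sd * x)) \<partial>?D)" by (simp add: char_def mult.assoc)
      also have "\<dots> = char (distr ?D borel (\<lambda>x. sd * x)) t"
        unfolding char_def by (rule integral_distr[symmetric]) measurable
      finally show "char (distr M borel X) t = char (distr ?D borel (\<lambda>x. sd * x)) t" .
    qed
  qed
  have iD: "integrable ?D (\<lambda>x. x\<^sup>2)" "(\<integral>x. x\<^sup>2 \<partial>?D) = 1"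
    using std_normal_distribution_even_moments(1)[of 1] integrable_std_normal_distribution_moment[of 2]
    by (auto simp: fact_numeral)
  have "integrable (distr ?D borel (\<lambda>x. sd * x)) (\<lambda>x. x\<^sup>2)"
    using iD by (subst integrable_distr_eq) (auto simp: power_mult_distrib)
  then show "integrable M (\<lambda>\<omega>. (X \<omega>)\<^sup>2)"
    unfolding eq[symmetric] by (subst (asm) integrable_distr_eq) auto
  have "(\<integral>\<omega>. (X \<omega>)\<^sup>2 \<partial>M) = (\<integral>x. x\<^sup>2 \<partial>distr M borel X)"
    by (rule integral_distr[symmetric]) measurable
  also have "\<dots> = (\<integral>x. (sd * x)\<^sup>2 \<partial>?D)" unfolding eq by (rule integral_distr) measurable
  also have "\<dots> = v" by (simp add: power_mult_distrib iD sd)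
  finally show "(\<integral>\<omega>. (X \<omega>)\<^sup>2 \<partial>M) = v" .
  show "distr M borel X = return borel 0 \<or> (\<exists>\<sigma>>0. distributed M lborel X (normal_density 0 \<sigma>))"
  proof (cases "v = 0")
    case True
    then have "distr M borel X = distr ?D borel (\<lambda>x. 0)" unfolding eq by (simp add: sd_def mult_zero_left[abs_def])
    then show ?thesis by (simp add: D.distr_const)
  next
    case False
    then have p: "sd > 0" using v by (simp add: sd_def)
    have dl: "distr ?D lborel (\<lambda>x. x) = ?D" by (rule distr_id2) simp
    have "distributed ?D lborel (\<lambda>x. x) std_normal_density"
      unfolding distributed_def by (auto simp: dl)
    from D.normal_density_affine[OF this, of sd 0] p
    have "distributed ?D lborel (\<lambda>x. sd * x) (normal_density 0 sd)" by simp
    then have "distr ?D lborel (\<lambda>x. sd * x) = density lborel (normal_density 0 sd)"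
      by (simp add: distributed_def)
    moreover have "distr ?D lborel (\<lambda>x. sd * x) = distr ?D borel (\<lambda>x. sd * x)" by (rule distr_cong) auto
    moreover have "distr M lborel X = distr M borel X" by (rule distr_cong) auto
    ultimately have "distributed M lborel X (normal_density 0 sd)"
      unfolding distributed_def using eq by auto
    then show ?thesis using p by blast
  qed
qed

section \<open>Independent standard normal variables\<close>

definition gauss_seq :: "(nat \<Rightarrow> real) measure" where
  "gauss_seq = PiM UNIV (\<lambda>_. std_normal_distribution)"

lemma prob_space_gauss_seq: "prob_space gauss_seq"
  unfolding gauss_seq_def using real_dist_normal_dist by (intro prob_space_PiM) (auto simp: real_distribution_def)

lemma sets_gauss_seq: "sets gauss_seq = sets (borel :: (nat \<Rightarrow> real) measure)"
proof -
  have "sets gauss_seq = sets (PiM UNIV (\<lambda>_::nat. borel :: real measure))"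
    unfolding gauss_seq_def by (intro sets_PiM_cong) auto
  then show ?thesis by (simp add: sets_PiM_equal_borel)
qed

lemma gauss_seq_coord: "(\<lambda>\<omega>. \<omega> m) \<in> borel_measurable gauss_seq"
proof -
  have "(\<lambda>\<omega>. \<omega> m) \<in> measurable gauss_seq std_normal_distribution"
    unfolding gauss_seq_def by (rule measurable_component_singleton) simp
  then show ?thesis by (simp cong: measurable_cong_sets)
qed

lemma gauss_seq_marginal: "distr gauss_seq borel (\<lambda>\<omega>. \<omega> m) = std_normal_distribution"
proof -
  have "distr gauss_seq borel (\<lambda>\<omega>. \<omega> m) = distr gauss_seq std_normal_distribution (\<lambda>\<omega>. \<omega> m)"
    by (rule distr_cong) auto
  also have "\<dots> = std_normal_distribution"
    unfolding gauss_seq_def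
    using real_dist_normal_dist by (intro distr_PiM_component) (auto simp: real_distribution_def)
  finally show ?thesis .
qed

lemma gauss_seq_indep: "prob_space.indep_vars gauss_seq (\<lambda>_. borel) (\<lambda>m \<omega>. \<omega> m) UNIV"
proof -
  interpret prob_space gauss_seq by (rule prob_space_gauss_seq)
  have eq: "distr gauss_seq (PiM UNIV (\<lambda>_. borel)) (\<lambda>x. \<lambda>i\<in>UNIV. x i) = gauss_seq"
  proof -
    have "distr gauss_seq (PiM UNIV (\<lambda>_. borel)) (\<lambda>x. x) = gauss_seq"
      by (rule distr_id2) (simp add: sets_gauss_seq sets_PiM_equal_borel)
    then show ?thesis by (simp add: restrict_def)
  qed
  show ?thesis
    by (subst indep_vars_iff_distr_eq_PiM')
      (use gauss_seq_coord eq in \<open>auto simp: gauss_seq_marginal, simp add: gauss_seq_def\<close>)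
qed

lemma gauss_seq_char:
  "(\<integral>\<omega>. iexp (\<Sum>m<n. b m * \<omega> m) \<partial>gauss_seq) = complex_of_real (exp (- (\<Sum>m<n. (b m)\<^sup>2) / 2))"
proof -
  note [measurable] = gauss_seq_coord
  interpret prob_space gauss_seq by (rule prob_space_gauss_seq)
  have "indep_vars (\<lambda>_. borel) (\<lambda>m. (\<lambda>x. b m * x) \<circ> (\<lambda>\<omega>. \<omega> m)) UNIV"
    by (rule indep_vars_compose[OF gauss_seq_indep]) measurable
  then have ind: "indep_vars (\<lambda>_. borel) (\<lambda>m \<omega>. b m * \<omega> m) {..<n}"
    unfolding comp_def by (rule indep_vars_subset) simp
  have c1: "char (distr gauss_seq borel (\<lambda>\<omega>. b m * \<omega> m)) 1 = complex_of_real (exp (- ((b m)\<^sup>2) / 2))" for m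
  proof -
    have "char (distr gauss_seq borel (\<lambda>\<omega>. b m * \<omega> m)) 1 = (\<integral>\<omega>. iexp (b m * \<omega> m) \<partial>gauss_seq)"
      unfolding char_def by (subst integral_distr) auto
    also have "\<dots> = char (distr gauss_seq borel (\<lambda>\<omega>. \<omega> m)) (b m)"
      unfolding char_def by (rule integral_distr[symmetric]) measurable
    finally show ?thesis by (simp only: gauss_seq_marginal char_std_normal_distribution)
  qed
  have "(\<integral>\<omega>. iexp (\<Sum>m<n. b m * \<omega> m) \<partial>gauss_seq) = char (distr gauss_seq borel (\<lambda>\<omega>. \<Sum>m<n. b m * \<omega> m)) 1"
    unfolding char_def by (subst integral_distr) auto
  also have "\<dots> = (\<Prod>m<n. complex_of_real (exp (- ((b m)\<^sup>2) / 2)))"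
    unfolding char_distr_sum[OF ind] c1 ..
  also have "\<dots> = complex_of_real (exp (\<Sum>m<n. - ((b m)\<^sup>2) / 2))"
    by (simp only: exp_sum[OF finite_lessThan] of_real_prod)
  finally show ?thesis by (simp only: sum_divide_distrib[symmetric] sum_negf)
qed

text \<open>Read off from the characteristic function of the sum, so that no mixed moments have to
  be treated.\<close>

lemma gauss_seq_second_moment:
  "integrable gauss_seq (\<lambda>\<omega>. (\<Sum>m<n. b m * \<omega> m)\<^sup>2)"
  "(\<integral>\<omega>. (\<Sum>m<n. b m * \<omega> m)\<^sup>2 \<partial>gauss_seq) = (\<Sum>m<n. (b m)\<^sup>2)"
proof -
  note [measurable] = gauss_seq_coord
  have "(\<integral>\<omega>. iexp (t * (\<Sum>m<n. b m * \<omega> m)) \<partial>gauss_seq) = complex_of_real (exp (- (t\<^sup>2 * (\<Sum>m<n. (b m)\<^sup>2)) / 2))" for t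
    using gauss_seq_char[of "\<lambda>m. t * b m" n] by (simp only: power_mult_distrib sum_distrib_left mult.assoc)
  from gaussian_of_char(2,3)[OF prob_space_gauss_seq _ _ this]
  show "integrable gauss_seq (\<lambda>\<omega>. (\<Sum>m<n. b m * \<omega> m)\<^sup>2)"
    "(\<integral>\<omega>. (\<Sum>m<n. b m * \<omega> m)\<^sup>2 \<partial>gauss_seq) = (\<Sum>m<n. (b m)\<^sup>2)"
    by (auto simp: sum_nonneg)
qed

section \<open>The Gaussian limit law\<close>

locale mixing_path_tail = mixing_path +
  assumes tail: "set_integrable lborel {0..} (\<lambda>t. sqrt (prob {y. \<bar>y 0\<bar> > t}))"
begin

text \<open>As a measurability rule, \<open>coord_meas\<close> has the shape \<open>\<lambda>y. y i\<close> and matches every application.\<close>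

declare coord_meas [measurable del]

section \<open>Measurability and integrability of the weights and the kernel\<close>

lemma wt_integrable: "integrable lborel wt"
proof -
  define g where "g x = indicator {0..} x * sqrt (tailp x)" for x :: real
  have g: "integrable lborel g"
    using tail unfolding set_integrable_def g_def tailp_def by simp
  \<comment> \<open>The hypothesis concerns the half-line, so \<open>wt\<close> is assembled from
    \<open>g\<close> at \<open>t / 2\<close> and at \<open>- t / 2\<close>. The maximum, unlike the
    sum, is also right at \<open>t = 0\<close>, where both are present.\<close>
  have "wt = (\<lambda>t. max (g (0 + 1 / 2 * t)) (g (0 + (- 1 / 2) * t)))"
  proof
    fix t
    have gp: "g x = wt (2 * x)" if "0 \<le> x" for x using that by (simp add: g_def wt_def)
    have gn: "g x = 0" if "x < 0" for x using that by (simp add: g_def)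
    have even: "wt (- t) = wt t" by (simp add: wt_def)
    consider "t > 0" | "t = 0" | "t < 0" by linarith
    then show "wt t = max (g (0 + 1 / 2 * t)) (g (0 + (- 1 / 2) * t))"
    proof cases
      case 1
      then show ?thesis using gp[of "1 / 2 * t"] gn[of "(- 1 / 2) * t"] wt_nonneg[of t] by simp
    next
      case 2
      then show ?thesis using gp[of 0] by simp
    next
      case 3
      then show ?thesis using gn[of "1 / 2 * t"] gp[of "(- 1 / 2) * t"] wt_nonneg[of t] even by simp
    qed
  qed
  moreover have "integrable lborel (\<lambda>t. max (g (0 + 1 / 2 * t)) (g (0 + (- 1 / 2) * t)))"
    using lborel_integrable_real_affine[OF g, of "1/2" 0] lborel_integrable_real_affine[OF g, of "-1/2" 0]
    by (intro integrable_max) auto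
  ultimately show ?thesis by (simp only:)
qed

lemma wt_measurable [measurable]: "wt \<in> borel_measurable borel"
  using wt_integrable by auto

lemma F_mono: "a \<le> b \<Longrightarrow> F a \<le> F b"
  unfolding F_eq by (rule finite_measure_mono) auto

lemma F_measurable [measurable]: "F \<in> borel_measurable borel"
  by (rule borel_measurable_mono) (auto simp: mono_def F_mono)

lemma ev_measurable2:
  assumes [measurable]: "f \<in> borel_measurable N" "g \<in> borel_measurable N"
  shows "(\<lambda>x. ev (f x) (g x)) \<in> borel_measurable N"
proof -
  have "ev (f x) (g x) = (if g x \<le> f x then 1 else 0) - F (f x)" for x
    by (simp add: ev_def indicator_def)
  then show ?thesis by simp
qed

lemma gam_measurable [measurable]: "(\<lambda>p. gam k (fst p) (snd p)) \<in> borel_measurable (borel \<Otimes>\<^sub>M borel)"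
proof -
  have [measurable]: "(\<lambda>q. snd q i) \<in> borel_measurable ((borel \<Otimes>\<^sub>M borel) \<Otimes>\<^sub>M P)" for i
    by (rule measurable_compose[OF measurable_snd coord_meas])
  have "(\<lambda>q. ev (snd (fst q)) (snd q 0) * ev (fst (fst q)) (snd q (int k)))
      \<in> borel_measurable ((borel \<Otimes>\<^sub>M borel) \<Otimes>\<^sub>M P)"
    by (intro borel_measurable_times ev_measurable2) measurable
  then have "(\<lambda>p. \<integral>y. ev (snd p) (y 0) * ev (fst p) (y (int k)) \<partial>P) \<in> borel_measurable (borel \<Otimes>\<^sub>M borel)"
    by (intro borel_measurable_lebesgue_integral) (simp add: case_prod_beta')
  then show ?thesis by (simp add: gam_def cov_def)
qed

lemma C_kernel_measurable [measurable]:
  "(\<lambda>p. C_kernel P coord (fst p) (snd p)) \<in> borel_measurable (borel \<Otimes>\<^sub>M borel)"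
  unfolding C_kernel_eq by measurable

lemma Kern_measurable: "(\<lambda>t. Kern t q) \<in> borel_measurable borel"
proof -
  have "(\<lambda>p. C_kernel P coord (snd p) (fst p)) \<in> borel_measurable (borel \<Otimes>\<^sub>M borel)"
    using measurable_compose[OF measurable_pair_swap' C_kernel_measurable] by (simp add: case_prod_beta')
  then have "(\<lambda>p. (C_kernel P coord (fst p) (snd p) + C_kernel P coord (snd p) (fst p)) / 2) \<in> borel_measurable (borel \<Otimes>\<^sub>M borel)"
    by measurable
  then have "(\<lambda>p. Kern (fst p) (snd p)) \<in> borel_measurable (borel \<Otimes>\<^sub>M borel)"
    by (simp add: C_kernel_sym_part)
  from measurable_compose[OF measurable_Pair2'[of q borel borel] this] show ?thesis by simp
qed

lemma integrable_product:
  fixes a b :: "real \<Rightarrow> real"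
  assumes a: "integrable lborel a" and b: "integrable lborel b"
  shows "integrable (lborel \<Otimes>\<^sub>M lborel) (\<lambda>p. a (fst p) * b (snd p))"
    and "(\<integral>p. a (fst p) * b (snd p) \<partial>(lborel \<Otimes>\<^sub>M lborel)) = (\<integral>s. a s \<partial>lborel) * (\<integral>t. b t \<partial>lborel)"
proof -
  have [measurable]: "a \<in> borel_measurable borel" "b \<in> borel_measurable borel" using a b by auto
  have "integrable (lborel \<Otimes>\<^sub>M lborel) (\<lambda>(s, t). a s * b t)"
    by (rule lborel_pair.Fubini_integrable) (use a b in \<open>auto simp: abs_mult\<close>)
  then show i: "integrable (lborel \<Otimes>\<^sub>M lborel) (\<lambda>p. a (fst p) * b (snd p))" by (simp add: case_prod_beta')
  show "(\<integral>p. a (fst p) * b (snd p) \<partial>(lborel \<Otimes>\<^sub>M lborel)) = (\<integral>s. a s \<partial>lborel) * (\<integral>t. b t \<partial>lborel)"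
    using lborel_pair.integral_fst'[OF i] by simp
qed

lemma Linfty_weighted_integrable:
  assumes "f \<in> Linfty" "g \<in> Linfty" and K: "(\<lambda>p. K (fst p) (snd p)) \<in> borel_measurable (lborel \<Otimes>\<^sub>M lborel)"
    and le: "\<And>s t. \<bar>K s t\<bar> \<le> A * (wt s * wt t)"
  shows "integrable (lborel \<Otimes>\<^sub>M lborel) (\<lambda>p. f (fst p) * g (snd p) * K (fst p) (snd p))"
proof (rule Bochner_Integration.integrable_bound)
  have [measurable]: "f \<in> borel_measurable borel" "g \<in> borel_measurable borel"
    using assms(1,2) by (auto simp: Linfty_def)
  note [measurable] = K
  show "integrable (lborel \<Otimes>\<^sub>M lborel) (\<lambda>p. A * ((f (fst p) * wt (fst p)) * (g (snd p) * wt (snd p))))"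
    using integrable_product(1)[OF integrable_Linfty_mult[OF assms(1) wt_integrable] integrable_Linfty_mult[OF assms(2) wt_integrable]]
    by simp
  show "(\<lambda>p. f (fst p) * g (snd p) * K (fst p) (snd p)) \<in> borel_measurable (lborel \<Otimes>\<^sub>M lborel)" by measurable
  have "\<bar>f s * g t * K s t\<bar> \<le> \<bar>A * ((f s * wt s) * (g t * wt t))\<bar>" for s t
  proof -
    have "\<bar>f s * g t * K s t\<bar> \<le> \<bar>f s * g t\<bar> * (A * (wt s * wt t))"
      unfolding abs_mult[of "f s * g t"] by (intro mult_left_mono le) auto
    also have "\<dots> \<le> \<bar>f s * g t\<bar> * \<bar>A * (wt s * wt t)\<bar>" by (intro mult_left_mono) auto
    finally show ?thesis by (simp add: abs_mult mult_ac)
  qed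
  then show "AE p in lborel \<Otimes>\<^sub>M lborel. norm (f (fst p) * g (snd p) * K (fst p) (snd p))
    \<le> norm (A * ((f (fst p) * wt (fst p)) * (g (snd p) * wt (snd p))))" by simp
qed

lemma Phi_integrable:
  assumes "f \<in> Linfty" "g \<in> Linfty"
  shows "integrable (lborel \<Otimes>\<^sub>M lborel) (Phi_integrand P coord f g)"
proof (rule C_kernel_le)
  fix A assume A: "\<And>s t. \<bar>C_kernel P coord s t\<bar> \<le> A * (wt s * wt t)"
  have "(\<lambda>p. C_kernel P coord (fst p) (snd p)) \<in> borel_measurable (lborel \<Otimes>\<^sub>M lborel)" by measurable
  from Linfty_weighted_integrable[OF assms this A] show ?thesis
    by (simp add: Phi_integrand_def case_prod_beta')
qed

section \<open>Cholesky columns of the limiting kernel\<close>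

definition piv :: "nat \<Rightarrow> real" where "piv = from_nat_into \<rat>"

definition chol :: "nat \<Rightarrow> real \<Rightarrow> real" where "chol = cholesky Kern piv"

lemma Kern_dense:
  assumes "e > 0"
  shows "\<exists>m. Kern t t - 2 * Kern t (piv m) + Kern (piv m) (piv m) < e"
proof -
  interpret D: real_distribution "distr P borel (coord 0)" by (rule real_distribution_distr[OF coord_meas])
  have "((\<lambda>v. (F v - F t) * cst) \<longlongrightarrow> (F t - F t) * cst) (at_right t)"
    using D.cdf_is_right_cont[of t] unfolding distr_fun_def continuous_within by (intro tendsto_intros)
  then have "eventually (\<lambda>v. (F v - F t) * cst < e) (at_right t)"
    using assms by (intro order_tendstoD(2)[where a=e]) auto
  then obtain b where b: "b > t" "\<And>v. v > t \<Longrightarrow> v < b \<Longrightarrow> (F v - F t) * cst < e"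
    by (auto simp: eventually_at_right_field)
  obtain q where q: "q \<in> \<rat>" "t < q" "q < b" using Rats_dense_in_real[OF b(1)] by blast
  have "range (from_nat_into \<rat>) = (\<rat> :: real set)"
    by (intro range_from_nat_into) (auto simp: countable_rat)
  then obtain m where "q = piv m" unfolding piv_def using q(1) by (metis imageE)
  then show ?thesis using b(2)[OF q(2,3)] Kern_diff_le[of t q] q by (intro exI[of _ m]) auto
qed

lemma chol_sums: "(\<lambda>m. chol m s * chol m t) sums Kern s t"
  unfolding chol_def by (rule cholesky_sums[OF psd_Kern Kern_dense])

lemma chol_sum_le: "(\<Sum>m<M. (chol m t)\<^sup>2) \<le> Kern t t"
  "(\<Sum>m<M. (chol m s - chol m t)\<^sup>2) \<le> Kern s s - 2 * Kern s t + Kern t t"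
  unfolding chol_def by (rule cholesky_sum_le[OF psd_Kern])+

lemma chol_measurable [measurable]: "chol m \<in> borel_measurable borel"
proof -
  have [measurable]: "(\<lambda>t. residual Kern piv m t q) \<in> borel_measurable borel" for q
    by (induction m arbitrary: q) (auto intro: Kern_measurable)
  show ?thesis unfolding chol_def cholesky_def[abs_def] by measurable
qed

text \<open>An integrable majorant of the standard deviations at \<open>t\<close> of the normalized
  process and of the Gaussian partial sums, uniform in the index, and of the modulus of every
  Cholesky column.\<close>

definition sqk :: "real \<Rightarrow> real" where "sqk t = sqrt cst * wt t"

lemma sqk: "0 \<le> sqk t" "Kern t t \<le> (sqk t)\<^sup>2" "integrable lborel sqk"
  using cst_ge wt_nonneg Kern_diag_le_wt[of t] wt_integrable
  by (auto simp: sqk_def[abs_def] power_mult_distrib)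

lemma chol_le: "\<bar>chol m t\<bar> \<le> sqk t"
proof -
  have "(chol m t)\<^sup>2 \<le> (\<Sum>j<Suc m. (chol j t)\<^sup>2)" by (rule member_le_sum) auto
  then have "\<bar>chol m t\<bar>\<^sup>2 \<le> (sqk t)\<^sup>2" using chol_sum_le(1)[where M="Suc m" and t=t] sqk(2)[of t] by simp
  then show ?thesis by (rule power2_le_imp_le[OF _ sqk(1)])
qed

lemma chol_integrable: "integrable lborel (chol m)"
  by (rule Bochner_Integration.integrable_bound[OF sqk(3)]) (use chol_le sqk(1) in auto)

section \<open>The Gaussian series in \<open>L^1\<close> and its limit\<close>

definition gser :: "nat \<Rightarrow> (nat \<Rightarrow> real) \<Rightarrow> l1" where
  "gser n \<omega> = (\<Sum>m<n. \<omega> m *\<^sub>R l1_class (chol m))"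

lemma gser_eq: "gser n \<omega> = l1_class (\<lambda>t. \<Sum>m<n. chol m t * \<omega> m)"
  unfolding gser_def using chol_integrable by (simp add: l1_class_scaleR l1_class_sum mult.commute)

text \<open>The finite combination is continuous on the product of lines, whose Borel sets are the
  measurable sets of \<open>gauss_seq\<close>.\<close>

lemma gser_measurable [measurable]: "gser n \<in> borel_measurable gauss_seq"
proof -
  have c: "continuous_on UNIV (\<lambda>\<omega> :: nat \<Rightarrow> real. \<omega> m)" for m
    by (rule continuous_on_product_then_coordinatewise[OF continuous_on_id])
  have "continuous_on UNIV (gser n)" unfolding gser_def by (intro continuous_intros c)
  then have "gser n \<in> borel_measurable borel" by (rule borel_measurable_continuous_onI)
  then show ?thesis by (simp cong: measurable_cong_sets add: sets_gauss_seq)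
qed

text \<open>The integrated standard deviation of what the first \<open>M\<close> columns leave out
  of the limiting process.\<close>

definition eta :: "nat \<Rightarrow> real" where
  "eta M = (\<integral>t. sqrt (Kern t t - (\<Sum>m<M. (chol m t)\<^sup>2)) \<partial>lborel)"

lemma Kern_diag_measurable [measurable]: "(\<lambda>t. Kern t t) \<in> borel_measurable borel"
proof -
  have "Kern t t = (\<Sum>m. chol m t * chol m t)" for t using chol_sums sums_unique by blast
  then show ?thesis by simp
qed

lemma residual_sqrt_bounds:
  "0 \<le> sqrt (Kern t t - (\<Sum>m<M. (chol m t)\<^sup>2))" "sqrt (Kern t t - (\<Sum>m<M. (chol m t)\<^sup>2)) \<le> sqk t"
proof -
  show "0 \<le> sqrt (Kern t t - (\<Sum>m<M. (chol m t)\<^sup>2))" using chol_sum_le(1) by simp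
  have "Kern t t - (\<Sum>m<M. (chol m t)\<^sup>2) \<le> Kern t t" by (simp add: sum_nonneg)
  then show "sqrt (Kern t t - (\<Sum>m<M. (chol m t)\<^sup>2)) \<le> sqk t"
    using sqk(1,2)[of t] by (intro real_le_lsqrt) auto
qed

lemma eta_integrable: "integrable lborel (\<lambda>t. sqrt (Kern t t - (\<Sum>m<M. (chol m t)\<^sup>2)))"
proof (rule Bochner_Integration.integrable_bound[OF sqk(3)])
  show "AE t in lborel. norm (sqrt (Kern t t - (\<Sum>m<M. (chol m t)\<^sup>2))) \<le> norm (sqk t)"
    using residual_sqrt_bounds sqk(1) by (intro AE_I2) (simp only: real_norm_def abs_of_nonneg)
qed measurable

lemma eta_tendsto: "eta \<longlonglongrightarrow> 0"
proof -
  have "(\<lambda>M. \<integral>t. sqrt (Kern t t - (\<Sum>m<M. (chol m t)\<^sup>2)) \<partial>lborel) \<longlonglongrightarrow> (\<integral>(t::real). (0::real) \<partial>lborel)"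
  proof (rule integral_dominated_convergence[OF _ _ sqk(3)])
    show "AE t in lborel. (\<lambda>M. sqrt (Kern t t - (\<Sum>m<M. (chol m t)\<^sup>2))) \<longlonglongrightarrow> 0"
    proof (rule AE_I2)
      fix t
      have "(\<lambda>M. \<Sum>m<M. (chol m t)\<^sup>2) \<longlonglongrightarrow> Kern t t"
        using chol_sums[of t t] by (simp add: sums_def power2_eq_square)
      then have "(\<lambda>M. sqrt (Kern t t - (\<Sum>m<M. (chol m t)\<^sup>2))) \<longlonglongrightarrow> sqrt (Kern t t - Kern t t)"
        by (intro tendsto_intros)
      then show "(\<lambda>M. sqrt (Kern t t - (\<Sum>m<M. (chol m t)\<^sup>2))) \<longlonglongrightarrow> 0" by simp
    qed
    show "AE t in lborel. norm (sqrt (Kern t t - (\<Sum>m<M. (chol m t)\<^sup>2))) \<le> sqk t" for M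
      using residual_sqrt_bounds by (intro AE_I2) (simp only: real_norm_def abs_of_nonneg)
  qed measurable
  then show ?thesis by (simp add: eta_def[abs_def])
qed

lemma gser_diff_expectation:
  assumes "M \<le> N"
  shows "integrable gauss_seq (\<lambda>\<omega>. norm (gser N \<omega> - gser M \<omega>))"
    "(\<integral>\<omega>. norm (gser N \<omega> - gser M \<omega>) \<partial>gauss_seq) \<le> eta M"
proof -
  \<comment> \<open>Setting the first \<open>M\<close> columns to zero writes the difference again
    as a sum over an initial segment, for which the moment formula is at hand.\<close>
  define b where "b m t = (if M \<le> m then chol m t else 0)" for m t
  have [measurable]: "b m \<in> borel_measurable borel" for m unfolding b_def[abs_def] by measurable
  have split: "(\<Sum>m<N. h m) = (\<Sum>m<M. h m) + (\<Sum>m\<in>{M..<N}. h m)" for h :: "nat \<Rightarrow> real"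
    unfolding lessThan_atLeast0 using assms by (simp add: sum.atLeastLessThan_concat)
  have eq: "(\<Sum>m<N. chol m t * \<omega> m) - (\<Sum>m<M. chol m t * \<omega> m) = (\<Sum>m<N. b m t * \<omega> m)" for t and \<omega> :: "nat \<Rightarrow> real"
    unfolding split[of "\<lambda>m. chol m t * \<omega> m"] split[of "\<lambda>m. b m t * \<omega> m"] by (simp add: b_def)
  have nrm: "norm (gser N \<omega> - gser M \<omega>) = (\<integral>t. \<bar>\<Sum>m<N. b m t * \<omega> m\<bar> \<partial>lborel)" for \<omega>
    unfolding gser_eq using chol_integrable by (subst norm_l1_class_diff) (auto simp: eq)
  have sq: "(\<Sum>m<N. (b m t)\<^sup>2) \<le> Kern t t - (\<Sum>m<M. (chol m t)\<^sup>2)" for t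
    using chol_sum_le(1)[where t=t and M=N] unfolding split[of "\<lambda>m. (chol m t)\<^sup>2"] split[of "\<lambda>m. (b m t)\<^sup>2"]
    by (simp add: b_def)
  have meas: "(\<lambda>(\<omega>, t). \<Sum>m<N. b m t * \<omega> m) \<in> borel_measurable (gauss_seq \<Otimes>\<^sub>M lborel)"
  proof -
    have [measurable]: "(\<lambda>q. fst q m) \<in> borel_measurable (gauss_seq \<Otimes>\<^sub>M lborel)" for m
      by (rule measurable_compose[OF measurable_fst gauss_seq_coord])
    have "(\<lambda>q. \<Sum>m<N. b m (snd q) * fst q m) \<in> borel_measurable (gauss_seq \<Otimes>\<^sub>M (lborel :: real measure))" by measurable
    then show ?thesis by (simp add: case_prod_beta')
  qed
  have le: "(\<integral>\<omega>. (\<Sum>m<N. b m t * \<omega> m)\<^sup>2 \<partial>gauss_seq) \<le> (sqrt (Kern t t - (\<Sum>m<M. (chol m t)\<^sup>2)))\<^sup>2" for t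
    unfolding gauss_seq_second_moment using sq[of t] chol_sum_le(1) by simp
  note * = expectation_integral_abs_le[OF prob_space_gauss_seq meas eta_integrable residual_sqrt_bounds(1) gauss_seq_second_moment(1) le]
  show "integrable gauss_seq (\<lambda>\<omega>. norm (gser N \<omega> - gser M \<omega>))" unfolding nrm by (rule *(1))
  show "(\<integral>\<omega>. norm (gser N \<omega> - gser M \<omega>) \<partial>gauss_seq) \<le> eta M" unfolding nrm eta_def by (rule *(2))
qed

text \<open>\<open>eta\<close> tends to zero without a rate, so a subsequence with errors below
  \<open>(1/2) ^ k\<close> is extracted. Its increments are almost surely summable in norm, and
  completeness supplies the limit.\<close>

lemma gser_subseq_AE_convergent:
  obtains r :: "nat \<Rightarrow> nat" and G :: "(nat \<Rightarrow> real) \<Rightarrow> l1" where "strict_mono r"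
    "G \<in> borel_measurable gauss_seq" "AE \<omega> in gauss_seq. (\<lambda>k. gser (r k) \<omega>) \<longlonglongrightarrow> G \<omega>"
proof -
  have small: "\<exists>N>x. eta N < (1/2) ^ k" for x k
  proof -
    have "eventually (\<lambda>N. eta N < (1/2) ^ k \<and> N > x) sequentially"
      by (intro eventually_conj order_tendstoD(2)[OF eta_tendsto] eventually_gt_at_top) simp
    then show ?thesis using eventually_happens trivial_limit_sequentially by blast
  qed
  have "\<exists>r. \<forall>k. eta (r k) < (1/2) ^ k \<and> r k < r (Suc k)"
  proof (rule dependent_nat_choice)
    show "\<exists>x. eta x < (1/2) ^ 0" using small[of 0 0] by blast
    show "\<exists>y. eta y < (1/2) ^ Suc n \<and> x < y" for x n using small[of x "Suc n"] by blast
  qed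
  then obtain r where r: "\<And>k. eta (r k) < (1/2) ^ k" "\<And>k. r k < r (Suc k)" by blast
  have mono: "strict_mono r" using r(2) by (simp add: strict_mono_Suc_iff)
  define D where "D k = (\<lambda>\<omega>. norm (gser (r (Suc k)) \<omega> - gser (r k) \<omega>))" for k
  have Di: "integrable gauss_seq (D k)" "(\<integral>\<omega>. D k \<omega> \<partial>gauss_seq) \<le> (1/2) ^ k" for k
    unfolding D_def using gser_diff_expectation[of "r k" "r (Suc k)"] r(1)[of k] less_imp_le[OF r(2)[of k]] by auto
  have [measurable]: "D k \<in> borel_measurable gauss_seq" for k using Di(1) by auto
  define good where "good \<omega> \<longleftrightarrow> (\<Sum>k. ennreal (D k \<omega>)) \<noteq> \<infinity>" for \<omega>
  have good: "AE \<omega> in gauss_seq. good \<omega>"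
  proof -
    have "(\<integral>\<^sup>+\<omega>. (\<Sum>k. ennreal (D k \<omega>)) \<partial>gauss_seq) = (\<Sum>k. \<integral>\<^sup>+\<omega>. ennreal (D k \<omega>) \<partial>gauss_seq)"
      by (rule nn_integral_suminf) measurable
    also have "\<dots> \<le> (\<Sum>k. ennreal ((1/2) ^ k))"
    proof (rule suminf_le)
      show "(\<integral>\<^sup>+\<omega>. ennreal (D k \<omega>) \<partial>gauss_seq) \<le> ennreal ((1/2) ^ k)" for k
        using Di[of k] by (subst nn_integral_eq_integral) (auto simp: D_def intro: ennreal_leI)
    qed auto
    also have "\<dots> < \<infinity>"
    proof -
      have "(\<Sum>k. ennreal ((1/2) ^ k)) \<noteq> \<top>" by (rule ennreal_suminf_neq_top) (auto intro: summable_geometric)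
      then show ?thesis by (metis infinity_ennreal_def less_top)
    qed
    finally show ?thesis unfolding good_def by (intro nn_integral_PInf_AE) auto
  qed
  have conv: "\<exists>x. (\<lambda>k. gser (r k) \<omega>) \<longlonglongrightarrow> x" if "good \<omega>" for \<omega>
  proof -
    have "summable (\<lambda>k. D k \<omega>)"
      using that unfolding good_def by (intro summable_suminf_not_top) (auto simp: D_def)
    then have "summable (\<lambda>k. gser (r (Suc k)) \<omega> - gser (r k) \<omega>)"
      unfolding D_def by (rule l1_summable_norm_cancel)
    then have "(\<lambda>n. \<Sum>k<n. gser (r (Suc k)) \<omega> - gser (r k) \<omega>) \<longlonglongrightarrow> (\<Sum>k. gser (r (Suc k)) \<omega> - gser (r k) \<omega>)"
      by (rule summable_LIMSEQ)
    then have "(\<lambda>n. gser (r n) \<omega> - gser (r 0) \<omega>) \<longlonglongrightarrow> (\<Sum>k. gser (r (Suc k)) \<omega> - gser (r k) \<omega>)"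
      by (simp only: sum_lessThan_telescope[of "\<lambda>k. gser (r k) \<omega>"])
    then have "(\<lambda>n. (gser (r n) \<omega> - gser (r 0) \<omega>) + gser (r 0) \<omega>) \<longlonglongrightarrow> (\<Sum>k. gser (r (Suc k)) \<omega> - gser (r k) \<omega>) + gser (r 0) \<omega>"
      by (intro tendsto_intros)
    then show ?thesis by (auto simp only: diff_add_cancel)
  qed
  \<comment> \<open>The value \<open>0\<close> off the event \<open>good\<close> makes
    \<open>G\<close> a limit of measurable functions at every point.\<close>
  define G where "G \<omega> = (if good \<omega> then lim (\<lambda>k. gser (r k) \<omega>) else 0)" for \<omega>
  have GL: "(\<lambda>k. gser (r k) \<omega>) \<longlonglongrightarrow> G \<omega>" if "good \<omega>" for \<omega>
    using conv[OF that] that unfolding G_def by (auto simp: limI)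
  have gset: "{\<omega> \<in> space gauss_seq. good \<omega>} \<in> sets gauss_seq"
    unfolding good_def by measurable
  have "G \<in> borel_measurable gauss_seq"
  proof (rule borel_measurable_LIMSEQ_metric)
    show "(\<lambda>\<omega>. if good \<omega> then gser (r k) \<omega> else 0) \<in> borel_measurable gauss_seq" for k
      by (rule measurable_If[OF gser_measurable _ gset]) simp
    fix \<omega>
    show "(\<lambda>k. if good \<omega> then gser (r k) \<omega> else 0) \<longlonglongrightarrow> G \<omega>"
      using GL[of \<omega>] by (cases "good \<omega>") (auto simp: G_def)
  qed
  moreover have "AE \<omega> in gauss_seq. (\<lambda>k. gser (r k) \<omega>) \<longlonglongrightarrow> G \<omega>"
    using good by eventually_elim (rule GL)
  ultimately show thesis by (rule that[OF mono])
qed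

text \<open>The variances \<open>v\<close> of \<open>\<phi> (gser n)\<close> are bounded because
  \<open>v = \<phi> (\<Sum>m<n. \<phi> (chol m) *\<^sub>R chol m) \<le> C * sqrt v\<close>.\<close>

lemma functional_chol_summable:
  assumes \<phi>: "bounded_linear (\<phi> :: l1 \<Rightarrow> real)"
  shows "summable (\<lambda>m. (\<phi> (l1_class (chol m)))\<^sup>2)"
proof -
  interpret bounded_linear \<phi> by fact
  obtain B where B: "\<And>x. norm (\<phi> x) \<le> norm x * B" "0 \<le> B" using nonneg_bounded by blast
  define a where "a m = \<phi> (l1_class (chol m))" for m
  define I where "I = (\<integral>t. sqk t \<partial>lborel)"
  have I: "0 \<le> I" unfolding I_def by (simp add: sqk(1))
  have bound: "(\<Sum>m<n. (a m)\<^sup>2) \<le> (B * I)\<^sup>2" for n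
  proof -
    define v where "v = (\<Sum>m<n. (a m)\<^sup>2)"
    have v: "0 \<le> v" by (simp add: v_def sum_nonneg)
    \<comment> \<open>The sequence \<open>a\<close> itself is inserted for the random coefficients,
      so that \<open>\<phi>\<close> returns the sum of its squares.\<close>
    have "v = \<phi> (gser n a)"
      unfolding gser_def by (simp add: sum scale a_def[symmetric] v_def power2_eq_square)
    also have "\<dots> \<le> norm (gser n a) * B" using B(1)[of "gser n a"] by simp
    also have "norm (gser n a) = (\<integral>t. \<bar>\<Sum>m<n. chol m t * a m\<bar> \<partial>lborel)"
      unfolding gser_eq using chol_integrable by (intro norm_l1_class) auto
    also have "\<dots> \<le> (\<integral>t. sqrt v * sqk t \<partial>lborel)"
    proof (rule integral_mono)
      show "integrable lborel (\<lambda>t. \<bar>\<Sum>m<n. chol m t * a m\<bar>)" using chol_integrable by auto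
      show "integrable lborel (\<lambda>t. sqrt v * sqk t)" using sqk(3) by simp
      fix t
      have "(\<Sum>m<n. chol m t * a m)\<^sup>2 \<le> (\<Sum>m<n. (chol m t)\<^sup>2) * (\<Sum>m<n. (a m)\<^sup>2)"
        by (rule Cauchy_Schwarz_ineq_sum)
      also have "\<dots> \<le> (sqk t)\<^sup>2 * v"
        unfolding v_def using order_trans[OF chol_sum_le(1) sqk(2)] by (intro mult_right_mono) (auto simp: sum_nonneg)
      also have "\<dots> = (sqrt v * sqk t)\<^sup>2" using v by (simp add: power_mult_distrib)
      finally have "\<bar>\<Sum>m<n. chol m t * a m\<bar>\<^sup>2 \<le> (sqrt v * sqk t)\<^sup>2" by simp
      then show "\<bar>\<Sum>m<n. chol m t * a m\<bar> \<le> sqrt v * sqk t"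
        by (rule power2_le_imp_le) (use v sqk(1) in auto)
    qed
    also have "\<dots> = sqrt v * I" by (simp add: I_def)
    finally have "v \<le> sqrt v * (B * I)" using B(2) by (simp add: mult_right_mono mult_ac)
    then have "sqrt v * sqrt v \<le> sqrt v * (B * I)" using v by simp
    then have "sqrt v \<le> B * I" 
    proof (cases "v = 0")
      case False
      then have "0 < sqrt v" using v by simp
      then show ?thesis using \<open>sqrt v * sqrt v \<le> sqrt v * (B * I)\<close> by (rule mult_left_le_imp_le[rotated])
    qed (use I B(2) in simp)
    then have "(sqrt v)\<^sup>2 \<le> (B * I)\<^sup>2" using v by (intro power_mono) auto
    then show ?thesis using v by (simp add: v_def)
  qed
  have "summable (\<lambda>m. (a m)\<^sup>2)"
    by (rule bounded_imp_summable[of _ "(B * I)\<^sup>2"]) (use bound[of "Suc _"] in \<open>auto simp: lessThan_Suc_atMost\<close>)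
  then show ?thesis by (simp add: a_def)
qed

text \<open>\<open>\<mu>\<close> is the law of the almost sure limit. The subsequence
  \<open>r\<close> belongs to the conclusion because convergence of the series is established along
  it, and the empirical process is later compared with the same partial sums.\<close>

theorem gaussian_limit:
  obtains r :: "nat \<Rightarrow> nat" and \<mu> :: "l1 measure" where "strict_mono r" "centered_gaussian_law \<mu>"
    "\<And>\<phi> :: l1 \<Rightarrow> real. bounded_linear \<phi> \<Longrightarrow> integrable \<mu> (\<lambda>x. (\<phi> x)\<^sup>2)"
    "\<And>\<phi> :: l1 \<Rightarrow> real. bounded_linear \<phi> \<Longrightarrow> (\<integral>x. (\<phi> x)\<^sup>2 \<partial>\<mu>) = (\<Sum>m. (\<phi> (l1_class (chol m)))\<^sup>2)"
    "\<And>h K. continuous_on UNIV h \<Longrightarrow> (\<And>x. \<bar>h x\<bar> \<le> K) \<Longrightarrow>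
      (\<lambda>k. \<integral>\<omega>. h (gser (r k) \<omega>) \<partial>gauss_seq) \<longlonglongrightarrow> (\<integral>x. (h x :: real) \<partial>\<mu>)"
proof (rule gser_subseq_AE_convergent)
  fix r :: "nat \<Rightarrow> nat" and G :: "(nat \<Rightarrow> real) \<Rightarrow> l1"
  assume r: "strict_mono r" and G [measurable]: "G \<in> borel_measurable gauss_seq"
    and lim: "AE \<omega> in gauss_seq. (\<lambda>k. gser (r k) \<omega>) \<longlonglongrightarrow> G \<omega>"
  interpret N: prob_space gauss_seq by (rule prob_space_gauss_seq)
  define \<mu> where "\<mu> = distr gauss_seq borel G"
  have mu: "prob_space \<mu>" "sets \<mu> = sets borel"
    unfolding \<mu>_def by (rule N.prob_space_distr[OF G]) simp
  have gauss: "(distr \<mu> borel \<phi> = return borel 0 \<or> (\<exists>\<sigma>>0. distributed \<mu> lborel \<phi> (normal_density 0 \<sigma>)))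
     \<and> integrable \<mu> (\<lambda>x. (\<phi> x)\<^sup>2) \<and> (\<integral>x. (\<phi> x)\<^sup>2 \<partial>\<mu>) = (\<Sum>m. (\<phi> (l1_class (chol m)))\<^sup>2)"
    if \<phi>: "bounded_linear \<phi>" for \<phi> :: "l1 \<Rightarrow> real"
  proof -
    interpret \<phi>: bounded_linear \<phi> by fact
    have cont: "continuous_on UNIV \<phi>" by (rule linear_continuous_on[OF \<phi>])
    have \<phi>b: "\<phi> \<in> borel_measurable borel" by (rule borel_measurable_continuous_onI[OF cont])
    then have \<phi>m: "\<phi> \<in> borel_measurable \<mu>" by (simp add: \<mu>_def)
    have [measurable]: "(\<lambda>\<omega>. \<phi> (G \<omega>)) \<in> borel_measurable gauss_seq" "(\<lambda>\<omega>. \<phi> (gser n \<omega>)) \<in> borel_measurable gauss_seq" for n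
      by (rule measurable_compose[OF G \<phi>b], rule measurable_compose[OF gser_measurable \<phi>b])
    define v where "v = (\<Sum>m. (\<phi> (l1_class (chol m)))\<^sup>2)"
    note sm = functional_chol_summable[OF \<phi>]
    have v: "0 \<le> v" unfolding v_def by (rule suminf_nonneg[OF sm]) simp
    have "(\<integral>x. iexp (t * \<phi> x) \<partial>\<mu>) = complex_of_real (exp (- (t\<^sup>2 * v) / 2))" for t
    proof -
      have "(\<integral>x. iexp (t * \<phi> x) \<partial>\<mu>) = (\<integral>\<omega>. iexp (t * \<phi> (G \<omega>)) \<partial>gauss_seq)"
        unfolding \<mu>_def by (rule integral_distr[OF G]) (use \<phi>b in measurable)
      moreover have "(\<lambda>k. \<integral>\<omega>. iexp (t * \<phi> (gser (r k) \<omega>)) \<partial>gauss_seq) \<longlonglongrightarrow> (\<integral>\<omega>. iexp (t * \<phi> (G \<omega>)) \<partial>gauss_seq)"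
      proof (rule integral_dominated_convergence[where w="\<lambda>_. 1"])
        show "AE \<omega> in gauss_seq. (\<lambda>k. iexp (t * \<phi> (gser (r k) \<omega>))) \<longlonglongrightarrow> iexp (t * \<phi> (G \<omega>))"
          using lim by eventually_elim (intro tendsto_intros \<phi>.tendsto)
      qed auto
      moreover have "(\<integral>\<omega>. iexp (t * \<phi> (gser n \<omega>)) \<partial>gauss_seq) = complex_of_real (exp (- (t\<^sup>2 * (\<Sum>m<n. (\<phi> (l1_class (chol m)))\<^sup>2)) / 2))" for n
      proof -
        have "t * \<phi> (gser n \<omega>) = (\<Sum>m<n. (t * \<phi> (l1_class (chol m))) * \<omega> m)" for \<omega>
          unfolding gser_def by (simp add: \<phi>.sum \<phi>.scale sum_distrib_left mult_ac)
        then show ?thesis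
          using gauss_seq_char[of "\<lambda>m. t * \<phi> (l1_class (chol m))" n]
          by (simp only: power_mult_distrib sum_distrib_left)
      qed
      moreover have "(\<lambda>k. complex_of_real (exp (- (t\<^sup>2 * (\<Sum>m<r k. (\<phi> (l1_class (chol m)))\<^sup>2)) / 2))) \<longlonglongrightarrow> complex_of_real (exp (- (t\<^sup>2 * v) / 2))"
      proof -
        have "(\<lambda>n. \<Sum>m<n. (\<phi> (l1_class (chol m)))\<^sup>2) \<longlonglongrightarrow> v"
          unfolding v_def by (rule summable_LIMSEQ[OF sm])
        note lim_v = LIMSEQ_subseq_LIMSEQ[OF this r, unfolded comp_def]
        show ?thesis by (intro tendsto_intros lim_v) simp
      qed
      ultimately show ?thesis using LIMSEQ_unique by simp
    qed
    from gaussian_of_char[OF mu(1) \<phi>m v this] show ?thesis by (simp add: v_def)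
  qed
  have conv: "(\<lambda>k. \<integral>\<omega>. h (gser (r k) \<omega>) \<partial>gauss_seq) \<longlonglongrightarrow> (\<integral>x. h x \<partial>\<mu>)"
    if h: "continuous_on UNIV h" "\<And>x. \<bar>h x\<bar> \<le> K" for h :: "l1 \<Rightarrow> real" and K
  proof -
    have hb: "h \<in> borel_measurable borel" by (rule borel_measurable_continuous_onI[OF h(1)])
    have "(\<integral>x. h x \<partial>\<mu>) = (\<integral>\<omega>. h (G \<omega>) \<partial>gauss_seq)"
      unfolding \<mu>_def by (rule integral_distr[OF G hb])
    moreover have "(\<lambda>k. \<integral>\<omega>. h (gser (r k) \<omega>) \<partial>gauss_seq) \<longlonglongrightarrow> (\<integral>\<omega>. h (G \<omega>) \<partial>gauss_seq)"
    proof (rule integral_dominated_convergence[where w="\<lambda>_. K"])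
      show "(\<lambda>\<omega>. h (G \<omega>)) \<in> borel_measurable gauss_seq" by (rule measurable_compose[OF G hb])
      show "(\<lambda>\<omega>. h (gser (r k) \<omega>)) \<in> borel_measurable gauss_seq" for k by (rule measurable_compose[OF gser_measurable hb])
      show "AE \<omega> in gauss_seq. (\<lambda>k. h (gser (r k) \<omega>)) \<longlonglongrightarrow> h (G \<omega>)"
        using lim
      proof eventually_elim
        case (elim \<omega>)
        then show ?case using continuous_on_tendsto_compose[OF h(1) elim] by simp
      qed
    qed (use h in auto)
    ultimately show ?thesis by simp
  qed
  have cg: "centered_gaussian_law \<mu>"
    unfolding centered_gaussian_law_def using mu gauss by simp
  show thesis
  proof (rule that)
    show "strict_mono r" by (rule r)
    show "centered_gaussian_law \<mu>" by (rule cg)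
    show "integrable \<mu> (\<lambda>x. (\<phi> x)\<^sup>2)" if "bounded_linear \<phi>" for \<phi> :: "l1 \<Rightarrow> real" using gauss[OF that] by simp
    show "(\<integral>x. (\<phi> x)\<^sup>2 \<partial>\<mu>) = (\<Sum>m. (\<phi> (l1_class (chol m)))\<^sup>2)" if "bounded_linear \<phi>" for \<phi> :: "l1 \<Rightarrow> real"
      using gauss[OF that] by simp
    show "(\<lambda>k. \<integral>\<omega>. h (gser (r k) \<omega>) \<partial>gauss_seq) \<longlonglongrightarrow> (\<integral>x. h x \<partial>\<mu>)"
      if "continuous_on UNIV h" "\<And>x. \<bar>h x\<bar> \<le> K" for h :: "l1 \<Rightarrow> real" and K using that by (rule conv)
  qed
qed

text \<open>Both sides are the double integral of \<open>f s * g t * Kern s t\<close>: the series by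
  inserting the Cholesky expansion, with partial sums dominated by \<open>sqk s * sqk t\<close>, and
  \<open>Phi_sym\<close> because exchanging the variables converts the transposed kernel into the
  form with \<open>f\<close> and \<open>g\<close> exchanged.\<close>

lemma Phi_sym_eq:
  assumes f: "f \<in> Linfty" and g: "g \<in> Linfty"
  shows "(\<lambda>m. (\<integral>t. f t * chol m t \<partial>lborel) * (\<integral>t. g t * chol m t \<partial>lborel)) sums Phi_sym P coord f g"
proof -
  let ?L = "lborel \<Otimes>\<^sub>M lborel :: (real \<times> real) measure"
  have [measurable]: "f \<in> borel_measurable borel" "g \<in> borel_measurable borel"
    using f g by (auto simp: Linfty_def)
  have ifc: "integrable lborel (\<lambda>t. f t * chol m t)" "integrable lborel (\<lambda>t. g t * chol m t)" for m
    using integrable_Linfty_mult[OF _ chol_integrable] f g by auto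
  define T where "T M p = f (fst p) * g (snd p) * (\<Sum>m<M. chol m (fst p) * chol m (snd p))" for M p
  have part: "(\<Sum>m<M. (\<integral>t. f t * chol m t \<partial>lborel) * (\<integral>t. g t * chol m t \<partial>lborel)) = (\<integral>p. T M p \<partial>?L)" for M
  proof -
    have "(\<integral>p. T M p \<partial>?L) = (\<integral>p. (\<Sum>m<M. (f (fst p) * chol m (fst p)) * (g (snd p) * chol m (snd p))) \<partial>?L)"
      unfolding T_def sum_distrib_left by (intro Bochner_Integration.integral_cong sum.cong refl) (simp add: mult_ac)
    also have "\<dots> = (\<Sum>m<M. \<integral>p. (f (fst p) * chol m (fst p)) * (g (snd p) * chol m (snd p)) \<partial>?L)"
      by (rule Bochner_Integration.integral_sum) (rule integrable_product(1)[OF ifc])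
    finally show ?thesis by (simp only: integrable_product(2)[OF ifc])
  qed
  have "(\<lambda>M. \<integral>p. T M p \<partial>?L) \<longlonglongrightarrow> (\<integral>p. f (fst p) * g (snd p) * Kern (fst p) (snd p) \<partial>?L)"
  proof (rule integral_dominated_convergence)
    show "T M \<in> borel_measurable ?L" for M unfolding T_def by measurable
    show "AE p in ?L. (\<lambda>M. T M p) \<longlonglongrightarrow> f (fst p) * g (snd p) * Kern (fst p) (snd p)"
      unfolding T_def by (intro AE_I2 tendsto_intros) (use chol_sums in \<open>auto simp: sums_def\<close>)
    then show "(\<lambda>p. f (fst p) * g (snd p) * Kern (fst p) (snd p)) \<in> borel_measurable ?L"
    proof -
      have "(\<lambda>p. f (fst p) * g (snd p) * (\<Sum>m. chol m (fst p) * chol m (snd p))) \<in> borel_measurable ?L" by measurable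
      moreover have "(\<Sum>m. chol m s * chol m t) = Kern s t" for s t
        by (rule sums_unique[symmetric, OF chol_sums])
      ultimately show ?thesis by simp
    qed
    show "integrable ?L (\<lambda>p. \<bar>(f (fst p) * sqk (fst p)) * (g (snd p) * sqk (snd p))\<bar>)"
      by (intro integrable_abs integrable_product(1) integrable_Linfty_mult[OF f sqk(3)] integrable_Linfty_mult[OF g sqk(3)])
    fix M
    have "\<bar>\<Sum>m<M. chol m s * chol m t\<bar> \<le> sqk s * sqk t" for s t
    proof -
      have "(\<Sum>m<M. chol m s * chol m t)\<^sup>2 \<le> (\<Sum>m<M. (chol m s)\<^sup>2) * (\<Sum>m<M. (chol m t)\<^sup>2)"
        by (rule Cauchy_Schwarz_ineq_sum)
      also have "\<dots> \<le> (sqk s)\<^sup>2 * (sqk t)\<^sup>2"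
        by (intro mult_mono order_trans[OF chol_sum_le(1) sqk(2)]) (auto simp: sum_nonneg)
      finally have "\<bar>\<Sum>m<M. chol m s * chol m t\<bar>\<^sup>2 \<le> (sqk s * sqk t)\<^sup>2" by (simp add: power_mult_distrib)
      then show ?thesis by (rule power2_le_imp_le) (simp add: sqk(1))
    qed
    then have "\<bar>T M p\<bar> \<le> \<bar>f (fst p) * g (snd p)\<bar> * (sqk (fst p) * sqk (snd p))" for p
      unfolding T_def abs_mult[of "f (fst p) * g (snd p)"] by (intro mult_left_mono) auto
    then show "AE p in ?L. norm (T M p) \<le> \<bar>(f (fst p) * sqk (fst p)) * (g (snd p) * sqk (snd p))\<bar>"
      using sqk(1) by (auto simp: abs_mult abs_of_nonneg mult_ac)
  qed
  moreover have "(\<integral>p. f (fst p) * g (snd p) * Kern (fst p) (snd p) \<partial>?L) = Phi_sym P coord f g"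
  proof -
    have i1: "integrable ?L (\<lambda>p. f (fst p) * g (snd p) * C_kernel P coord (fst p) (snd p))"
      using Phi_integrable[OF f g] by (simp add: Phi_integrand_def case_prod_beta')
    have i2: "integrable ?L (\<lambda>p. g (fst p) * f (snd p) * C_kernel P coord (fst p) (snd p))"
      using Phi_integrable[OF g f] by (simp add: Phi_integrand_def case_prod_beta')
    have sw: "(\<integral>p. g (snd p) * f (fst p) * C_kernel P coord (snd p) (fst p) \<partial>?L) = Phi P coord g f"
      using lborel_pair.integral_product_swap[OF borel_measurable_integrable[OF i2]]
      by (simp add: Phi_def Phi_integrand_def case_prod_beta')
    have i2': "integrable ?L (\<lambda>p. g (snd p) * f (fst p) * C_kernel P coord (snd p) (fst p))"
      using lborel_pair.integrable_product_swap[OF i2] by (simp add: case_prod_beta')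
    have KC: "Kern s t = (C_kernel P coord s t + C_kernel P coord t s) / 2" for s t
      by (simp add: C_kernel_sym_part)
    have "(\<integral>p. f (fst p) * g (snd p) * Kern (fst p) (snd p) \<partial>?L) =
      (\<integral>p. (f (fst p) * g (snd p) * C_kernel P coord (fst p) (snd p) + g (snd p) * f (fst p) * C_kernel P coord (snd p) (fst p)) / 2 \<partial>?L)"
      unfolding KC by (intro Bochner_Integration.integral_cong refl) (simp add: field_simps)
    also have "\<dots> = ((\<integral>p. f (fst p) * g (snd p) * C_kernel P coord (fst p) (snd p) \<partial>?L) + Phi P coord g f) / 2"
      using i1 i2' by (simp add: sw)
    finally show ?thesis by (simp add: Phi_sym_def Phi_def Phi_integrand_def case_prod_beta')
  qed
  ultimately show ?thesis unfolding sums_def part by simp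
qed

end

section \<open>Discretization\<close>

context mixing_path_tail
begin

text \<open>To the left of \<open>- \<bar>x\<bar>\<close> the modulus is \<open>F t\<close>, to the
  right of \<open>\<bar>x\<bar>\<close> it is \<open>1 - F t\<close>. Both are at most the square of
  \<open>wt t\<close>, hence at most \<open>wt t\<close>.\<close>

lemma ev_integrable: "integrable lborel (\<lambda>t. ev t x)"
proof (rule Bochner_Integration.integrable_bound)
  show "integrable lborel (\<lambda>t. indicator {- \<bar>x\<bar>..\<bar>x\<bar>} t + wt t)"
    using wt_integrable by (intro Bochner_Integration.integrable_add) auto
  show "(\<lambda>t. ev t x) \<in> borel_measurable lborel"
    using ev_measurable2[of "\<lambda>t. t" borel "\<lambda>_. x"] by simp
  have w: "(wt t)\<^sup>2 \<le> wt t" for t using wt_nonneg[of t] wt_le_one[of t] by (simp add: power2_eq_square mult_left_le)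
  have "\<bar>ev t x\<bar> \<le> indicator {- \<bar>x\<bar>..\<bar>x\<bar>} t + wt t" for t
  proof -
    consider "t < - \<bar>x\<bar>" | "t > \<bar>x\<bar>" | "t \<in> {- \<bar>x\<bar>..\<bar>x\<bar>}" by force
    then show ?thesis
    proof cases
      case 1
      then have "\<bar>ev t x\<bar> = F t" using F_bounds[of t] by (auto simp: ev_def indicator_def)
      moreover have "t < 0" using 1 by linarith
      ultimately show ?thesis using 1 lower_tail_le_wt[of t] w[of t] by (simp add: indicator_def)
    next
      case 2
      then have "\<bar>ev t x\<bar> = 1 - F t" using F_bounds[of t] by (auto simp: ev_def indicator_def)
      moreover have "0 \<le> t" using 2 by linarith
      ultimately show ?thesis using 2 upper_tail_le_wt[of t] w[of t] by (simp add: indicator_def)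
    next
      case 3
      then show ?thesis using ev_bound[of t x] wt_nonneg[of t] by (simp add: indicator_def)
    qed
  qed
  then show "AE t in lborel. norm (ev t x) \<le> norm (indicator {- \<bar>x\<bar>..\<bar>x\<bar>} t + wt t)"
    using wt_nonneg by (intro AE_I2) (simp add: abs_of_nonneg)
qed

definition evc :: "real \<Rightarrow> l1" where "evc x = l1_class (\<lambda>t. ev t x)"

text \<open>The centering cancels and the indicator of an interval remains. The line is thus
  embedded isometrically into \<open>L^1\<close>, whence the continuity of the process as a function
  of the path, and its measurability.\<close>

lemma evc_dist: "x \<le> x' \<Longrightarrow> norm (evc x - evc x') = x' - x"
proof -
  assume le: "x \<le> x'"
  have "norm (evc x - evc x') = (\<integral>t. \<bar>ev t x - ev t x'\<bar> \<partial>lborel)"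
    unfolding evc_def by (rule norm_l1_class_diff[OF ev_integrable ev_integrable])
  also have "\<dots> = (\<integral>t. indicator {x..<x'} t \<partial>lborel)"
    by (intro Bochner_Integration.integral_cong refl) (use le in \<open>auto simp: ev_def indicator_def\<close>)
  also have "\<dots> = x' - x" using le by simp
  finally show ?thesis .
qed

lemma continuous_evc: "continuous_on UNIV evc"
proof (rule lipschitz_on_continuous_on)
  have "norm (evc x - evc x') \<le> \<bar>x - x'\<bar>" for x x'
    using evc_dist[of x x'] evc_dist[of x' x] norm_minus_commute[of "evc x" "evc x'"] by (cases "x \<le> x'") auto
  then show "1-lipschitz_on UNIV evc" by (auto simp: lipschitz_on_def dist_norm)
qed

text \<open>The estimates concern the times \<open>0, -1, ..., 1 - n\<close>, the theorem the times
  \<open>1, ..., n\<close> of \<open>fproc\<close>. A shift by \<open>n\<close> carries one to the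
  other and preserves the law.\<close>

definition bproc :: "nat \<Rightarrow> (int \<Rightarrow> real) \<Rightarrow> real \<Rightarrow> real" where
  "bproc n y t = bsum (ev t) n y / sqrt (real n)"

definition fproc :: "nat \<Rightarrow> (int \<Rightarrow> real) \<Rightarrow> real \<Rightarrow> real" where
  "fproc n y t = (\<Sum>i=1..n. ev t (y (int i))) / sqrt (real n)"

lemma fproc_shift: "fproc n (\<lambda>i. y (i - int n)) = bproc n y"
proof
  fix t
  have "(\<Sum>i=1..n. ev t (y (int i - int n))) = (\<Sum>j<n. ev t (y (- int j)))"
    by (rule sum.reindex_bij_witness[of _ "\<lambda>j. n - j" "\<lambda>i. n - i"]) (auto simp: of_nat_diff)
  then show "fproc n (\<lambda>i. y (i - int n)) t = bproc n y t" by (simp add: fproc_def bproc_def bsum_def)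
qed

lemma fproc_integrable: "integrable lborel (fproc n y)"
  unfolding fproc_def using ev_integrable by (intro Bochner_Integration.integrable_divide Bochner_Integration.integrable_sum)

lemma bproc_integrable: "integrable lborel (bproc n y)"
  using fproc_integrable[of n "\<lambda>i. y (i - int n)"] by (simp only: fproc_shift)

lemma fproc_class: "l1_class (fproc n y) = (1 / sqrt (real n)) *\<^sub>R (\<Sum>i=1..n. evc (y (int i)))"
proof -
  have "(\<Sum>i=1..n. evc (y (int i))) = l1_class (\<lambda>t. \<Sum>i=1..n. ev t (y (int i)))"
    unfolding evc_def by (rule l1_class_sum[OF ev_integrable])
  moreover have "integrable lborel (\<lambda>t. \<Sum>i=1..n. ev t (y (int i)))"
    by (rule Bochner_Integration.integrable_sum[OF ev_integrable])
  ultimately show ?thesis by (simp add: l1_class_scaleR fproc_def[abs_def])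
qed

lemma fproc_class_measurable: "(\<lambda>y. l1_class (fproc n y)) \<in> borel_measurable path_space"
proof -
  have c: "continuous_on UNIV (\<lambda>y :: int \<Rightarrow> real. evc (y i))" for i
    by (rule continuous_on_compose2[OF continuous_evc continuous_on_product_then_coordinatewise[OF continuous_on_id]]) simp
  have "continuous_on UNIV (\<lambda>y. l1_class (fproc n y))"
    unfolding fproc_class by (intro continuous_intros c)
  then have "(\<lambda>y. l1_class (fproc n y)) \<in> borel_measurable borel" by (rule borel_measurable_continuous_onI)
  then show ?thesis by (simp cong: measurable_cong_sets add: sets_PiM_equal_borel)
qed

lemma expectation_fproc:
  assumes h: "(h :: l1 \<Rightarrow> real) \<in> borel_measurable borel"
  shows "(\<integral>y. h (l1_class (fproc n y)) \<partial>P) = (\<integral>y. h (l1_class (bproc n y)) \<partial>P)"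
proof -
  have "(\<lambda>y. h (l1_class (fproc n y))) \<in> borel_measurable path_space"
    by (rule measurable_compose[OF fproc_class_measurable h])
  then have "(\<lambda>y. h (l1_class (fproc n y))) \<in> borel_measurable P"
    by (simp cong: measurable_cong_sets add: sets_P)
  from integral_shift[OF this, of n] show ?thesis by (simp add: fproc_shift)
qed

lemma bproc_class_measurable: "(\<lambda>y. l1_class (bproc n y)) \<in> borel_measurable P"
proof -
  have "(\<lambda>y. l1_class (fproc n y)) \<in> borel_measurable P"
    using fproc_class_measurable by (simp cong: measurable_cong_sets add: sets_P)
  from measurable_compose[OF B_pow_meas[of n] this] show ?thesis by (simp add: bshift_pow fproc_shift)
qed

lemma bproc_measurable2: "case_prod (bproc n) \<in> borel_measurable (P \<Otimes>\<^sub>M lborel)"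
proof -
  have [measurable]: "(\<lambda>q. fst q i) \<in> borel_measurable (P \<Otimes>\<^sub>M lborel)" for i
    by (rule measurable_compose[OF measurable_fst coord_meas])
  have "(\<lambda>q. (\<Sum>j<n. ev (snd q) (fst q (- int j))) / sqrt (real n)) \<in> borel_measurable (P \<Otimes>\<^sub>M lborel)"
    by (intro borel_measurable_divide borel_measurable_sum ev_measurable2) measurable
  then show ?thesis by (simp add: bproc_def[abs_def] bsum_def case_prod_beta')
qed

lemma bproc_moments:
  "integrable P (\<lambda>y. (bproc n y t)\<^sup>2)" "(\<integral>y. (bproc n y t)\<^sup>2 \<partial>P) \<le> (sqk t)\<^sup>2"
  "integrable P (\<lambda>y. (bproc n y v - bproc n y u)\<^sup>2)"
  "u \<le> v \<Longrightarrow> (\<integral>y. (bproc n y v - bproc n y u)\<^sup>2 \<partial>P) \<le> (F v - F u) * cst"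
proof -
  have i: "integrable P (\<lambda>y. (bsum (ev t) n y)\<^sup>2)" for t
    using integrable_bsum_mult(1)[OF mixf_ev[of t] mixf_ev[of t], of n] by (simp add: power2_eq_square)
  then show "integrable P (\<lambda>y. (bproc n y t)\<^sup>2)" by (simp add: bproc_def power_divide)
  have i2: "integrable P (\<lambda>y. (bsum (ev v) n y - bsum (ev u) n y)\<^sup>2)"
    using i[of u] i[of v] integrable_bsum_mult(1)[OF mixf_ev[of v] mixf_ev[of u], of n] by (simp add: power2_diff mult.assoc)
  have d: "(bproc n y v - bproc n y u)\<^sup>2 = (bsum (ev v) n y - bsum (ev u) n y)\<^sup>2 / real n" for y
    by (simp add: bproc_def diff_divide_distrib[symmetric] power_divide)
  show "integrable P (\<lambda>y. (bproc n y v - bproc n y u)\<^sup>2)" using i2 by (simp add: d)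
  show "(\<integral>y. (bproc n y t)\<^sup>2 \<partial>P) \<le> (sqk t)\<^sup>2"
  proof (cases "n = 0")
    case False
    then show ?thesis using bsum_ev_le_wt[where t=t and n=n] cst_ge
      by (simp add: bproc_def power_divide sqk_def power_mult_distrib divide_le_eq mult_ac)
  qed (simp add: bproc_def)
  assume uv: "u \<le> v"
  show "(\<integral>y. (bproc n y v - bproc n y u)\<^sup>2 \<partial>P) \<le> (F v - F u) * cst"
  proof (cases "n = 0")
    case True
    then show ?thesis using F_mono[OF uv] cst_ge by (simp add: bproc_def)
  next
    case False
    then show ?thesis using bsum_ev_diff_second_moment[OF uv, where n=n]
      by (simp add: d divide_le_eq mult_ac)
  qed
qed

definition gproc :: "nat \<Rightarrow> (nat \<Rightarrow> real) \<Rightarrow> real \<Rightarrow> real" where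
  "gproc n \<omega> t = (\<Sum>m<n. chol m t * \<omega> m)"

lemma gproc_moments:
  "integrable gauss_seq (\<lambda>\<omega>. (gproc n \<omega> t)\<^sup>2)" "(\<integral>\<omega>. (gproc n \<omega> t)\<^sup>2 \<partial>gauss_seq) \<le> (sqk t)\<^sup>2"
  "integrable gauss_seq (\<lambda>\<omega>. (gproc n \<omega> v - gproc n \<omega> u)\<^sup>2)"
  "u \<le> v \<Longrightarrow> (\<integral>\<omega>. (gproc n \<omega> v - gproc n \<omega> u)\<^sup>2 \<partial>gauss_seq) \<le> (F v - F u) * cst"
proof -
  show "integrable gauss_seq (\<lambda>\<omega>. (gproc n \<omega> t)\<^sup>2)" unfolding gproc_def by (rule gauss_seq_second_moment)
  show "(\<integral>\<omega>. (gproc n \<omega> t)\<^sup>2 \<partial>gauss_seq) \<le> (sqk t)\<^sup>2"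
    unfolding gproc_def gauss_seq_second_moment by (rule order_trans[OF chol_sum_le(1) sqk(2)])
  have d: "gproc n \<omega> v - gproc n \<omega> u = (\<Sum>m<n. (chol m v - chol m u) * \<omega> m)" for \<omega>
    by (simp add: gproc_def sum_subtractf left_diff_distrib)
  show "integrable gauss_seq (\<lambda>\<omega>. (gproc n \<omega> v - gproc n \<omega> u)\<^sup>2)" unfolding d by (rule gauss_seq_second_moment)
  show "(\<integral>\<omega>. (gproc n \<omega> v - gproc n \<omega> u)\<^sup>2 \<partial>gauss_seq) \<le> (F v - F u) * cst" if "u \<le> v"
    unfolding d gauss_seq_second_moment
    using order_trans[OF chol_sum_le(2)[where s=v and t=u and M=n] _] Kern_diff_le[OF that] Kern_sym[of u v] by simp
qed

lemma gproc_measurable2: "case_prod (gproc n) \<in> borel_measurable (gauss_seq \<Otimes>\<^sub>M lborel)"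
proof -
  have [measurable]: "(\<lambda>q. fst q m) \<in> borel_measurable (gauss_seq \<Otimes>\<^sub>M lborel)" for m
    by (rule measurable_compose[OF measurable_fst gauss_seq_coord])
  have "(\<lambda>q. \<Sum>m<n. chol m (snd q) * fst q m) \<in> borel_measurable (gauss_seq \<Otimes>\<^sub>M (lborel :: real measure))" by measurable
  then show ?thesis by (simp add: gproc_def[abs_def] case_prod_beta')
qed

section \<open>Sampling on dyadic grids\<close>

definition cell :: "nat \<Rightarrow> nat \<Rightarrow> real set" where
  "cell k j = {real j / 2 ^ k - real k..<(real j + 1) / 2 ^ k - real k}"

text \<open>The right end of the cell, so that the nodes approach each \<open>t\<close> from the
  right, where \<open>F\<close> is continuous.\<close>

definition node :: "nat \<Rightarrow> nat \<Rightarrow> real" where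
  "node k j = (real j + 1) / 2 ^ k - real k"

text \<open>The map from grid values to the step function on \<open>[- k, k)\<close>. It is linear
  and depends on finitely many values, hence continuous on the product space.\<close>

definition step :: "nat \<Rightarrow> (nat \<Rightarrow> real) \<Rightarrow> l1" where
  "step k x = (\<Sum>j<2 * k * 2 ^ k. x j *\<^sub>R l1_class (indicator (cell k j)))"

definition next_node :: "nat \<Rightarrow> real \<Rightarrow> real" where
  "next_node k t = (of_int \<lfloor>(t + real k) * 2 ^ k\<rfloor> + 1) / 2 ^ k - real k"

lemma next_node_bounds: "t \<le> next_node k t" "next_node k t \<le> t + 1 / 2 ^ k"
proof -
  have "(t + real k) * 2 ^ k \<le> of_int \<lfloor>(t + real k) * 2 ^ k\<rfloor> + 1" by linarith
  then have "t + real k \<le> (of_int \<lfloor>(t + real k) * 2 ^ k\<rfloor> + 1) / 2 ^ k" by (simp add: pos_le_divide_eq)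
  then show "t \<le> next_node k t" by (simp add: next_node_def)
  have "of_int \<lfloor>(t + real k) * 2 ^ k\<rfloor> / 2 ^ k \<le> t + real k" by (simp add: divide_le_eq)
  then show "next_node k t \<le> t + 1 / 2 ^ k" by (simp add: next_node_def add_divide_distrib)
qed

lemma cell_integrable: "integrable lborel (indicator (cell k j) :: real \<Rightarrow> real)"
proof -
  have "real j / 2 ^ k - real k \<le> (real j + 1) / 2 ^ k - real k" by (simp add: divide_right_mono)
  then show ?thesis unfolding cell_def by (intro integrable_real_indicator) (auto simp: emeasure_lborel_Ico)
qed

lemma cell_iff: "t \<in> cell k j \<longleftrightarrow> \<lfloor>(t + real k) * 2 ^ k\<rfloor> = int j"
proof -
  have "t \<in> cell k j \<longleftrightarrow> real j \<le> (t + real k) * 2 ^ k \<and> (t + real k) * 2 ^ k < real j + 1"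
    by (auto simp: cell_def field_simps)
  then show ?thesis by (auto simp: floor_eq_iff)
qed

lemma step_sum_eq:
  "(\<Sum>j<2 * k * 2 ^ k. Z (node k j) * indicator (cell k j) t) =
    (if - real k \<le> t \<and> t < real k then Z (next_node k t) else (0 :: real))"
proof -
  let ?f = "\<lfloor>(t + real k) * 2 ^ k\<rfloor>"
  have ind: "(indicator (cell k j) t :: real) = (if ?f = int j then 1 else 0)" for j
    by (simp add: indicator_def cell_iff)
  show ?thesis
  proof (cases "- real k \<le> t \<and> t < real k")
    case True
    then have f0: "0 \<le> ?f" by simp
    have "(t + real k) * 2 ^ k < (2 * real k) * 2 ^ k" using True by (intro mult_strict_right_mono) auto
    moreover have "real_of_int (int (2 * k * 2 ^ k)) = (2 * real k) * 2 ^ k" by simp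
    ultimately have "real_of_int ?f < of_int (int (2 * k * 2 ^ k))"
      using of_int_floor_le[of "(t + real k) * 2 ^ k"] by linarith
    then have f1: "?f < int (2 * k * 2 ^ k)" by linarith
    have "(\<Sum>j<2 * k * 2 ^ k. Z (node k j) * indicator (cell k j) t) = (\<Sum>j<2 * k * 2 ^ k. if j = nat ?f then Z (node k j) else 0)"
      by (intro sum.cong refl) (use f0 in \<open>auto simp: ind\<close>)
    also have "\<dots> = Z (node k (nat ?f))" using f0 f1 by (simp add: nat_less_iff)
    also have "node k (nat ?f) = next_node k t" using f0 by (simp add: node_def next_node_def)
    finally show ?thesis using True by simp
  next
    case False
    have "?f \<noteq> int j" if j: "j < 2 * k * 2 ^ k" for j
    proof
      assume "?f = int j"
      then have b: "real j \<le> (t + real k) * 2 ^ k" "(t + real k) * 2 ^ k < real j + 1" by linarith+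
      have "0 \<le> t + real k" using b(1) by (metis of_nat_0_le_iff order_trans zero_le_mult_iff zero_less_numeral zero_less_power not_le)
      moreover have "real j + 1 \<le> 2 * real k * 2 ^ k"
      proof -
        have "real (j + 1) \<le> real (2 * k * 2 ^ k)" using j by (intro of_nat_mono) simp
        then show ?thesis by simp
      qed
      then have "(t + real k) * 2 ^ k < 2 * real k * 2 ^ k" using b(2) by linarith
      then have "t + real k < 2 * real k" by (rule mult_right_less_imp_less) simp
      ultimately show False using False by linarith
    qed
    then show ?thesis unfolding if_not_P[OF False] by (simp add: ind)
  qed
qed

text \<open>Bounds the root mean square of the sampling error at \<open>t\<close>: that of an
  increment inside the grid, that of the process itself outside.\<close>

definition step_err :: "nat \<Rightarrow> real \<Rightarrow> real" where
  "step_err k t = (if - real k \<le> t \<and> t < real k then sqrt ((F (next_node k t) - F t) * cst) else sqk t)"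

lemma next_node_measurable [measurable]: "next_node k \<in> borel_measurable borel"
  unfolding next_node_def[abs_def] by measurable

lemma step_err_nonneg: "0 \<le> step_err k t"
  using F_mono[OF next_node_bounds(1)[where t=t and k=k]] cst_ge sqk(1) by (simp add: step_err_def)

text \<open>Each summand serves one region: the upper tail for \<open>t > 0\<close>, the lower tail
  at \<open>t + 1\<close> for \<open>t < - 1\<close>, since the next node may lie up to one unit to
  the right, and the trivial bound in between.\<close>

definition step_dom :: "real \<Rightarrow> real" where
  "step_dom t = sqrt cst * (wt t + wt (t + 1) + indicator {- 1..0} t)"

lemma step_dom_integrable: "integrable lborel step_dom"
proof -
  have "integrable lborel (\<lambda>t. wt (t + 1))"
    using lborel_integrable_real_affine[OF wt_integrable, of 1 1] by (simp add: add.commute)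
  then show ?thesis unfolding step_dom_def[abs_def] using wt_integrable
    by (intro integrable_mult_right Bochner_Integration.integrable_add) auto
qed

lemma step_err_le: "step_err k t \<le> step_dom t"
proof (cases "- real k \<le> t \<and> t < real k")
  case True
  let ?r = "next_node k t" and ?w = "wt t + wt (t + 1) + indicator {- 1..0} t"
  have nn: "0 \<le> wt t" "0 \<le> wt (t + 1)" "0 \<le> ?w" using wt_nonneg by (auto simp: indicator_def)
  have r: "t \<le> ?r" "?r \<le> t + 1"
    using next_node_bounds(1)[where t=t and k=k] next_node_bounds(2)[where t=t and k=k] by (auto intro: order_trans[of _ "t + 1 / 2 ^ k"] simp: divide_le_eq_1)
  have "F ?r - F t \<le> ?w\<^sup>2"
  proof -
    consider "t > 0" | "t \<in> {- 1..0}" | "t < - 1" by force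
    then show ?thesis
    proof cases
      case 1
      then have "F ?r - F t \<le> (wt t)\<^sup>2" using upper_tail_le_wt[of t] F_bounds(2)[of ?r] by linarith
      also have "\<dots> \<le> ?w\<^sup>2" using nn by (intro power_mono) auto
      finally show ?thesis .
    next
      case 2
      have "F ?r - F t \<le> 1\<^sup>2" using F_bounds[of t] F_bounds[of ?r] by simp
      also have "\<dots> \<le> ?w\<^sup>2" using nn 2 by (intro power_mono) auto
      finally show ?thesis .
    next
      case 3
      then have "F ?r - F t \<le> (wt (t + 1))\<^sup>2"
        using lower_tail_le_wt[of "t + 1"] F_mono[OF r(2)] F_bounds(1)[of t] by linarith
      also have "\<dots> \<le> ?w\<^sup>2" using nn by (intro power_mono) auto
      finally show ?thesis .
    qed
  qed
  then have "sqrt ((F ?r - F t) * cst) \<le> sqrt (?w\<^sup>2 * cst)"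
    using cst_ge by (intro real_sqrt_le_mono mult_right_mono) auto
  also have "\<dots> = step_dom t" using nn(3) by (simp add: step_dom_def real_sqrt_mult)
  finally show ?thesis using True by (simp add: step_err_def)
next
  case False
  have "sqrt cst * wt t \<le> step_dom t"
    unfolding step_dom_def using wt_nonneg cst_ge by (intro mult_left_mono) auto
  then show ?thesis unfolding step_err_def if_not_P[OF False] sqk_def .
qed

lemma sqk_measurable [measurable]: "sqk \<in> borel_measurable borel"
  using sqk(3) by auto

lemma step_err_measurable [measurable]: "step_err k \<in> borel_measurable borel"
  unfolding step_err_def[abs_def] by measurable

lemma step_err_integrable: "integrable lborel (step_err k)"
proof (rule Bochner_Integration.integrable_bound[OF step_dom_integrable])
  have "\<bar>step_err k t\<bar> \<le> \<bar>step_dom t\<bar>" for t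
    using step_err_nonneg[of k t] step_err_le[of k t] by linarith
  then show "AE t in lborel. norm (step_err k t) \<le> norm (step_dom t)" by simp
qed measurable

lemma step_err_tendsto: "(\<lambda>k. \<integral>t. step_err k t \<partial>lborel) \<longlonglongrightarrow> 0"
proof -
  interpret D: real_distribution "distr P borel (coord 0)" by (rule real_distribution_distr[OF coord_meas])
  have "(\<lambda>k. \<integral>t. step_err k t \<partial>lborel) \<longlonglongrightarrow> (\<integral>(t::real). (0::real) \<partial>lborel)"
  proof (rule integral_dominated_convergence[OF _ _ step_dom_integrable])
    show "AE t in lborel. (\<lambda>k. step_err k t) \<longlonglongrightarrow> 0"
    proof (rule AE_I2)
      fix t
      have ge: "(F \<longlongrightarrow> F t) (at t within {t..})"
      proof -
        have "(F \<longlongrightarrow> F t) (at_right t)"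
          using D.cdf_is_right_cont[of t] unfolding distr_fun_def continuous_within .
        then have "continuous (at_right t) F" by (simp add: continuous_within)
        then show ?thesis
          by (metis at_within_Ici_at_right continuous_within)
      qed
      have rt: "(\<lambda>k. next_node k t) \<longlonglongrightarrow> t"
      proof (rule tendsto_sandwich[where f="\<lambda>_. t" and h="\<lambda>k. t + 1 / 2 ^ k"])
        show "(\<lambda>k. t + 1 / 2 ^ k) \<longlonglongrightarrow> t" by real_asymp
      qed (use next_node_bounds in auto)
      have "(\<lambda>k. F (next_node k t)) \<longlonglongrightarrow> F t"
      proof (rule LIMSEQ_I)
        fix e :: real assume "e > 0"
        then have "eventually (\<lambda>x. dist (F x) (F t) < e) (at t within {t..})"
          using ge tendstoD by blast
        then obtain d where d: "d > 0" "\<And>x. x \<in> {t..} \<Longrightarrow> x \<noteq> t \<Longrightarrow> dist x t < d \<Longrightarrow> dist (F x) (F t) < e"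
          unfolding eventually_at by blast
        from LIMSEQ_D[OF rt d(1)] obtain k0 where k0: "\<And>k. k \<ge> k0 \<Longrightarrow> norm (next_node k t - t) < d" by blast
        have "norm (F (next_node k t) - F t) < e" if "k \<ge> k0" for k
          using k0[OF that] d(2)[of "next_node k t"] next_node_bounds(1)[where t=t and k=k] \<open>e > 0\<close>
          by (cases "next_node k t = t") (auto simp: dist_norm)
        then show "\<exists>k0. \<forall>k\<ge>k0. norm (F (next_node k t) - F t) < e" by blast
      qed
      then have "(\<lambda>k. sqrt ((F (next_node k t) - F t) * cst)) \<longlonglongrightarrow> sqrt ((F t - F t) * cst)"
        by (intro tendsto_intros)
      moreover have "eventually (\<lambda>k. sqrt ((F (next_node k t) - F t) * cst) = step_err k t) sequentially"
      proof -
        have "eventually (\<lambda>k. k > nat \<lceil>\<bar>t\<bar>\<rceil>) sequentially" by (rule eventually_gt_at_top)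
        then show ?thesis
        proof eventually_elim
          case (elim k)
          then have "\<bar>t\<bar> < real k" by linarith
          then show ?case by (simp add: step_err_def abs_less_iff)
        qed
      qed
      ultimately show "(\<lambda>k. step_err k t) \<longlonglongrightarrow> 0" by (auto intro: Lim_transform_eventually)
    qed
    show "AE t in lborel. norm (step_err k t) \<le> step_dom t" for k
      using step_err_nonneg step_err_le by (simp add: abs_of_nonneg)
  qed measurable
  then show ?thesis by simp
qed

text \<open>Formulated for any random function with these moment bounds, since it is applied to the
  empirical process and to the Gaussian partial sums, with an error that is the same for both and
  independent of their index.\<close>

lemma step_approx:
  assumes Q: "prob_space Q" and Zm: "case_prod Z \<in> borel_measurable (Q \<Otimes>\<^sub>M lborel)"
    and Zi: "\<And>\<omega>. integrable lborel (Z \<omega>)"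
    and Z2: "\<And>t. integrable Q (\<lambda>\<omega>. (Z \<omega> t)\<^sup>2)" "\<And>t. (\<integral>\<omega>. (Z \<omega> t)\<^sup>2 \<partial>Q) \<le> (sqk t)\<^sup>2"
    and Zd: "\<And>u v. integrable Q (\<lambda>\<omega>. (Z \<omega> v - Z \<omega> u)\<^sup>2)"
      "\<And>u v. u \<le> v \<Longrightarrow> (\<integral>\<omega>. (Z \<omega> v - Z \<omega> u)\<^sup>2 \<partial>Q) \<le> (F v - F u) * cst"
    and h: "\<And>x y. \<bar>h x - h y\<bar> \<le> L * dist x y" "\<And>x. \<bar>h x\<bar> \<le> K" and L: "0 \<le> L"
    and hm: "(\<lambda>\<omega>. h (l1_class (Z \<omega>))) \<in> borel_measurable Q" "(\<lambda>\<omega>. h (step k (\<lambda>j. Z \<omega> (node k j)))) \<in> borel_measurable Q"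
  shows "\<bar>(\<integral>\<omega>. h (l1_class (Z \<omega>)) \<partial>Q) - (\<integral>\<omega>. h (step k (\<lambda>j. Z \<omega> (node k j))) \<partial>Q)\<bar> \<le> L * (\<integral>t. step_err k t \<partial>lborel)"
proof -
  interpret Q: prob_space Q by fact
  define T where "T \<omega> t = (\<Sum>j<2 * k * 2 ^ k. Z \<omega> (node k j) * indicator (cell k j) t)" for \<omega> t
  define \<phi> where "\<phi> \<omega> t = Z \<omega> t - T \<omega> t" for \<omega> t
  have st: "step k (\<lambda>j. Z \<omega> (node k j)) = l1_class (T \<omega>)" for \<omega>
    unfolding step_def T_def[abs_def] using cell_integrable by (simp add: l1_class_scaleR l1_class_sum)
  have Ti: "integrable lborel (T \<omega>)" for \<omega>
    unfolding T_def[abs_def] by (intro Bochner_Integration.integrable_sum integrable_mult_right cell_integrable)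
  have nrm: "norm (l1_class (Z \<omega>) - step k (\<lambda>j. Z \<omega> (node k j))) = (\<integral>t. \<bar>\<phi> \<omega> t\<bar> \<partial>lborel)" for \<omega>
    unfolding st \<phi>_def by (rule norm_l1_class_diff[OF Zi Ti])
  have \<phi>_eq: "\<phi> \<omega> t = (if - real k \<le> t \<and> t < real k then Z \<omega> t - Z \<omega> (next_node k t) else Z \<omega> t)" for \<omega> t
    unfolding \<phi>_def T_def step_sum_eq by simp
  have Zt: "(\<lambda>\<omega>. Z \<omega> t) \<in> borel_measurable Q" for t
    using measurable_compose[OF measurable_Pair2' Zm, of t] by simp
  have \<phi>m: "case_prod \<phi> \<in> borel_measurable (Q \<Otimes>\<^sub>M lborel)"
  proof -
    have "(\<lambda>p. Z (fst p) (snd p)) \<in> borel_measurable (Q \<Otimes>\<^sub>M lborel)" using Zm by (simp add: case_prod_beta')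
    moreover have "(\<lambda>p. Z (fst p) (node k j)) \<in> borel_measurable (Q \<Otimes>\<^sub>M lborel)" for j
      by (rule measurable_compose[OF measurable_fst Zt])
    moreover have "(\<lambda>p. indicator (cell k j) (snd p) :: real) \<in> borel_measurable (Q \<Otimes>\<^sub>M lborel)" for j
      unfolding cell_def by measurable
    ultimately have "(\<lambda>p. Z (fst p) (snd p) - (\<Sum>j<2 * k * 2 ^ k. Z (fst p) (node k j) * indicator (cell k j) (snd p))) \<in> borel_measurable (Q \<Otimes>\<^sub>M lborel)"
      by (intro borel_measurable_diff borel_measurable_sum borel_measurable_times)
    then show ?thesis by (simp add: \<phi>_def T_def case_prod_beta')
  qed
  have "integrable Q (\<lambda>\<omega>. (\<phi> \<omega> t)\<^sup>2)" for t
    unfolding \<phi>_eq using Z2(1)[of t] Zd(1)[of t "next_node k t"] by (cases "- real k \<le> t \<and> t < real k") auto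
  moreover have "(\<integral>\<omega>. (\<phi> \<omega> t)\<^sup>2 \<partial>Q) \<le> (step_err k t)\<^sup>2" for t
  proof (cases "- real k \<le> t \<and> t < real k")
    case True
    have "(\<integral>\<omega>. (\<phi> \<omega> t)\<^sup>2 \<partial>Q) = (\<integral>\<omega>. (Z \<omega> (next_node k t) - Z \<omega> t)\<^sup>2 \<partial>Q)"
      using True by (simp add: \<phi>_eq power2_commute)
    also have "\<dots> \<le> (F (next_node k t) - F t) * cst" by (rule Zd(2)[OF next_node_bounds(1)])
    also have "\<dots> = (step_err k t)\<^sup>2"
      using True F_mono[OF next_node_bounds(1)[where t=t and k=k]] cst_ge by (simp add: step_err_def)
    finally show ?thesis .
  next
    case False
    then have "(\<integral>\<omega>. (\<phi> \<omega> t)\<^sup>2 \<partial>Q) = (\<integral>\<omega>. (Z \<omega> t)\<^sup>2 \<partial>Q)" "step_err k t = sqk t"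
      by (auto simp: \<phi>_eq step_err_def)
    then show ?thesis using Z2(2)[of t] by simp
  qed
  ultimately have e: "integrable Q (\<lambda>\<omega>. \<integral>t. \<bar>\<phi> \<omega> t\<bar> \<partial>lborel)"
    "(\<integral>\<omega>. (\<integral>t. \<bar>\<phi> \<omega> t\<bar> \<partial>lborel) \<partial>Q) \<le> (\<integral>t. step_err k t \<partial>lborel)"
    using expectation_integral_abs_le[OF Q \<phi>m step_err_integrable step_err_nonneg] by auto
  have i1: "integrable Q (\<lambda>\<omega>. h (l1_class (Z \<omega>)))"
    by (rule Q.integrable_const_bound[of _ K]) (use h hm in auto)
  have i2: "integrable Q (\<lambda>\<omega>. h (step k (\<lambda>j. Z \<omega> (node k j))))"
    by (rule Q.integrable_const_bound[of _ K]) (use h hm in auto)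
  have "\<bar>(\<integral>\<omega>. h (l1_class (Z \<omega>)) \<partial>Q) - (\<integral>\<omega>. h (step k (\<lambda>j. Z \<omega> (node k j))) \<partial>Q)\<bar>
    = \<bar>\<integral>\<omega>. h (l1_class (Z \<omega>)) - h (step k (\<lambda>j. Z \<omega> (node k j))) \<partial>Q\<bar>"
    using i1 i2 by simp
  also have "\<dots> \<le> (\<integral>\<omega>. \<bar>h (l1_class (Z \<omega>)) - h (step k (\<lambda>j. Z \<omega> (node k j)))\<bar> \<partial>Q)" by (rule integral_abs_bound)
  also have "\<dots> \<le> (\<integral>\<omega>. L * (\<integral>t. \<bar>\<phi> \<omega> t\<bar> \<partial>lborel) \<partial>Q)"
  proof (rule integral_mono)
    show "\<bar>h (l1_class (Z \<omega>)) - h (step k (\<lambda>j. Z \<omega> (node k j)))\<bar> \<le> L * (\<integral>t. \<bar>\<phi> \<omega> t\<bar> \<partial>lborel)" for \<omega>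
      using h(1)[of "l1_class (Z \<omega>)" "step k (\<lambda>j. Z \<omega> (node k j))"] by (simp only: dist_norm nrm)
  qed (use i1 i2 e in auto)
  also have "\<dots> \<le> L * (\<integral>t. step_err k t \<partial>lborel)" using e L by (simp add: mult_left_mono)
  finally show ?thesis .
qed

lemma continuous_step: "continuous_on UNIV (step k)"
proof -
  have c: "continuous_on UNIV (\<lambda>x :: nat \<Rightarrow> real. x j)" for j
    by (rule continuous_on_product_then_coordinatewise[OF continuous_on_id])
  show ?thesis unfolding step_def by (intro continuous_intros c)
qed

text \<open>The Cholesky series makes the limit the one found in \<open>bsum_lincomb_clt\<close>, so
  that \<open>expectation_diff_of_char_tendsto\<close> applies to the grid values.\<close>

lemma gproc_char_tendsto:
  assumes "strict_mono r"
  shows "(\<lambda>n. \<integral>\<omega>. iexp (\<Sum>j<d. u j * gproc (r n) \<omega> (t j)) \<partial>gauss_seq)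
    \<longlonglongrightarrow> complex_of_real (exp (- (\<Sum>i<d. \<Sum>j<d. u i * u j * Kern (t i) (t j)) / 2))"
proof -
  define b where "b m = (\<Sum>j<d. u j * chol m (t j))" for m
  have "(\<Sum>j<d. u j * gproc n \<omega> (t j)) = (\<Sum>m<n. b m * \<omega> m)" for n \<omega>
    unfolding gproc_def b_def sum_distrib_left sum_distrib_right by (subst sum.swap) (simp add: mult_ac)
  then have e: "(\<integral>\<omega>. iexp (\<Sum>j<d. u j * gproc n \<omega> (t j)) \<partial>gauss_seq) = complex_of_real (exp (- (\<Sum>m<n. (b m)\<^sup>2) / 2))" for n
    using gauss_seq_char[of b n] by (simp only:)
  have "(\<Sum>m<n. (b m)\<^sup>2) = (\<Sum>i<d. \<Sum>j<d. u i * u j * (\<Sum>m<n. chol m (t i) * chol m (t j)))" for n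
  proof -
    have "(\<Sum>m<n. (b m)\<^sup>2) = (\<Sum>m<n. \<Sum>i<d. \<Sum>j<d. u i * u j * (chol m (t i) * chol m (t j)))"
      unfolding b_def power2_eq_square sum_product by (intro sum.cong refl) (simp add: mult_ac)
    also have "\<dots> = (\<Sum>i<d. \<Sum>m<n. \<Sum>j<d. u i * u j * (chol m (t i) * chol m (t j)))" by (rule sum.swap)
    also have "\<dots> = (\<Sum>i<d. \<Sum>j<d. \<Sum>m<n. u i * u j * (chol m (t i) * chol m (t j)))"
      by (intro sum.cong refl sum.swap)
    finally show ?thesis by (simp add: sum_distrib_left)
  qed
  moreover have "(\<lambda>n. \<Sum>i<d. \<Sum>j<d. u i * u j * (\<Sum>m<n. chol m (t i) * chol m (t j))) \<longlonglongrightarrow> (\<Sum>i<d. \<Sum>j<d. u i * u j * Kern (t i) (t j))"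
    by (intro tendsto_intros) (use chol_sums in \<open>auto simp: sums_def\<close>)
  ultimately have "(\<lambda>n. \<Sum>m<n. (b m)\<^sup>2) \<longlonglongrightarrow> (\<Sum>i<d. \<Sum>j<d. u i * u j * Kern (t i) (t j))" by simp
  note l = LIMSEQ_subseq_LIMSEQ[OF this assms, unfolded comp_def]
  show ?thesis unfolding e by (intro tendsto_intros l) simp
qed

text \<open>A grid is fixed on which both sampling errors are below \<open>e / 3\<close> for every
  index; only then does \<open>n\<close> grow, and the grid values are compared through their
  characteristic functions.\<close>

lemma expectation_diff_tendsto:
  assumes h: "\<And>x y :: l1. \<bar>h x - h y\<bar> \<le> L * dist x y" "\<And>x. \<bar>h x\<bar> \<le> K" and r: "strict_mono r"
  shows "(\<lambda>n. (\<integral>y. h (l1_class (bproc n y)) \<partial>P) - (\<integral>\<omega>. h (gser (r n) \<omega>) \<partial>gauss_seq)) \<longlonglongrightarrow> 0"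
proof (rule LIMSEQ_I)
  fix e :: real assume e: "e > 0"
  define L' where "L' = \<bar>L\<bar>"
  have L': "0 \<le> L'" by (simp add: L'_def)
  have hL: "\<bar>h x - h y\<bar> \<le> L' * dist x y" for x y
    using h(1)[of x y] mult_right_mono[OF abs_ge_self[of L], of "dist x y"] by (simp add: L'_def)
  have hc: "continuous_on UNIV h" by (rule continuous_on_of_dist_le[OF h(1)])
  have hb: "h \<in> borel_measurable borel" by (rule borel_measurable_continuous_onI[OF hc])
  have "(\<lambda>k. L' * (\<integral>t. step_err k t \<partial>lborel)) \<longlonglongrightarrow> L' * 0" by (intro tendsto_intros step_err_tendsto)
  then have "eventually (\<lambda>k. L' * (\<integral>t. step_err k t \<partial>lborel) < e / 3) sequentially"
    using e by (intro order_tendstoD(2)[where a="e/3"]) auto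
  then obtain k where k: "L' * (\<integral>t. step_err k t \<partial>lborel) < e / 3"
    using eventually_happens trivial_limit_sequentially by blast
  let ?d = "2 * k * 2 ^ k :: nat"
  have hs: "continuous_on UNIV (\<lambda>x. h (step k x))"
    by (rule continuous_on_compose2[OF hc continuous_step]) simp
  have hsb: "(\<lambda>x. h (step k x)) \<in> borel_measurable borel" by (rule borel_measurable_continuous_onI[OF hs])
  have Vm: "(\<lambda>y. bproc n y t) \<in> borel_measurable P" for n t
    unfolding bproc_def using bsum_meas[OF ev_measurable] by measurable
  have Um: "(\<lambda>\<omega>. gproc n \<omega> t) \<in> borel_measurable gauss_seq" for n t
    unfolding gproc_def by (intro borel_measurable_sum borel_measurable_times gauss_seq_coord) simp
  have wt1: "(sqk t)\<^sup>2 \<le> cst" for t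
    using wt_nonneg[of t] wt_le_one[of t] cst_ge power_mono[of "wt t" 1 2]
    by (simp add: sqk_def power_mult_distrib mult_left_le)
  have "(\<lambda>n. (\<integral>y. h (step k (\<lambda>j. bproc n y (node k j))) \<partial>P) - (\<integral>\<omega>. h (step k (\<lambda>j. gproc (r n) \<omega> (node k j))) \<partial>gauss_seq)) \<longlonglongrightarrow> 0"
  proof (rule expectation_diff_of_char_tendsto[where d="?d" and c=cst and K=K and h="\<lambda>x. h (step k x)"
      and V="\<lambda>n y j. bproc n y (node k j)" and U="\<lambda>n \<omega> j. gproc (r n) \<omega> (node k j)"])
    show "prob_space P" by unfold_locales
    show "prob_space gauss_seq" by (rule prob_space_gauss_seq)
    show "(\<lambda>y. bproc n y (node k j)) \<in> borel_measurable P" for n j by (rule Vm)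
    show "(\<lambda>\<omega>. gproc (r n) \<omega> (node k j)) \<in> borel_measurable gauss_seq" for n j by (rule Um)
    show "integrable P (\<lambda>y. (bproc n y (node k j))\<^sup>2) \<and> (\<integral>y. (bproc n y (node k j))\<^sup>2 \<partial>P) \<le> cst" for n j
      using bproc_moments(1,2)[where n=n and t="node k j"] wt1[of "node k j"] by simp
    show "integrable gauss_seq (\<lambda>\<omega>. (gproc (r n) \<omega> (node k j))\<^sup>2) \<and> (\<integral>\<omega>. (gproc (r n) \<omega> (node k j))\<^sup>2 \<partial>gauss_seq) \<le> cst" for n j
      using gproc_moments(1,2)[where n="r n" and t="node k j"] wt1[of "node k j"] by simp
    show "(\<lambda>n. \<integral>y. iexp (\<Sum>j<?d. u j * bproc n y (node k j)) \<partial>P)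
      \<longlonglongrightarrow> complex_of_real (exp (- (\<Sum>i<?d. \<Sum>j<?d. u i * u j * Kern (node k i) (node k j)) / 2))" for u
      unfolding bproc_def by (rule bsum_lincomb_clt) simp
    show "(\<lambda>n. \<integral>\<omega>. iexp (\<Sum>j<?d. u j * gproc (r n) \<omega> (node k j)) \<partial>gauss_seq)
      \<longlonglongrightarrow> complex_of_real (exp (- (\<Sum>i<?d. \<Sum>j<?d. u i * u j * Kern (node k i) (node k j)) / 2))" for u
      by (rule gproc_char_tendsto[OF r])
    show "continuous_on UNIV (\<lambda>x. h (step k x))" by (rule hs)
    show "\<bar>h (step k x)\<bar> \<le> K" for x by (rule h(2))
    show "h (step k x) = h (step k (\<lambda>j. if j < ?d then x j else 0))" for x
      unfolding step_def by (intro arg_cong[of _ _ h] sum.cong) auto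
  qed
  from LIMSEQ_D[OF this, of "e / 3"] e obtain n0 where n0: "\<And>n. n \<ge> n0 \<Longrightarrow>
    \<bar>(\<integral>y. h (step k (\<lambda>j. bproc n y (node k j))) \<partial>P) - (\<integral>\<omega>. h (step k (\<lambda>j. gproc (r n) \<omega> (node k j))) \<partial>gauss_seq)\<bar> < e / 3"
    by auto
  have aV: "\<bar>(\<integral>y. h (l1_class (bproc n y)) \<partial>P) - (\<integral>y. h (step k (\<lambda>j. bproc n y (node k j))) \<partial>P)\<bar> \<le> L' * (\<integral>t. step_err k t \<partial>lborel)" for n
  proof (rule step_approx[OF _ bproc_measurable2 bproc_integrable bproc_moments hL h(2) L'])
    show "prob_space P" by unfold_locales
    show "(\<lambda>y. h (l1_class (bproc n y))) \<in> borel_measurable P" by (rule measurable_compose[OF bproc_class_measurable hb])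
    show "(\<lambda>y. h (step k (\<lambda>j. bproc n y (node k j)))) \<in> borel_measurable P"
      by (rule measurable_compose[OF measurable_coordinatewise_then_product hsb]) (rule Vm)
  qed
  have gs: "gser n \<omega> = l1_class (gproc n \<omega>)" for n \<omega> by (simp add: gser_eq gproc_def[abs_def])
  have aU: "\<bar>(\<integral>\<omega>. h (gser n \<omega>) \<partial>gauss_seq) - (\<integral>\<omega>. h (step k (\<lambda>j. gproc n \<omega> (node k j))) \<partial>gauss_seq)\<bar> \<le> L' * (\<integral>t. step_err k t \<partial>lborel)" for n
    unfolding gs
  proof (rule step_approx[OF prob_space_gauss_seq gproc_measurable2 _ gproc_moments hL h(2) L'])
    show "integrable lborel (gproc n \<omega>)" for \<omega> unfolding gproc_def[abs_def] using chol_integrable by simp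
    show "(\<lambda>\<omega>. h (l1_class (gproc n \<omega>))) \<in> borel_measurable gauss_seq"
      using measurable_compose[OF gser_measurable hb] by (simp only: gs)
    show "(\<lambda>\<omega>. h (step k (\<lambda>j. gproc n \<omega> (node k j)))) \<in> borel_measurable gauss_seq"
      by (rule measurable_compose[OF measurable_coordinatewise_then_product hsb]) (rule Um)
  qed
  have "norm ((\<integral>y. h (l1_class (bproc n y)) \<partial>P) - (\<integral>\<omega>. h (gser (r n) \<omega>) \<partial>gauss_seq) - 0) < e" if "n \<ge> n0" for n
    using aV[of n] aU[of "r n"] n0[OF that] k unfolding real_norm_def by linarith
  then show "\<exists>n0. \<forall>n\<ge>n0. norm ((\<integral>y. h (l1_class (bproc n y)) \<partial>P) - (\<integral>\<omega>. h (gser (r n) \<omega>) \<partial>gauss_seq) - 0) < e" by blast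
qed

theorem path_limit:
  obtains \<mu> :: "l1 measure" where "centered_gaussian_law \<mu>"
    "\<And>f g. f \<in> Linfty \<Longrightarrow> g \<in> Linfty \<Longrightarrow> (\<integral>x. Linfty_act f x * Linfty_act g x \<partial>\<mu>) = Phi_sym P coord f g"
    "\<And>h L K. (\<And>x y. \<bar>h x - h y\<bar> \<le> L * dist x y) \<Longrightarrow> (\<And>x. \<bar>h x\<bar> \<le> K) \<Longrightarrow>
      (\<lambda>n. \<integral>y. h (l1_class (fproc n y)) \<partial>P) \<longlonglongrightarrow> (\<integral>x. (h x :: real) \<partial>\<mu>)"
proof (rule gaussian_limit)
  fix r :: "nat \<Rightarrow> nat" and \<mu> :: "l1 measure"
  assume r: "strict_mono r" and cg: "centered_gaussian_law \<mu>"
    and i2: "\<And>\<phi> :: l1 \<Rightarrow> real. bounded_linear \<phi> \<Longrightarrow> integrable \<mu> (\<lambda>x. (\<phi> x)\<^sup>2)"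
    and e2: "\<And>\<phi> :: l1 \<Rightarrow> real. bounded_linear \<phi> \<Longrightarrow> (\<integral>x. (\<phi> x)\<^sup>2 \<partial>\<mu>) = (\<Sum>m. (\<phi> (l1_class (chol m)))\<^sup>2)"
    and lim: "\<And>h K. continuous_on UNIV h \<Longrightarrow> (\<And>x. \<bar>h x\<bar> \<le> K) \<Longrightarrow>
      (\<lambda>k. \<integral>\<omega>. h (gser (r k) \<omega>) \<partial>gauss_seq) \<longlonglongrightarrow> (\<integral>x. (h x :: real) \<partial>\<mu>)"
  show thesis
  proof (rule that[OF cg])
    fix f g assume f: "f \<in> Linfty" and g: "g \<in> Linfty"
    let ?f = "Linfty_act f" and ?g = "Linfty_act g"
    define a where "a m = ?f (l1_class (chol m))" for m
    define b where "b m = ?g (l1_class (chol m))" for m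
    note bf = bounded_linear_Linfty_act[OF f] and bg = bounded_linear_Linfty_act[OF g]
    note bfg = bounded_linear_add[OF bf bg]
    have s: "summable (\<lambda>m. (a m)\<^sup>2)" "summable (\<lambda>m. (b m)\<^sup>2)" "summable (\<lambda>m. (a m + b m)\<^sup>2)"
      using functional_chol_summable[OF bf] functional_chol_summable[OF bg] functional_chol_summable[OF bfg]
      by (simp_all add: a_def b_def)
    \<comment> \<open>Polarization: second moments are known for single functionals, and the sum of
      the two is again a bounded functional.\<close>
    have "(\<integral>x. ?f x * ?g x \<partial>\<mu>) = (\<integral>x. ((?f x + ?g x)\<^sup>2 - (?f x)\<^sup>2 - (?g x)\<^sup>2) / 2 \<partial>\<mu>)"
      by (intro Bochner_Integration.integral_cong refl) (simp add: power2_sum)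
    also have "\<dots> = ((\<Sum>m. (a m + b m)\<^sup>2) - (\<Sum>m. (a m)\<^sup>2) - (\<Sum>m. (b m)\<^sup>2)) / 2"
      using i2[OF bf] i2[OF bg] i2[OF bfg] e2[OF bf] e2[OF bg] e2[OF bfg] by (simp add: a_def b_def)
    also have "\<dots> = (\<Sum>m. a m * b m)"
    proof -
      have "(\<lambda>m. ((a m + b m)\<^sup>2 - (a m)\<^sup>2 - (b m)\<^sup>2) / 2) sums (((\<Sum>m. (a m + b m)\<^sup>2) - (\<Sum>m. (a m)\<^sup>2) - (\<Sum>m. (b m)\<^sup>2)) / 2)"
        by (intro sums_divide sums_diff summable_sums s)
      moreover have "((a m + b m)\<^sup>2 - (a m)\<^sup>2 - (b m)\<^sup>2) / 2 = a m * b m" for m by (simp add: power2_sum)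
      ultimately show ?thesis by (simp add: sums_iff)
    qed
    also have "\<dots> = Phi_sym P coord f g"
      using Phi_sym_eq[OF f g] by (simp add: sums_iff a_def b_def Linfty_act_class f g chol_integrable)
    finally show "(\<integral>x. ?f x * ?g x \<partial>\<mu>) = Phi_sym P coord f g" .
  next
    fix h :: "l1 \<Rightarrow> real" and L K
    assume h: "\<And>x y. \<bar>h x - h y\<bar> \<le> L * dist x y" "\<And>x. \<bar>h x\<bar> \<le> K"
    have hc: "continuous_on UNIV h" by (rule continuous_on_of_dist_le[OF h(1)])
    have "(\<lambda>n. ((\<integral>y. h (l1_class (bproc n y)) \<partial>P) - (\<integral>\<omega>. h (gser (r n) \<omega>) \<partial>gauss_seq)) + (\<integral>\<omega>. h (gser (r n) \<omega>) \<partial>gauss_seq))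
      \<longlonglongrightarrow> 0 + (\<integral>x. h x \<partial>\<mu>)"
      by (rule tendsto_add[OF expectation_diff_tendsto[OF h r] lim[OF hc h(2)]])
    then show "(\<lambda>n. \<integral>y. h (l1_class (fproc n y)) \<partial>P) \<longlonglongrightarrow> (\<integral>x. h x \<partial>\<mu>)"
      by (simp add: expectation_fproc[OF borel_measurable_continuous_onI[OF hc]])
  qed
qed

end

section \<open>From the process to its law on the path space\<close>

lemma phi_coeff_AE:
  fixes M :: "'a measure"
  assumes M: "prob_space M" and Y: "\<And>i. Y i \<in> borel_measurable M"
  shows "0 \<le> phi_coeff M Y k"
    and "AE \<omega> in M. \<bar>real_cond_exp M (past M Y) (indicat_real {\<omega>' \<in> space M. Y (int k) \<omega>' \<le> t}) \<omega>
       - measure M {\<omega>' \<in> space M. Y (int k) \<omega>' \<le> t}\<bar> \<le> phi_coeff M Y k"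
proof -
  interpret prob_space M by fact
  note [measurable] = Y
  have sub: "subalgebra M (past M Y)" by (rule subalgebra_past) measurable
  interpret past: finite_measure_subalgebra M "past M Y" by unfold_locales (rule sub)
  define A where "A t = {\<omega>' \<in> space M. Y (int k) \<omega>' \<le> t}" for t
  define R where "R t = real_cond_exp M (past M Y) (indicat_real (A t))" for t
  define D where "D t \<omega> = ereal \<bar>R t \<omega> - prob (A t)\<bar>" for t \<omega>
  have [measurable]: "A t \<in> sets M" for t unfolding A_def by measurable
  have [measurable]: "R t \<in> borel_measurable M" for t
    unfolding R_def by measurable
  have Dm: "D t \<in> borel_measurable M" for t unfolding D_def by measurable
  have i: "integrable M (indicat_real (A t))" for t by (simp add: integrable_indicator_iff less_top[symmetric])
  have D1: "AE \<omega> in M. D t \<omega> \<le> 1" for t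
  proof -
    have "AE \<omega> in M. R t \<omega> \<ge> 0" unfolding R_def by (rule past.real_cond_exp_pos) (auto simp: i)
    moreover have "AE \<omega> in M. R t \<omega> \<le> 1" unfolding R_def
      by (rule past.real_cond_exp_le_c[OF i]) (auto simp: indicator_def)
    ultimately show ?thesis
    proof eventually_elim
      case (elim \<omega>)
      moreover have "0 \<le> prob (A t)" "prob (A t) \<le> 1" by auto
      ultimately have "\<bar>R t \<omega> - prob (A t)\<bar> \<le> 1" by linarith
      then show ?case by (simp add: D_def one_ereal_def)
    qed
  qed
  define S where "S = (SUP t. esssup M (D t))"
  \<comment> \<open>\<open>real_of_ereal\<close> returns zero at infinite values, so the supremum
    has to be placed between \<open>0\<close> and \<open>1\<close> before its real value can serve
    as a bound.\<close>
  have S1: "S \<le> 1" unfolding S_def by (intro SUP_least esssup_I Dm D1)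
  have DS: "AE \<omega> in M. D t \<omega> \<le> S" for t
  proof -
    have "esssup M (D t) \<le> S" unfolding S_def by (rule SUP_upper) simp
    then show ?thesis using esssup_AE[of "D t" M] by (auto elim!: eventually_mono)
  qed
  \<comment> \<open>A probability space is not null, so an almost sure bound holds at some point,
    which rules out a negative supremum.\<close>
  have "\<exists>\<omega>. D 0 \<omega> \<le> S"
    using DS[of 0] by (metis (mono_tags, lifting) AE_False eventually_mono prob_space_axioms)
  then have S0: "0 \<le> S" by (auto simp: D_def intro: order_trans[of 0 "ereal \<bar>_\<bar>"])
  have phi: "phi_coeff M Y k = real_of_ereal S"
    unfolding phi_coeff_def S_def D_def R_def A_def ..
  have Sr: "ereal (phi_coeff M Y k) = S"
    unfolding phi using S0 S1 by (cases S) (auto simp: one_ereal_def zero_ereal_def)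
  show "0 \<le> phi_coeff M Y k" using S0 Sr by (metis ereal_less_eq(3) zero_ereal_def)
  show "AE \<omega> in M. \<bar>real_cond_exp M (past M Y) (indicat_real {\<omega>' \<in> space M. Y (int k) \<omega>' \<le> t}) \<omega>
       - measure M {\<omega>' \<in> space M. Y (int k) \<omega>' \<le> t}\<bar> \<le> phi_coeff M Y k"
    using DS[of t] unfolding D_def Sr[symmetric] R_def A_def by simp
qed

text \<open>A weight from the past can be paired with the conditional probability in place of the
  indicator, and then the almost sure bound applies under the integral.\<close>

lemma phi_coeff_mixing:
  fixes M :: "'a measure"
  assumes M: "prob_space M" and Y: "\<And>i. Y i \<in> borel_measurable M"
    and W: "W \<in> borel_measurable (past M Y)" "\<And>\<omega>. \<bar>W \<omega>\<bar> \<le> K"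
  shows "\<bar>\<integral>\<omega>. W \<omega> * (indicator {..t} (Y (int k) \<omega>) - measure M {\<omega> \<in> space M. Y (int k) \<omega> \<le> t}) \<partial>M\<bar>
    \<le> phi_coeff M Y k * (\<integral>\<omega>. \<bar>W \<omega>\<bar> \<partial>M)"
proof -
  interpret prob_space M by fact
  note [measurable] = Y
  have sub: "subalgebra M (past M Y)" by (rule subalgebra_past) measurable
  interpret past: finite_measure_subalgebra M "past M Y" by unfold_locales (rule sub)
  define A where "A = {\<omega> \<in> space M. Y (int k) \<omega> \<le> t}"
  define R where "R = real_cond_exp M (past M Y) (indicat_real A)"
  have [measurable]: "A \<in> sets M" unfolding A_def by measurable
  have Wm [measurable]: "W \<in> borel_measurable M" by (rule measurable_from_subalg[OF sub W(1)])
  have iW: "integrable M W" by (rule integrable_const_bound[of _ K]) (use W in auto)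
  have iWA: "integrable M (\<lambda>\<omega>. W \<omega> * indicat_real A \<omega>)"
    by (rule Bochner_Integration.integrable_bound[OF iW]) (auto simp: indicator_def)
  note R = past.real_cond_exp_intg[OF iWA W(1), folded R_def]
  have "(\<integral>\<omega>. W \<omega> * (indicator {..t} (Y (int k) \<omega>) - prob A) \<partial>M) = (\<integral>\<omega>. W \<omega> * indicat_real A \<omega> - W \<omega> * prob A \<partial>M)"
    by (intro Bochner_Integration.integral_cong refl) (simp add: A_def indicator_def algebra_simps)
  also have "\<dots> = (\<integral>\<omega>. W \<omega> * (R \<omega> - prob A) \<partial>M)"
    using iWA iW R by (simp add: right_diff_distrib)
  also have "\<bar>\<dots>\<bar> \<le> (\<integral>\<omega>. \<bar>W \<omega> * (R \<omega> - prob A)\<bar> \<partial>M)" by (rule integral_abs_bound)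
  also have "\<dots> \<le> (\<integral>\<omega>. phi_coeff M Y k * \<bar>W \<omega>\<bar> \<partial>M)"
  proof (rule integral_mono_AE)
    show "integrable M (\<lambda>\<omega>. \<bar>W \<omega> * (R \<omega> - prob A)\<bar>)" using R(1) iW by (simp add: right_diff_distrib)
    show "AE \<omega> in M. \<bar>W \<omega> * (R \<omega> - prob A)\<bar> \<le> phi_coeff M Y k * \<bar>W \<omega>\<bar>"
      using phi_coeff_AE(2)[where M=M and Y=Y and k=k and t=t, OF M Y]
    proof eventually_elim
      case (elim \<omega>)
      then have "\<bar>W \<omega>\<bar> * \<bar>R \<omega> - prob A\<bar> \<le> \<bar>W \<omega>\<bar> * phi_coeff M Y k"
        unfolding R_def A_def by (intro mult_left_mono) auto
      then show ?case by (simp add: abs_mult mult.commute)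
    qed
  qed (use iW in auto)
  finally show ?thesis by (simp add: A_def)
qed

definition path_of :: "(int \<Rightarrow> 'a \<Rightarrow> real) \<Rightarrow> 'a \<Rightarrow> int \<Rightarrow> real" where
  "path_of Y \<omega> = (\<lambda>i. Y i \<omega>)"

lemma path_of_measurable:
  assumes "\<And>i. Y i \<in> borel_measurable M"
  shows "path_of Y \<in> measurable M path_space"
  unfolding path_of_def[abs_def] using assms by (intro measurable_PiM_single') (auto simp: space_PiM)

locale phi_mixing_process = prob_space M for M :: "'a measure" +
  fixes Y :: "int \<Rightarrow> 'a \<Rightarrow> real"
  assumes Y_meas: "\<And>i. Y i \<in> borel_measurable M"
    and stat: "stationary M Y" and erg: "ergodic M Y"
    and phi_summable: "summable (\<lambda>k. sqrt (phi_coeff M Y (Suc k) / real (Suc k)))"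
    and tail_integrable: "set_integrable lborel {0..} (\<lambda>t. sqrt (measure M {\<omega> \<in> space M. \<bar>Y 0 \<omega>\<bar> > t}))"
begin

section \<open>The law of the process on the path space\<close>

definition path_law :: "(int \<Rightarrow> real) measure" where
  "path_law = distr M path_space (path_of Y)"

lemma path_meas: "path_of Y \<in> measurable M path_space"
  by (rule path_of_measurable[OF Y_meas])

lemma sets_path_law: "sets path_law = sets path_space" by (simp add: path_law_def)

lemma prob_path_law: "prob_space path_law"
  unfolding path_law_def by (rule prob_space_distr[OF path_meas])

lemma integral_path_law:
  fixes f :: "(int \<Rightarrow> real) \<Rightarrow> 'c::{banach, second_countable_topology}"
  assumes "f \<in> borel_measurable path_law"
  shows "(\<integral>y. f y \<partial>path_law) = (\<integral>\<omega>. f (path_of Y \<omega>) \<partial>M)"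
proof -
  have "f \<in> borel_measurable path_space" using assms by (simp cong: measurable_cong_sets add: sets_path_law)
  then show ?thesis unfolding path_law_def by (rule integral_distr[OF path_meas])
qed

lemma measure_path_law:
  assumes "A \<in> sets path_space"
  shows "measure path_law A = prob {\<omega> \<in> space M. path_of Y \<omega> \<in> A}"
  unfolding path_law_def measure_distr[OF path_meas assms] by (rule arg_cong[of _ _ prob]) auto

lemma distr_fun_path_law: "distr_fun path_law coord = distr_fun M Y"
proof -
  have "coord 0 \<in> borel_measurable path_space" by simp
  then have "distr path_law borel (coord 0) = distr M borel (coord 0 \<circ> path_of Y)"
    unfolding path_law_def by (rule distr_distr[OF _ path_meas])
  then show ?thesis by (simp add: distr_fun_def path_of_def comp_def)
qed

lemma lag_cov_path_law: "lag_cov path_law coord k s t = lag_cov M Y k s t"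
proof -
  have "{y \<in> space path_space. y 0 \<le> t \<and> y (int k) \<le> s} \<in> sets path_space" by measurable
  then have "{y. y 0 \<le> t \<and> y (int k) \<le> s} \<in> sets path_space" by (simp add: space_PiM)
  from measure_path_law[OF this] show ?thesis
    by (simp add: lag_cov_def distr_fun_path_law path_of_def space_path[OF sets_path_law])
qed

lemma Phi_path_law:
  "Phi_integrand path_law coord = Phi_integrand M Y" "Phi_sym path_law coord = Phi_sym M Y"
proof -
  have C: "C_kernel path_law coord = C_kernel M Y"
    by (intro ext) (simp add: C_kernel_def distr_fun_path_law lag_cov_path_law)
  show P: "Phi_integrand path_law coord = Phi_integrand M Y"
    by (intro ext) (simp add: Phi_integrand_def C)
  show "Phi_sym path_law coord = Phi_sym M Y"
    by (intro ext) (simp add: Phi_sym_def Phi_def P)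
qed

text \<open>\<open>stationary\<close> speaks of the forward shift; the backward shift is its inverse
  and therefore preserves the law as well.\<close>

lemma bshift_pres_path_law: "distr path_law path_law bshift = path_law"
proof -
  define fw where "fw y = (\<lambda>i. y (i + 1))" for y :: "int \<Rightarrow> real"
  have fm: "fw \<in> measurable path_space path_space"
    unfolding fw_def[abs_def] by (intro measurable_PiM_single') (auto simp: space_PiM)
  have bm: "bshift \<in> measurable path_space path_space" by (rule measurable_bshift) simp
  have "distr M path_space (fw \<circ> path_of Y) = path_law"
    using stat unfolding stationary_def path_law_def path_of_def[abs_def] fw_def comp_def by simp
  then have fw: "distr path_law path_space fw = path_law"
    unfolding path_law_def by (simp add: distr_distr[OF fm path_meas])
  have "bshift \<circ> fw = (\<lambda>y. y)" by (auto simp: bshift_def fw_def fun_eq_iff)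
  then have "distr (distr path_law path_space fw) path_space bshift = distr path_law path_space (\<lambda>y. y)"
    using fm by (subst distr_distr[OF bm]) (auto cong: measurable_cong_sets simp: sets_path_law)
  also have "\<dots> = path_law" by (rule distr_id2) (simp add: sets_path_law)
  finally have "distr path_law path_space bshift = path_law" by (simp only: fw)
  moreover have "distr path_law path_law bshift = distr path_law path_space bshift"
    by (rule distr_cong) (auto simp: sets_path_law)
  ultimately show ?thesis by simp
qed

text \<open>The two shifts are inverse to each other and so have the same invariant sets.\<close>

lemma bshift_erg_path_law:
  assumes A: "A \<in> sets path_law" "bshift -` A = A"
  shows "measure path_law A = 0 \<or> measure path_law A = 1"
proof -
  have "(\<lambda>y i. y (i + 1)) -` A = (\<lambda>y i. y (i + 1)) -` (bshift -` A)" by (simp only: A(2))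
  also have "\<dots> = A" by (auto simp: bshift_def)
  finally have "(\<lambda>y i. y (i + 1)) -` A = A" .
  then have "prob {\<omega> \<in> space M. (\<lambda>i. Y i \<omega>) \<in> A} \<in> {0, 1}"
    using erg A(1) unfolding ergodic_def sets_path_law by blast
  then show ?thesis
    using A(1) measure_path_law[of A] by (simp add: sets_path_law path_of_def)
qed

text \<open>A shift by \<open>k - j\<close> moves the weight further into the past, where it stays
  measurable, so the coefficient of a smaller lag also controls the larger lag. This is what admits
  a running minimum as the rate.\<close>

lemma mixing_path_law:
  assumes W: "W \<in> borel_measurable (past path_law coord)" "\<And>y. \<bar>W y\<bar> \<le> K" and jk: "j \<le> k"
  shows "\<bar>\<integral>y. W y * (indicator {..t} (y (int k)) - distr_fun path_law coord t) \<partial>path_law\<bar>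
    \<le> phi_coeff M Y j * (\<integral>y. \<bar>W y\<bar> \<partial>path_law)"
proof -
  interpret P: prob_space path_law by (rule prob_path_law)
  have cm [measurable]: "coord i \<in> borel_measurable path_law" for i by (rule measurable_coord[OF sets_path_law])
  interpret E: ergodic_system path_law bshift
    by unfold_locales (use measurable_bshift[OF sets_path_law] bshift_pres_path_law bshift_erg_path_law
      space_path[OF sets_path_law] in auto)
  have sub: "subalgebra path_law (past path_law coord)" by (rule subalgebra_past) (rule cm)
  have bF: "bshift \<in> measurable (past path_law coord) (past path_law coord)"
  proof (rule measurable_pastI)
    fix i :: int assume "i \<le> 0"
    then show "(\<lambda>y. bshift y i) \<in> borel_measurable (past path_law coord)"
      unfolding bshift_def using measurable_past[of "i - 1" coord path_law] by simp
  qed (simp add: space_path[OF sets_path_law])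
  have bFn: "(bshift ^^ n) \<in> measurable (past path_law coord) (past path_law coord)" for n
    by (induction n) (auto intro: measurable_compose[OF _ bF])
  define V where "V y = W ((bshift ^^ (k - j)) y)" for y
  have V: "V \<in> borel_measurable (past path_law coord)" "\<And>y. \<bar>V y\<bar> \<le> K"
    unfolding V_def using measurable_compose[OF bFn W(1)] W(2) by auto
  have Wm [measurable]: "W \<in> borel_measurable path_law" and Vm [measurable]: "V \<in> borel_measurable path_law"
    by (rule measurable_from_subalg[OF sub W(1)], rule measurable_from_subalg[OF sub V(1)])
  have F0: "distr_fun path_law coord t = prob {\<omega> \<in> space M. Y (int j) \<omega> \<le> t}"
  proof -
    have s: "{y. y i \<le> t} \<in> sets path_space" for i :: int
    proof -
      have "{y \<in> space path_space. y i \<le> t} \<in> sets path_space" by measurable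
      then show ?thesis by (simp add: space_PiM)
    qed
    then have s': "{y. y i \<le> t} \<in> sets path_law" for i :: int by (simp add: sets_path_law)
    have "distr_fun path_law coord t = measure path_law {y. y 0 \<le> t}"
      unfolding distr_fun_def cdf_def by (subst measure_distr) (auto simp: vimage_def space_path[OF sets_path_law])
    also have "\<dots> = (\<integral>y. indicat_real {y. y 0 \<le> t} y \<partial>path_law)" using s' by simp
    also have "\<dots> = (\<integral>y. indicat_real {y. y (int j) \<le> t} y \<partial>path_law)"
      using E.integral_B_pow[of "indicat_real {y. y (int j) \<le> t}" j] s' by (simp add: bshift_pow indicator_def)
    also have "\<dots> = measure path_law {y. y (int j) \<le> t}" using s' by simp
    finally show ?thesis using measure_path_law[OF s] by (simp add: path_of_def)
  qed
  have "(\<integral>y. W y * (indicator {..t} (y (int k)) - distr_fun path_law coord t) \<partial>path_law)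
    = (\<integral>y. V y * (indicator {..t} (y (int j)) - distr_fun path_law coord t) \<partial>path_law)"
  proof -
    have m: "(\<lambda>y. W y * (indicator {..t} (y (int k)) - distr_fun path_law coord t)) \<in> borel_measurable path_law"
      by measurable
    have "int k - int (k - j) = int j" using jk by simp
    then show ?thesis using E.integral_B_pow[OF m, of "k - j"] unfolding V_def bshift_pow by simp
  qed
  also have "\<dots> = (\<integral>\<omega>. V (path_of Y \<omega>) * (indicator {..t} (Y (int j) \<omega>) - distr_fun path_law coord t) \<partial>M)"
    by (subst integral_path_law) (measurable, simp add: path_of_def)
  also have "\<bar>\<dots>\<bar> \<le> phi_coeff M Y j * (\<integral>\<omega>. \<bar>V (path_of Y \<omega>)\<bar> \<partial>M)"
    unfolding F0
  proof (rule phi_coeff_mixing[OF prob_space_axioms Y_meas])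
    have "path_of Y \<in> measurable (past M Y) (past path_law coord)"
      by (rule measurable_pastI) (auto simp: path_of_def space_path[OF sets_path_law] measurable_past)
    then show "(\<lambda>\<omega>. V (path_of Y \<omega>)) \<in> borel_measurable (past M Y)"
      by (rule measurable_compose[OF _ V(1)])
    show "\<bar>V (path_of Y \<omega>)\<bar> \<le> K" for \<omega> by (rule V(2))
  qed
  also have "(\<integral>\<omega>. \<bar>V (path_of Y \<omega>)\<bar> \<partial>M) = (\<integral>y. \<bar>V y\<bar> \<partial>path_law)"
    by (subst integral_path_law) auto
  also have "\<dots> = (\<integral>y. \<bar>W y\<bar> \<partial>path_law)"
    unfolding V_def by (rule E.integral_B_pow[of "\<lambda>y. \<bar>W y\<bar>"]) measurable
  finally show ?thesis .
qed

text \<open>The running minimum replaces \<open>phi_coeff\<close> by a coefficient that is evidently monotone.\<close>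

definition min_phi :: "nat \<Rightarrow> real" where
  "min_phi k = (if k = 0 then 0 else Min (phi_coeff M Y ` {1..k}))"

lemma min_phi_nonneg: "0 \<le> min_phi k"
  unfolding min_phi_def using phi_coeff_AE(1)[OF prob_space_axioms Y_meas] by auto

lemma min_phi_le: "1 \<le> k \<Longrightarrow> min_phi k \<le> phi_coeff M Y k"
  unfolding min_phi_def by (auto intro!: Min_le)

sublocale path: mixing_path_tail path_law min_phi
proof -
  interpret P: prob_space path_law by (rule prob_path_law)
  show "mixing_path_tail path_law min_phi"
  proof
    show "sets path_law = sets path_space" by (rule sets_path_law)
    show "distr path_law path_law bshift = path_law" by (rule bshift_pres_path_law)
    show "A \<in> sets path_law \<Longrightarrow> bshift -` A = A \<Longrightarrow> P.prob A = 0 \<or> P.prob A = 1" for A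
      by (rule bshift_erg_path_law)
    show "0 \<le> min_phi k" for k by (rule min_phi_nonneg)
    show "min_phi k \<le> min_phi j" if "1 \<le> j" "j \<le> k" for j k
      unfolding min_phi_def using that by (auto intro!: Min_antimono image_mono)
    show "summable (\<lambda>k. sqrt (min_phi (Suc k) / real (Suc k)))"
    proof (rule summable_comparison_test'[OF phi_summable, of 0])
      fix k
      have "sqrt (min_phi (Suc k) / real (Suc k)) \<le> sqrt (phi_coeff M Y (Suc k) / real (Suc k))"
        using min_phi_le[of "Suc k"] by (intro real_sqrt_le_mono divide_right_mono) auto
      then show "norm (sqrt (min_phi (Suc k) / real (Suc k))) \<le> sqrt (phi_coeff M Y (Suc k) / real (Suc k))"
        using min_phi_nonneg[of "Suc k"] by simp
    qed
    show "\<bar>\<integral>y. W y * (indicator {..t} (y (int k)) - distr_fun path_law coord t) \<partial>path_law\<bar> \<le> min_phi k * (\<integral>y. \<bar>W y\<bar> \<partial>path_law)"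
      if W: "W \<in> borel_measurable (past path_law coord)" "\<And>y. \<bar>W y\<bar> \<le> K" and k: "1 \<le> k" for W K k t
    proof -
      have "min_phi k \<in> phi_coeff M Y ` {1..k}"
        unfolding min_phi_def using k by (auto intro!: Min_in)
      then obtain j where "j \<in> {1..k}" "min_phi k = phi_coeff M Y j" by blast
      then show ?thesis using mixing_path_law[OF W, of j k t] by simp
    qed
    have "P.prob {y. \<bar>y 0\<bar> > t} = prob {\<omega> \<in> space M. \<bar>Y 0 \<omega>\<bar> > t}" for t
    proof -
      have "{y \<in> space path_space. \<bar>y 0\<bar> > t} \<in> sets path_space" by measurable
      then have "{y. \<bar>y 0\<bar> > t} \<in> sets path_space" by (simp add: space_PiM)
      from measure_path_law[OF this] show ?thesis by (simp add: path_of_def)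
    qed
    then show "set_integrable lborel {0..} (\<lambda>t. sqrt (P.prob {y. \<bar>y 0\<bar> > t}))"
      using tail_integrable by simp
  qed
qed

lemma empirical_process_eq: "empirical_process M Y n \<omega> = path.fproc n (path_of Y \<omega>)"
proof
  fix t
  show "empirical_process M Y n \<omega> t = path.fproc n (path_of Y \<omega>) t"
  proof (cases "n = 0")
    \<comment> \<open>For \<open>n = 0\<close> both sides vanish, one through the factor
      \<open>sqrt 0\<close>, the other through the empty sum.\<close>
    case True
    then show ?thesis by (simp add: empirical_process_def path.fproc_def)
  next
    case False
    have "(\<Sum>i=1..n. path.ev t (Y (int i) \<omega>)) = (\<Sum>i=1..n. indicat_real {..t} (Y (int i) \<omega>)) - real n * distr_fun M Y t"
      by (simp add: path.ev_def distr_fun_path_law sum_subtractf)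
    moreover have "sqrt (real n) * (1 / real n * b - f) = (b - real n * f) / sqrt (real n)" for b f
    proof -
      have "sqrt (real n) * (1 / real n * b - f) = (b - real n * f) * (sqrt (real n) / real n)"
        using False by (simp add: field_simps)
      also have "sqrt (real n) / real n = 1 / sqrt (real n)"
        using False by (simp add: real_div_sqrt field_simps)
      finally show ?thesis by simp
    qed
    ultimately show ?thesis
      by (simp only: empirical_process_def path.fproc_def empirical_df_def path_of_def)
  qed
qed

end

text \<open>Divergent series and integrals take default values, and \<open>l1_class\<close> is
  meaningful for integrable arguments only. The first three conclusions certify that the random
  elements, the series in \<open>C_kernel\<close> and the integrals \<open>Phi\<close> are genuine,
  so that the last one carries its intended meaning.\<close>

theorem proposition3p2:
  fixes M :: "'a measure" and Y :: "int \<Rightarrow> 'a \<Rightarrow> real"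
  assumes "prob_space M"
    and "\<And>i. Y i \<in> borel_measurable M"
    and "stationary M Y"
    and "ergodic M Y"
    and "summable (\<lambda>k. sqrt (phi_coeff M Y (Suc k) / real (Suc k)))"
    and "set_integrable lborel {0..} (\<lambda>t. sqrt (measure M {\<omega> \<in> space M. \<bar>Y 0 \<omega>\<bar> > t}))"
  shows "(\<forall>n. \<forall>\<omega>\<in>space M. integrable lborel (empirical_process M Y n \<omega>)) \<and>
    (\<forall>s t. summable (\<lambda>k. lag_cov M Y (Suc k) s t)) \<and>
    (\<forall>f\<in>Linfty. \<forall>g\<in>Linfty. integrable (lborel \<Otimes>\<^sub>M lborel) (Phi_integrand M Y f g)) \<and>
    (\<exists>\<mu> :: l1 measure.
      centered_gaussian_law \<mu> \<and>
      (\<forall>f\<in>Linfty. \<forall>g\<in>Linfty.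
        (\<integral>x. Linfty_act f x * Linfty_act g x \<partial>\<mu>) = Phi_sym M Y f g) \<and>
      converges_in_law M (\<lambda>n \<omega>. l1_class (empirical_process M Y n \<omega>)) \<mu>)"
proof -
  interpret phi_mixing_process M Y
    using assms by (auto intro!: phi_mixing_process.intro phi_mixing_process_axioms.intro)
  show ?thesis
  proof (intro conjI allI ballI)
    show "integrable lborel (empirical_process M Y n \<omega>)" for n \<omega>
      unfolding empirical_process_eq by (rule path.fproc_integrable)
    show "summable (\<lambda>k. lag_cov M Y (Suc k) s t)" for s t
      using path.gam_summable[of s t] by (simp only: path.lag_cov_eq[symmetric] lag_cov_path_law)
    show "integrable (lborel \<Otimes>\<^sub>M lborel) (Phi_integrand M Y f g)" if "f \<in> Linfty" "g \<in> Linfty" for f g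
      using path.Phi_integrable[OF that] by (simp only: Phi_path_law)
    show "\<exists>\<mu> :: l1 measure.
        centered_gaussian_law \<mu> \<and>
        (\<forall>f\<in>Linfty. \<forall>g\<in>Linfty.
          (\<integral>x. Linfty_act f x * Linfty_act g x \<partial>\<mu>) = Phi_sym M Y f g) \<and>
        converges_in_law M (\<lambda>n \<omega>. l1_class (empirical_process M Y n \<omega>)) \<mu>"
    proof (rule path.path_limit)
      fix \<mu> :: "l1 measure"
      assume cg: "centered_gaussian_law \<mu>"
        and cov: "\<And>f g. f \<in> Linfty \<Longrightarrow> g \<in> Linfty \<Longrightarrow> (\<integral>x. Linfty_act f x * Linfty_act g x \<partial>\<mu>) = Phi_sym path_law coord f g"
        and lim: "\<And>h L K. (\<And>x y. \<bar>h x - h y\<bar> \<le> L * dist x y) \<Longrightarrow> (\<And>x. \<bar>h x\<bar> \<le> K) \<Longrightarrow>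
          (\<lambda>n. \<integral>y. h (l1_class (path.fproc n y)) \<partial>path_law) \<longlonglongrightarrow> (\<integral>x. (h x :: real) \<partial>\<mu>)"
      have X: "(\<lambda>\<omega>. l1_class (empirical_process M Y n \<omega>)) \<in> borel_measurable M" for n
        unfolding empirical_process_eq by (rule measurable_compose[OF path_meas path.fproc_class_measurable])
      have "converges_in_law M (\<lambda>n \<omega>. l1_class (empirical_process M Y n \<omega>)) \<mu>"
      proof (rule converges_in_law_lipschitzI[OF prob_space_axioms _ _ X])
        show "prob_space \<mu>" "sets \<mu> = sets borel" using cg by (auto simp: centered_gaussian_law_def)
        fix h :: "l1 \<Rightarrow> real" and L K
        assume h: "\<And>x y. \<bar>h x - h y\<bar> \<le> L * dist x y" "\<And>x. \<bar>h x\<bar> \<le> K"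
        have hc: "continuous_on UNIV h" by (rule continuous_on_of_dist_le[OF h(1)])
        have "(\<integral>y. h (l1_class (path.fproc n y)) \<partial>path_law) = (\<integral>\<omega>. h (l1_class (empirical_process M Y n \<omega>)) \<partial>M)" for n
        proof -
          have "(\<lambda>y. h (l1_class (path.fproc n y))) \<in> borel_measurable path_law"
            using measurable_compose[OF path.fproc_class_measurable borel_measurable_continuous_onI[OF hc]]
            by (simp cong: measurable_cong_sets add: sets_path_law)
          then show ?thesis by (simp only: integral_path_law empirical_process_eq)
        qed
        then show "(\<lambda>n. \<integral>\<omega>. h (l1_class (empirical_process M Y n \<omega>)) \<partial>M) \<longlonglongrightarrow> (\<integral>x. h x \<partial>\<mu>)"
          using lim[OF h] by simp
      qed
      then show ?thesis using cg cov by (intro exI[of _ \<mu>]) (simp add: Phi_path_law)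
    qed
  qed
qed

end
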